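(* Let $w$ be a majorant and let $\mathcal{B}_0(w)$ denote the corresponding Bloch-type space. Then there exists a set $E\subset\partial\mathbb{D}$ of positive Lebesgue measure which satisfies the SA-property with respect to $\mathcal{B}_0(w)$ if and only if $$\int_0^1 \frac{w^2(t)}{t}\,dt = \infty .$$ If this condition does not hold, then any set of positive Lebesgue measure in $\partial\mathbb{D}$ is a set of rigidity for $\mathcal{B}_0(w)$.
   Context: $\mathbb{D}$ is the open unit disc, $\partial\mathbb{D}$ the unit circle, $m$ normalized Lebesgue measure on $\partial\mathbb{D}$. "Set" means Lebesgue measurable subset of $\partial\mathbb{D}$. $L^\infty(E)$ is the space of essentially bounded functions on $E$, with its weak-star topology as dual of $L^1(E)$. A majorant is a continuous non-decreasing function $w$ on $[0,1]$, positive on $(0,1]$, for which there is a number $0<\alpha<1$ such that $w(t)/t^\alpha$ increases up to $\infty$ as $t\to0+$ (constants are allowed). $\mathcal{B}_0(w)$ is the Banach space of holomorphic $f$ in $\mathbb{D}$ with $\lim_{|z|\to1-}\frac{1-|z|}{w(1-|z|)}f'(z)=0$, with norm $\|f\|_{\mathcal{B}(w)}=|f(0)|+\sup_{z\in\mathbb{D}}\frac{1-|z|}{w(1-|z|)}|f'(z)|$; equivalently, the closure of the analytic polynomials in this norm. For a Banach space $X$ of holomorphic functions in $\mathbb{D}$, continuously embedded in the space of all holomorphic functions on $\mathbb{D}$ (uniform convergence on compacts) and containing the analytic polynomials as a dense subset, and a set $E\subseteq\partial\mathbb{D}$, $\mathcal{P}_E(X)$ is the closure of $\{(Q,Q):Q\text{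 analytic polynomial}\}$ in $X\oplus L^\infty(E)$, with the norm topology on $X$ and the weak-star topology on $L^\infty(E)$. $E$ satisfies the SA-property with respect to $X$ if $\mathcal{P}_E(X)=X\oplus L^\infty(E)$. $E$ is a set of rigidity for $X$ if the projection $X\oplus L^\infty(E)\to X$ restricted to $\mathcal{P}_E(X)$ is injective. *)

theory Defs
  imports "HOL-Analysis.Analysis" "HOL-Computational_Algebra.Polynomial"
begin

abbreviation unit_disc :: "complex set" where
  "unit_disc \<equiv> ball 0 1"

text \<open>Normalized Lebesgue measure on the unit circle. The completion makes the measurable sets
  exactly the Lebesgue measurable subsets of the circle, not only the Borel ones.\<close>

definition circle_measure :: "complex measure" where
  "circle_measure =
     completion (distr (uniform_measure lborel {0..1}) (restrict_space borel (sphere 0 1))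
                       (\<lambda>t::real. cis (2 * pi * t)))"

definition majorant :: "(real \<Rightarrow> real) \<Rightarrow> bool" where
  "majorant w \<longleftrightarrow>
     continuous_on {0..1} w \<and> mono_on {0..1} w \<and> (\<forall>t\<in>{0<..1}. 0 < w t) \<and>
     (\<exists>\<alpha>. 0 < \<alpha> \<and> \<alpha> < 1 \<and>
        antimono_on {0<..1} (\<lambda>t. w t / t powr \<alpha>) \<and>
        filterlim (\<lambda>t. w t / t powr \<alpha>) at_top (at_right 0))"

text \<open>A function on the disc is represented by the total function that is \<^term>\<open>undefined\<close>
  outside the disc, so that equality of representatives is equality on the disc.\<close>

definition bloch0 :: "(real \<Rightarrow> real) \<Rightarrow> (complex \<Rightarrow> complex) set" where
  "bloch0 w = {f \<in> extensional unit_disc. f holomorphic_on unit_disc \<and>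
     ((\<lambda>z. of_real ((1 - norm z) / w (1 - norm z)) * deriv f z) \<longlongrightarrow> 0)
       (filtercomap norm (at_left 1))}"

definition bloch_norm :: "(real \<Rightarrow> real) \<Rightarrow> (complex \<Rightarrow> complex) \<Rightarrow> real" where
  "bloch_norm w f =
     norm (f 0) + (SUP z\<in>unit_disc. (1 - norm z) / w (1 - norm z) * norm (deriv f z))"

text \<open>The distance is cut off outside \<open>X\<close> because the locale \<^locale>\<open>Metric_space\<close> demands
  nonnegativity for all arguments, and the supremum in \<^const>\<open>bloch_norm\<close> is
  unspecified for functions of infinite norm. The topology is not affected.\<close>

definition norm_topology ::
  "(complex \<Rightarrow> complex) set \<Rightarrow> ((complex \<Rightarrow> complex) \<Rightarrow> real) \<Rightarrow> (complex \<Rightarrow> complex) topology" where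
  "norm_topology X N = Metric_space.mtopology X
     (\<lambda>f g. if f \<in> X \<and> g \<in> X then N (\<lambda>z. f z - g z) else 0)"

text \<open>The elements of $L^\infty(E)$ are classes of essentially bounded functions modulo equality
  almost everywhere on $E$; the values of a representative off $E$ are irrelevant.\<close>

definition ess_bounded :: "complex set \<Rightarrow> (complex \<Rightarrow> complex) set" where
  "ess_bounded E = {g \<in> borel_measurable (restrict_space circle_measure E).
     \<exists>C. AE z in restrict_space circle_measure E. norm (g z) \<le> C}"

definition ae_eq :: "complex set \<Rightarrow> ((complex \<Rightarrow> complex) \<times> (complex \<Rightarrow> complex)) set" where
  "ae_eq E = {(g, h). g \<in> ess_bounded E \<and> h \<in> ess_bounded E \<and>
     (AE z in restrict_space circle_measure E. g z = h z)}"

definition Linf :: "complex set \<Rightarrow> (complex \<Rightarrow> complex) set set" where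
  "Linf E = ess_bounded E // ae_eq E"

definition Linf_class :: "complex set \<Rightarrow> (complex \<Rightarrow> complex) \<Rightarrow> (complex \<Rightarrow> complex) set" where
  "Linf_class E g = ae_eq E `` {g}"

text \<open>The pairing of $L^1(E)$ with $L^\infty(E)$; its value does not depend on the representative
  chosen.\<close>

definition pairing :: "complex set \<Rightarrow> (complex \<Rightarrow> complex) \<Rightarrow> (complex \<Rightarrow> complex) set \<Rightarrow> complex" where
  "pairing E \<phi> G = (LINT z|restrict_space circle_measure E. \<phi> z * (SOME g. g \<in> G) z)"

definition weak_star_topology :: "complex set \<Rightarrow> (complex \<Rightarrow> complex) set topology" where
  "weak_star_topology E = topology_generated_by
     {{G \<in> Linf E. pairing E \<phi> G \<in> U} | \<phi> U.
        integrable (restrict_space circle_measure E) \<phi> \<and> open U}"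

text \<open>In the following three definitions \<open>X\<close> is the carrier of a Banach space of holomorphic
  functions in the disc and \<open>N\<close> its norm; \<open>poly_closure X N E\<close> is $\mathcal{P}_E(X)$.\<close>

definition poly_closure ::
  "(complex \<Rightarrow> complex) set \<Rightarrow> ((complex \<Rightarrow> complex) \<Rightarrow> real) \<Rightarrow> complex set \<Rightarrow>
     ((complex \<Rightarrow> complex) \<times> (complex \<Rightarrow> complex) set) set" where
  "poly_closure X N E =
     prod_topology (norm_topology X N) (weak_star_topology E) closure_of
       {(restrict (poly Q) unit_disc, Linf_class E (poly Q)) | Q :: complex poly. True}"

definition SA_property ::
  "(complex \<Rightarrow> complex) set \<Rightarrow> ((complex \<Rightarrow> complex) \<Rightarrow> real) \<Rightarrow> complex set \<Rightarrow> bool" where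
  "SA_property X N E \<longleftrightarrow> poly_closure X N E = X \<times> Linf E"

definition rigidity_set ::
  "(complex \<Rightarrow> complex) set \<Rightarrow> ((complex \<Rightarrow> complex) \<Rightarrow> real) \<Rightarrow> complex set \<Rightarrow> bool" where
  "rigidity_set X N E \<longleftrightarrow> inj_on fst (poly_closure X N E)"

end

theory Submission
  imports Defs "HOL-Complex_Analysis.Complex_Analysis" "HOL-Probability.Probability_Measure" "HOL-Real_Asymp.Real_Asymp"
begin

text \<open>If the integral converges, integrate Parseval's identity for \<open>Q'\<close> on the circle of radius
  \<open>1 - t\<close> against \<open>t dt\<close>: the Bloch norm of a polynomial \<open>Q\<close> dominates its $L^2$ norm on the circle.
  Hence the first coordinate of an element of the closure determines the second one.

  If the integral diverges, then $\sum_k w(2^{-k})^2 = \infty$, and it suffices to find polynomials of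
  small Bloch norm that are close to 1 off a set of small measure. They come from a holomorphic
  martingale: start at a large constant \<open>L\<close> and repeatedly add \<open>T(z) \<Sum> b_k z^(2^k)\<close>, where
  \<open>0 \<le> b_k \<le> \<delta> w(2^-k)\<close>, the sum of the \<open>b_k^2\<close> is a fixed number, and the frequencies are so high that
  the new sum is orthogonal to whatever was built before. The factor \<open>T\<close> is a trigonometric polynomial
  close to a cutoff function of the current polynomial \<open>Z\<close>, so that the motion stops where
  \<open>|Z|^2 \<le> 1/a\<close>. To second order the mean of \<open>(1 + |Z|^2)^(-a)\<close> grows with the Laplacian of this
  function, which is positive for \<open>|Z|^2 > 1/a\<close>; it grows by a fixed amount as long as
  \<open>2/a \<le> |Z|^2 \<le> K\<close> on a set that is not small, so this happens finitely often. When \<open>a\<close> is small,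
  most points then have \<open>|Z|^2 < 2/a = (\<epsilon> L)^2\<close>, that is, \<open>(L - Z) / L\<close> is \<open>\<epsilon>\<close>-close to 1.\<close>

text \<open>The motion reaches the small disc because planar Brownian motion is recurrent: for small
  \<open>a\<close>, \<open>(1 + |Z|^2) powr (- a)\<close> is a bounded substitute for
  \<open>1 - a log (1 + |Z|^2)\<close>. As \<open>L^2\<close> is a multiple of \<open>1 / a\<close>
  and a log(1/a) tends to 0, the initial mean is close to 1; it never decreases, so few points can
  escape beyond \<open>K\<close>, where the function is at most 1/2.

  The order of the choices keeps the Bloch norm small. Divergence supplies blocks with the same sum
  of squares and arbitrarily small \<open>\<delta>\<close>, chosen when \<open>T\<close> and its
  constant are known, so a step costs as little norm as desired.

  One set \<open>E\<close> has to serve all functions: its complement is the union of the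
  exceptional sets for all shifts \<open>z ^ d\<close> and all precisions, with summable measures.
  Multiplication by a fixed polynomial is bounded in the Bloch norm, which turns approximations of
  \<open>z^(-d)\<close> into approximations of any trigonometric polynomial.\<close>

abbreviation "\<mu> \<equiv> circle_measure"

abbreviation "\<mu>on E \<equiv> restrict_space circle_measure E"

section \<open>Integration over the circle\<close>

lemma cis_measurable_circle:
  "(\<lambda>t. cis (2 * pi * t)) \<in> measurable (uniform_measure lborel {0..1}) (restrict_space borel (sphere 0 1))"
proof -
  have "(\<lambda>t. cis (2 * pi * t)) \<in> borel_measurable borel"
    by (intro borel_measurable_continuous_onI continuous_intros)
  then have "(\<lambda>t. cis (2 * pi * t)) \<in> measurable borel (restrict_space borel (sphere 0 1))"
    by (intro measurable_restrict_space2) auto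
  then show ?thesis
    by (subst measurable_cong_sets[of _ borel]) auto
qed

lemma prob_space_uniform01: "prob_space (uniform_measure lborel {0..1::real})"
  by (rule prob_space_uniform_measure) auto

lemma space_circle_measure [simp]: "space \<mu> = sphere 0 1"
  by (simp add: circle_measure_def space_restrict_space)

interpretation circle: prob_space \<mu>
  unfolding circle_measure_def
  by (intro prob_space.prob_space_completion prob_space.prob_space_distr prob_space_uniform01 cis_measurable_circle)

lemma continuous_on_circle_measurable:
  fixes f :: "complex \<Rightarrow> 'b :: topological_space"
  assumes "continuous_on (sphere 0 1) f"
  shows "f \<in> borel_measurable \<mu>"
  unfolding circle_measure_def
  using borel_measurable_continuous_on_restrict[OF assms]
  by (intro measurable_completion) simp

lemma continuous_on_circle_bounded:
  fixes f :: "complex \<Rightarrow> 'b :: real_normed_vector"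
  assumes "continuous_on (sphere 0 1) f"
  obtains C where "C > 0" "\<And>z. z \<in> sphere 0 1 \<Longrightarrow> norm (f z) \<le> C"
  using compact_imp_bounded[OF compact_continuous_image[OF assms compact_sphere]]
  unfolding bounded_pos by auto

lemma continuous_on_circle_integrable:
  fixes f :: "complex \<Rightarrow> 'b :: {banach, second_countable_topology}"
  assumes "continuous_on (sphere 0 1) f"
  shows "integrable \<mu> f"
proof -
  obtain C where "\<And>z. z \<in> sphere 0 1 \<Longrightarrow> norm (f z) \<le> C"
    using continuous_on_circle_bounded[OF assms] by blast
  then show ?thesis
    by (intro circle.integrable_const_bound[of _ C] continuous_on_circle_measurable assms AE_I2) auto
qed

lemma uniform_measure01_eq: "uniform_measure lborel {0..1::real} = density lborel (indicator {0..1})"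
proof -
  have "x / (1::ennreal) = x" for x by (simp add: divide_ennreal_def)
  then show ?thesis by (simp add: uniform_measure_def)
qed

lemma integral_circle_measure:
  fixes f :: "complex \<Rightarrow> complex"
  assumes "continuous_on (sphere 0 1) f"
  shows "(LINT z|\<mu>. f z) = (LINT t:{0..1}|lborel. f (cis (2 * pi * t)))"
proof -
  have m: "f \<in> borel_measurable (restrict_space borel (sphere 0 1))"
    by (rule borel_measurable_continuous_on_restrict[OF assms])
  have m2: "(\<lambda>t. f (cis (2 * pi * t))) \<in> borel_measurable lborel"
    using measurable_compose[OF cis_measurable_circle m] by simp
  have "(LINT z|\<mu>. f z) = (LINT t|uniform_measure lborel {0..1}. f (cis (2 * pi * t)))"
    unfolding circle_measure_def using m
    by (subst integral_completion) (auto intro!: integral_distr cis_measurable_circle)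
  also have "\<dots> = (LINT t|density lborel (\<lambda>t. ennreal (indicator {0..1} t)). f (cis (2 * pi * t)))"
    by (simp add: uniform_measure01_eq ennreal_indicator)
  also have "\<dots> = (LINT t:{0..1}|lborel. f (cis (2 * pi * t)))"
    unfolding set_lebesgue_integral_def using m2
    by (subst integral_density) auto
  finally show ?thesis .
qed

lemma integral_circle_power: 
  assumes "n > 0"
  shows "(LINT z|\<mu>. z ^ n) = 0"
proof -
  have "(LINT z|\<mu>. z ^ n) = (LINT t:{0..1}|lborel. cis (2 * pi * t) ^ n)"
    by (rule integral_circle_measure) (intro continuous_intros)
  also have "\<dots> = (LINT t:{0..1}|lborel. cis (2 * pi * n * t))"
    by (simp add: Complex.DeMoivre mult_ac)
  also have "\<dots> = cis (2 * pi * n * 1) / (\<i> * (2 * pi * n)) - cis (2 * pi * n * 0) / (\<i> * (2 * pi * n))"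
    unfolding set_lebesgue_integral_def
  proof (rule integral_FTC_Icc)
    show "((\<lambda>t. cis (2 * pi * n * t) / (\<i> * (2 * pi * n))) has_vector_derivative cis (2 * pi * n * x)) 
       (at x within {0..1})" for x
    proof -
      have "((\<lambda>z. exp (\<i> * (2 * pi * n) * z) / (\<i> * (2 * pi * n))) has_field_derivative
               exp (\<i> * (2 * pi * n) * of_real x)) (at (of_real x))"
        using assms by (auto intro!: derivative_eq_intros)
      from has_vector_derivative_real_field[OF this] show ?thesis
        by (simp add: cis_conv_exp mult_ac)
    qed
  qed (auto intro!: continuous_intros)
  also have "cis (2 * pi * n * 1) = 1"
    using cis_multiple_2pi[of "of_nat n"] by (auto simp: mult_ac)
  finally show ?thesis by simp
qed

section \<open>Trigonometric polynomials\<close>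

text \<open>Laurent polynomials, seen only on the circle. Clearing the denominator by
  \<open>z ^ d\<close> is the form used later: multiplied by a power above \<open>d\<close>, the
  function becomes an analytic polynomial.\<close>

definition trig_poly :: "(complex \<Rightarrow> complex) \<Rightarrow> bool" where
  "trig_poly f \<longleftrightarrow> (\<exists>d p. \<forall>z\<in>sphere 0 1. f z * z ^ d = poly p z)"

lemma trig_poly_const: "trig_poly (\<lambda>z. c)"
  unfolding trig_poly_def by (rule exI[of _ 0], rule exI[of _ "[:c:]"]) simp

lemma trig_poly_ident: "trig_poly (\<lambda>z. z)"
  unfolding trig_poly_def by (rule exI[of _ 0], rule exI[of _ "[:0, 1:]"]) simp

lemma cnj_mult_self_circle: "z \<in> sphere 0 1 \<Longrightarrow> cnj z * z = 1"
  using complex_norm_square[of z] by (simp add: mult.commute)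

lemma trig_poly_cnj_ident: "trig_poly cnj"
  unfolding trig_poly_def
  by (rule exI[of _ 1], rule exI[of _ "[:1:]"]) (simp add: cnj_mult_self_circle)

lemma trig_poly_add:
  assumes "trig_poly f" "trig_poly g"
  shows "trig_poly (\<lambda>z. f z + g z)"
proof -
  obtain d p e q where p: "\<forall>z\<in>sphere 0 1. f z * z ^ d = poly p z"
    and q: "\<forall>z\<in>sphere 0 1. g z * z ^ e = poly q z"
    using assms unfolding trig_poly_def by blast
  have "(f z + g z) * z ^ (d + e) = poly (p * monom 1 e + q * monom 1 d) z" if "z \<in> sphere 0 1" for z
  proof -
    have "(f z + g z) * z ^ (d + e) = (f z * z ^ d) * z ^ e + (g z * z ^ e) * z ^ d"
      by (simp add: algebra_simps power_add)
    then show ?thesis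
      using p[rule_format, OF that] q[rule_format, OF that] by (simp add: poly_monom)
  qed
  then show ?thesis unfolding trig_poly_def by blast
qed

lemma trig_poly_mult:
  assumes "trig_poly f" "trig_poly g"
  shows "trig_poly (\<lambda>z. f z * g z)"
proof -
  obtain d p e q where p: "\<forall>z\<in>sphere 0 1. f z * z ^ d = poly p z"
    and q: "\<forall>z\<in>sphere 0 1. g z * z ^ e = poly q z"
    using assms unfolding trig_poly_def by blast
  have "(f z * g z) * z ^ (d + e) = poly (p * q) z" if "z \<in> sphere 0 1" for z
  proof -
    have "(f z * g z) * z ^ (d + e) = (f z * z ^ d) * (g z * z ^ e)"
      by (simp add: algebra_simps power_add)
    then show ?thesis
      using p[rule_format, OF that] q[rule_format, OF that] by simp
  qed
  then show ?thesis unfolding trig_poly_def by blast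
qed

text \<open>Polynomials in Re and Im are polynomials in \<open>z\<close> and \<open>cnj z\<close>,
  and on the circle \<open>cnj z\<close> is \<open>1 / z\<close>. This makes the real
  Stone-Weierstrass theorem available.\<close>

lemma trig_poly_real_polynomial_function:
  fixes g :: "complex \<Rightarrow> real"
  assumes "real_polynomial_function g"
  shows "trig_poly (\<lambda>z. of_real (g z))"
  using assms
proof (induction g rule: real_polynomial_function.induct)
  case (linear f)
  interpret bounded_linear f by fact
  have lin: "f z = Re z * f 1 + Im z * f \<i>" for z
  proof -
    have "f z = f (Re z *\<^sub>R 1 + Im z *\<^sub>R \<i>)"
      by (rule arg_cong[of _ _ f]) (simp add: complex_eq_iff)
    then show ?thesis by (simp only: add scaleR real_scaleR_def)
  qed
  have "of_real (f z) = (z + cnj z) * (1 / 2) * of_real (f 1) + (z + (- 1) * cnj z) * (1 / (2 * \<i>)) * of_real (f \<i>)" for z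
  proof -
    have "complex_of_real (f z) = of_real (Re z) * of_real (f 1) + of_real (Im z) * of_real (f \<i>)"
      by (subst lin) (simp only: of_real_add of_real_mult)
    moreover have "of_real (Re z) = (z + cnj z) * (1 / 2)" "of_real (Im z) = (z + (- 1) * cnj z) * (1 / (2 * \<i>))"
      by (simp_all add: complex_eq_iff)
    ultimately show ?thesis by (simp only:)
  qed
  then have eq: "(\<lambda>z. complex_of_real (f z)) =
      (\<lambda>z. (z + cnj z) * (1 / 2) * of_real (f 1) + (z + (- 1) * cnj z) * (1 / (2 * \<i>)) * of_real (f \<i>))"
    by (rule ext)
  show ?case
    by (subst eq) (intro trig_poly_const trig_poly_ident trig_poly_cnj_ident trig_poly_add trig_poly_mult)
next
  case (const c)
  show ?case by (rule trig_poly_const)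
next
  case (add f g)
  then show ?case using trig_poly_add by simp
next
  case (mult f g)
  then show ?case using trig_poly_mult by simp
qed

lemma trig_poly_continuous_on:
  assumes "trig_poly f"
  shows "continuous_on (sphere 0 1) f"
proof -
  obtain d p where p: "\<forall>z\<in>sphere 0 1. f z * z ^ d = poly p z"
    using assms unfolding trig_poly_def by blast
  have "continuous_on (sphere 0 1) (\<lambda>z. poly p z / z ^ d)"
    by (intro continuous_intros) auto
  moreover have "poly p z / z ^ d = f z" if "z \<in> sphere 0 1" for z
  proof -
    have "z ^ d \<noteq> 0" using that by auto
    then show ?thesis using p[rule_format, OF that] by (simp add: field_simps)
  qed
  ultimately show ?thesis by (rule continuous_on_eq)
qed

text \<open>The approximant stays a real polynomial function: real values are needed for the cutoff
  factor and for the coefficient \<open>F3\<close> in the energy estimate.\<close>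

lemma trig_poly_approx_real:
  fixes f :: "complex \<Rightarrow> real"
  assumes "continuous_on (sphere 0 1) f" "e > 0"
  obtains g where "real_polynomial_function g" "\<And>z. z \<in> sphere 0 1 \<Longrightarrow> \<bar>f z - g z\<bar> < e"
  using Stone_Weierstrass_real_polynomial_function[OF compact_sphere assms] by blast

lemma trig_poly_approx:
  fixes f :: "complex \<Rightarrow> complex"
  assumes "continuous_on (sphere 0 1) f" "e > 0"
  obtains g where "trig_poly g" "\<And>z. z \<in> sphere 0 1 \<Longrightarrow> norm (f z - g z) < e"
proof -
  have "continuous_on (sphere 0 1) (\<lambda>z. Re (f z))" "continuous_on (sphere 0 1) (\<lambda>z. Im (f z))"
    using assms(1) by (intro continuous_intros; assumption)+
  then obtain g h where g: "real_polynomial_function g" "\<And>z. z \<in> sphere 0 1 \<Longrightarrow> \<bar>Re (f z) - g z\<bar> < e / 2"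
    and h: "real_polynomial_function h" "\<And>z. z \<in> sphere 0 1 \<Longrightarrow> \<bar>Im (f z) - h z\<bar> < e / 2"
    using assms(2) by (metis half_gt_zero trig_poly_approx_real)
  show ?thesis
  proof (rule that)
    show "trig_poly (\<lambda>z. of_real (g z) + \<i> * of_real (h z))"
      by (intro trig_poly_add trig_poly_mult trig_poly_const trig_poly_real_polynomial_function g h)
    fix z :: complex assume z: "z \<in> sphere 0 1"
    have "norm (f z - (of_real (g z) + \<i> * of_real (h z))) \<le> \<bar>Re (f z) - g z\<bar> + \<bar>Im (f z) - h z\<bar>"
      using cmod_le[of "f z - (of_real (g z) + \<i> * of_real (h z))"] by simp
    also have "\<dots> < e" using g(2)[OF z] h(2)[OF z] by linarith
    finally show "norm (f z - (of_real (g z) + \<i> * of_real (h z))) < e" .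
  qed
qed

lemma integral_circle_power_poly:
  assumes "n > 0"
  shows "(LINT z|\<mu>. poly p z * z ^ n) = 0"
  using assms
proof (induction p arbitrary: n)
  case 0
  then show ?case by simp
next
  case (pCons a p)
  have "(LINT z|\<mu>. poly (pCons a p) z * z ^ n) =
        (LINT z|\<mu>. a * z ^ n + poly p z * z ^ Suc n)"
    by (simp add: algebra_simps)
  also have "\<dots> = a * (LINT z|\<mu>. z ^ n) + (LINT z|\<mu>. poly p z * z ^ Suc n)"
    by (subst Bochner_Integration.integral_add)
       (auto intro!: continuous_on_circle_integrable continuous_intros)
  also have "\<dots> = 0"
    using integral_circle_power[OF pCons.prems] pCons.IH[of "Suc n"] by simp
  finally show ?case .
qed

text \<open>The frequencies of \<open>f\<close> are bounded below by \<open>- d\<close>; after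
  multiplication by \<open>z ^ n\<close> only positive ones remain, and these have mean 0.\<close>

lemma integral_trig_poly_power:
  assumes "trig_poly f"
  obtains d where "\<And>n. n > d \<Longrightarrow> (LINT z|\<mu>. f z * z ^ n) = 0"
proof -
  obtain d p where p: "\<forall>z\<in>sphere 0 1. f z * z ^ d = poly p z"
    using assms unfolding trig_poly_def by blast
  show ?thesis
  proof (rule that)
    fix n assume n: "n > d"
    have "f z * z ^ n = poly p z * z ^ (n - d)" if "z \<in> sphere 0 1" for z
    proof -
      have "f z * z ^ n = f z * z ^ d * z ^ (n - d)"
        using n by (simp add: mult.assoc flip: power_add)
      then show ?thesis using p[rule_format, OF that] by (simp only:)
    qed
    then have "(LINT z|\<mu>. f z * z ^ n) = (LINT z|\<mu>. poly p z * z ^ (n - d))"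
      by (intro Bochner_Integration.integral_cong) auto
    also have "\<dots> = 0" using n by (intro integral_circle_power_poly) auto
    finally show "(LINT z|\<mu>. f z * z ^ n) = 0" .
  qed
qed

text \<open>Powers of 2 form a Sidon set, which makes fourth moments of lacunary sums comparable to
  squares of second moments. If the larger exponents differed, the larger power alone would be at
  least the whole opposite sum.\<close>

lemma pow2_add_eq:
  fixes j k l m :: nat
  assumes "(2::nat) ^ j + 2 ^ k = 2 ^ l + 2 ^ m"
  shows "(j = l \<and> k = m) \<or> (j = m \<and> k = l)"
proof -
  have *: "j = l \<and> k = m" if "(2::nat) ^ j + 2 ^ k = 2 ^ l + 2 ^ m" "j \<le> k" "l \<le> m" for j k l m :: nat
  proof -
    have max: "k \<le> m" if eq: "(2::nat) ^ j + 2 ^ k = 2 ^ l + 2 ^ m" and "l \<le> m" for j k l m :: nat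
    proof (rule ccontr)
      assume "\<not> k \<le> m"
      then have "(2::nat) ^ Suc m \<le> 2 ^ k" by (intro power_increasing) auto
      moreover have "(2::nat) ^ l \<le> 2 ^ m" using \<open>l \<le> m\<close> by (intro power_increasing) auto
      moreover have "0 < (2::nat) ^ j" by (rule zero_less_power) simp
      moreover have "(2::nat) ^ Suc m = 2 * 2 ^ m" by (rule power_Suc)
      ultimately show False using eq by linarith
    qed
    have "k = m" using max[OF that(1,3)] max[OF that(1)[symmetric] that(2)] by (rule antisym)
    moreover have "(2::nat) ^ j = 2 ^ l" using that(1) unfolding \<open>k = m\<close> by linarith
    then have "j = l" by (simp only: power_inject_exp)
    ultimately show ?thesis by blast
  qed
  have c: "(2::nat) ^ a + 2 ^ b = 2 ^ b + 2 ^ a" for a b :: nat by (rule add.commute)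
  consider "j \<le> k" "l \<le> m" | "j \<le> k" "m \<le> l" | "k \<le> j" "l \<le> m" | "k \<le> j" "m \<le> l" by linarith
  then show ?thesis
  proof cases
    case 1 then show ?thesis using *[of j k l m] assms by blast
  next
    case 2 then show ?thesis using *[of j k m l] assms c[of l m] by metis
  next
    case 3 then show ?thesis using *[of k j l m] assms c[of j k] by metis
  next
    case 4 then show ?thesis using *[of k j m l] assms c[of j k] c[of l m] by metis
  qed
qed

section \<open>Lacunary sums\<close>

lemma measure_circle_sphere [simp]: "measure \<mu> (sphere 0 1) = 1"
  using circle.prob_space by simp

lemma integral_power_cnj_power:
  "(LINT z|\<mu>. z ^ p * cnj z ^ q) = (if p = q then 1 else 0)"
proof -
  have reduce: "z ^ (m + n) * cnj z ^ n = z ^ m" if "z \<in> sphere 0 1" for z m n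
  proof -
    have "z ^ (m + n) * cnj z ^ n = z ^ m * (cnj z * z) ^ n"
      by (simp add: power_add power_mult_distrib)
    then show ?thesis using cnj_mult_self_circle[OF that] by simp
  qed
  have gt: "(LINT z|\<mu>. z ^ p * cnj z ^ q) = 0" if "q < p" for p q
  proof -
    have "(LINT z|\<mu>. z ^ p * cnj z ^ q) = (LINT z|\<mu>. z ^ (p - q))"
      using reduce[of _ "p - q" q] that by (intro Bochner_Integration.integral_cong) auto
    then show ?thesis using integral_circle_power[of "p - q"] that by simp
  qed
  have lt: "(LINT z|\<mu>. z ^ p * cnj z ^ q) = 0" if "p < q"
  proof -
    have "(LINT z|\<mu>. z ^ p * cnj z ^ q) = (LINT z|\<mu>. cnj (z ^ q * cnj z ^ p))"
      by (simp add: mult.commute)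
    also have "\<dots> = cnj (LINT z|\<mu>. z ^ q * cnj z ^ p)"
      by (rule Bochner_Integration.integral_cnj)
    finally show ?thesis using gt[OF that] by simp
  qed
  have eq: "(LINT z|\<mu>. z ^ p * cnj z ^ p) = 1"
  proof -
    have "(LINT z|\<mu>. z ^ p * cnj z ^ p) = (LINT z|\<mu>. 1)"
      using reduce[of _ 0 p] by (intro Bochner_Integration.integral_cong) auto
    then show ?thesis by (simp add: circle.prob_space)
  qed
  show ?thesis using gt lt eq by (cases p q rule: linorder_cases) auto
qed

text \<open>The frequencies \<open>n i\<close> may repeat, hence the double sum. Repetition occurs
  for squares of lacunary sums, which are indexed by pairs.\<close>

lemma integral_norm_square_sum_powers:
  fixes c :: "'i \<Rightarrow> complex" and n :: "'i \<Rightarrow> nat"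
  assumes "finite S"
  shows "(LINT z|\<mu>. (norm (\<Sum>i\<in>S. c i * z ^ n i))^2) =
         (\<Sum>i\<in>S. \<Sum>j\<in>S. if n i = n j then Re (c i * cnj (c j)) else 0)"
proof -
  have "complex_of_real (LINT z|\<mu>. (norm (\<Sum>i\<in>S. c i * z ^ n i))^2) =
        (LINT z|\<mu>. complex_of_real ((norm (\<Sum>i\<in>S. c i * z ^ n i))^2))"
    by (rule integral_complex_of_real[symmetric])
  also have "\<dots> = (LINT z|\<mu>. (\<Sum>i\<in>S. \<Sum>j\<in>S. c i * cnj (c j) * (z ^ n i * cnj z ^ n j)))"
    by (intro Bochner_Integration.integral_cong)
       (simp_all only: complex_norm_square cnj_sum complex_cnj_mult complex_cnj_power sum_product mult_ac)
  also have "\<dots> = (\<Sum>i\<in>S. \<Sum>j\<in>S. c i * cnj (c j) * (LINT z|\<mu>. z ^ n i * cnj z ^ n j))"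
    by (subst Bochner_Integration.integral_sum
        | intro sum.cong refl continuous_on_circle_integrable continuous_intros integral_mult_right_zero)+
  also have "\<dots> = (\<Sum>i\<in>S. \<Sum>j\<in>S. if n i = n j then c i * cnj (c j) else 0)"
    by (intro sum.cong refl) (simp add: integral_power_cnj_power)
  finally have "Re (complex_of_real (LINT z|\<mu>. (norm (\<Sum>i\<in>S. c i * z ^ n i))^2)) =
      Re (\<Sum>i\<in>S. \<Sum>j\<in>S. if n i = n j then c i * cnj (c j) else 0)"
    by (rule arg_cong)
  also have "\<dots> = (\<Sum>i\<in>S. \<Sum>j\<in>S. if n i = n j then Re (c i * cnj (c j)) else 0)"
    unfolding Re_sum by (intro sum.cong refl) auto
  finally show ?thesis by (simp only: Re_complex_of_real)
qed

lemma parseval_circle: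
  assumes "finite S"
  shows "(LINT z|\<mu>. (norm (\<Sum>k\<in>S. c k * z ^ k))^2) = (\<Sum>k\<in>S. (norm (c k))^2)"
proof -
  have "(\<Sum>j\<in>S. if i = j then Re (c i * cnj (c j)) else 0) = (norm (c i))^2" if "i \<in> S" for i
    using assms that by (simp add: cmod_power2 power2_eq_square[of "Re _"] power2_eq_square[of "Im _"])
  then show ?thesis
    by (subst integral_norm_square_sum_powers[OF assms]) simp
qed

text \<open>The index is the dyadic exponent, not the frequency: \<open>b k\<close> will be compared
  with the majorant at distance \<open>1 / 2 ^ k\<close> from the circle, the scale that belongs to
  \<open>z ^ (2 ^ k)\<close>.\<close>

definition lacunary :: "(nat \<Rightarrow> real) \<Rightarrow> nat set \<Rightarrow> complex \<Rightarrow> complex" where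
  "lacunary b A z = (\<Sum>k\<in>A. of_real (b k) * z ^ (2 ^ k))"

lemma continuous_on_lacunary [continuous_intros]:
  "continuous_on S f \<Longrightarrow> continuous_on S (\<lambda>z. lacunary b A (f z))"
  unfolding lacunary_def by (intro continuous_intros)

lemma integral_lacunary_square:
  assumes "finite A"
  shows "(LINT z|\<mu>. (norm (lacunary b A z))^2) = (\<Sum>k\<in>A. (b k)^2)"
proof -
  have "(\<Sum>j\<in>A. if i = j then b i * b j else 0) = (b i)^2" if "i \<in> A" for i
    using assms that by (simp add: power2_eq_square)
  moreover have "(\<Sum>j\<in>A. if (2::nat) ^ i = 2 ^ j then Re (complex_of_real (b i) * cnj (complex_of_real (b j))) else 0) =
      (\<Sum>j\<in>A. if i = j then b i * b j else 0)" for i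
    by (intro sum.cong refl) auto
  ultimately show ?thesis
    unfolding lacunary_def by (subst integral_norm_square_sum_powers[OF assms]) simp
qed

text \<open>Expand the square into pairs of indices. Two pairs have the same frequency only if they
  are equal or swapped, so each pair is matched by at most two; this is the factor 2.\<close>

lemma integral_lacunary_fourth:
  assumes "finite A" "\<And>k. b k \<ge> 0"
  shows "(LINT z|\<mu>. (norm (lacunary b A z)) ^ 4) \<le> 2 * (\<Sum>k\<in>A. (b k)^2)^2"
proof -
  define c where "c = (\<lambda>x. complex_of_real (b (fst x) * b (snd x)))"
  define n :: "nat \<times> nat \<Rightarrow> nat" where "n = (\<lambda>x. 2 ^ fst x + 2 ^ snd x)"
  have sq: "lacunary b A z * lacunary b A z = (\<Sum>x\<in>A \<times> A. c x * z ^ n x)" for z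
    unfolding lacunary_def sum_product sum.cartesian_product
    by (intro sum.cong refl) (auto simp: c_def n_def power_add)
  have "(norm (lacunary b A z)) ^ 4 = (norm (\<Sum>x\<in>A \<times> A. c x * z ^ n x))^2" for z
    unfolding sq[symmetric] by (simp add: norm_mult power2_eq_square power4_eq_xxxx)
  then have "(LINT z|\<mu>. (norm (lacunary b A z)) ^ 4) =
        (\<Sum>x\<in>A \<times> A. \<Sum>y\<in>A \<times> A. if n x = n y then Re (c x * cnj (c y)) else 0)"
    using assms(1) by (simp add: integral_norm_square_sum_powers)
  \<comment> \<open>On diagonal pairs both summands on the right count the same term, hence only an
    inequality.\<close>
  also have "\<dots> \<le> (\<Sum>x\<in>A \<times> A. \<Sum>y\<in>A \<times> A. (if y = x then (b (fst x))^2 * (b (snd x))^2 else 0) +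
        (if y = prod.swap x then (b (fst x))^2 * (b (snd x))^2 else 0))"
  proof (intro sum_mono)
    fix x y :: "nat \<times> nat"
    have "y = x \<or> y = prod.swap x" if "n x = n y"
      using pow2_add_eq[of "fst x" "snd x" "fst y" "snd y"] that
      unfolding n_def by (cases x; cases y) auto
    then show "(if n x = n y then Re (c x * cnj (c y)) else 0) \<le>
        (if y = x then (b (fst x))^2 * (b (snd x))^2 else 0) +
        (if y = prod.swap x then (b (fst x))^2 * (b (snd x))^2 else 0)"
      using assms(2) by (auto simp: c_def power2_eq_square mult_ac)
  qed
  also have "\<dots> = (\<Sum>x\<in>A \<times> A. 2 * ((b (fst x))^2 * (b (snd x))^2))"
  proof (intro sum.cong refl)
    fix x assume x: "x \<in> A \<times> A"
    then have "prod.swap x \<in> A \<times> A" by auto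
    then show "(\<Sum>y\<in>A \<times> A. (if y = x then (b (fst x))^2 * (b (snd x))^2 else 0) +
        (if y = prod.swap x then (b (fst x))^2 * (b (snd x))^2 else 0)) = 2 * ((b (fst x))^2 * (b (snd x))^2)"
      using x assms(1) by (simp add: sum.distrib)
  qed
  also have "\<dots> = 2 * (\<Sum>k\<in>A. (b k)^2)^2"
  proof -
    have "(\<Sum>k\<in>A. (b k)^2)^2 = (\<Sum>x\<in>A \<times> A. (b (fst x))^2 * (b (snd x))^2)"
      by (simp add: power2_eq_square[of "sum _ _"] sum_product sum.cartesian_product case_prod_unfold)
    then show ?thesis by (simp add: sum_distrib_left)
  qed
  finally show ?thesis .
qed

lemma integral_circle_mono:
  fixes f g :: "complex \<Rightarrow> real"
  assumes "continuous_on (sphere 0 1) f" "continuous_on (sphere 0 1) g" "\<And>z. z \<in> sphere 0 1 \<Longrightarrow> f z \<le> g z"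
  shows "(LINT z|\<mu>. f z) \<le> (LINT z|\<mu>. g z)"
  using assms by (intro integral_mono continuous_on_circle_integrable) auto

text \<open>Instead of Cauchy-Schwarz, the pointwise inequality between arithmetic and geometric
  means with weight \<open>s\<close> is integrated.\<close>

lemma integral_lacunary_norm:
  assumes "finite A" "s > 0" "(\<Sum>k\<in>A. (b k)^2) = s^2"
  shows "(LINT z|\<mu>. norm (lacunary b A z)) \<le> s"
proof -
  have "norm w \<le> s / 2 + (norm w)^2 / (2 * s)" for w :: complex
  proof -
    have "0 \<le> (norm w - s)^2 / (2 * s)" using assms(2) by simp
    also have "\<dots> = s / 2 + (norm w)^2 / (2 * s) - norm w"
      using assms(2) by (simp add: field_simps power2_eq_square)
    finally show ?thesis by simp
  qed
  then have "(LINT z|\<mu>. norm (lacunary b A z)) \<le>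
      (LINT z|\<mu>. s / 2 + (norm (lacunary b A z))^2 / (2 * s))"
    using assms(2) by (intro integral_circle_mono continuous_intros) auto
  also have "\<dots> = s / 2 + (LINT z|\<mu>. (norm (lacunary b A z))^2) / (2 * s)"
    using assms(2)
    by (subst Bochner_Integration.integral_add)
       (auto intro!: continuous_on_circle_integrable continuous_intros simp: circle.prob_space)
  also have "\<dots> = s"
    using assms by (simp add: integral_lacunary_square power2_eq_square[of s])
  finally show ?thesis .
qed

text \<open>Interpolation between the second and the fourth moment: the same weighted inequality,
  multiplied by the square. It yields the constant 3/2, rounded up to 2.\<close>

lemma integral_lacunary_cube:
  assumes "finite A" "\<And>k. b k \<ge> 0" "s > 0" "(\<Sum>k\<in>A. (b k)^2) = s^2"
  shows "(LINT z|\<mu>. (norm (lacunary b A z)) ^ 3) \<le> 2 * s ^ 3"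
proof -
  have "(norm w) ^ 3 \<le> s / 2 * (norm w)^2 + (norm w) ^ 4 / (2 * s)" for w :: complex
  proof -
    have "0 \<le> (norm w)^2 * (norm w - s)^2 / (2 * s)" using assms(3) by simp
    also have "\<dots> = s / 2 * (norm w)^2 + (norm w) ^ 4 / (2 * s) - (norm w) ^ 3"
      using assms(3) by (simp add: field_simps power2_eq_square power3_eq_cube power4_eq_xxxx)
    finally show ?thesis by simp
  qed
  then have "(LINT z|\<mu>. (norm (lacunary b A z)) ^ 3) \<le>
      (LINT z|\<mu>. s / 2 * (norm (lacunary b A z))^2 + (norm (lacunary b A z)) ^ 4 / (2 * s))"
    using assms(3) by (intro integral_circle_mono continuous_intros) auto
  also have "\<dots> = s / 2 * (LINT z|\<mu>. (norm (lacunary b A z))^2) +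
      (LINT z|\<mu>. (norm (lacunary b A z)) ^ 4) / (2 * s)"
    using assms(3)
    by (subst Bochner_Integration.integral_add)
       (auto intro!: continuous_on_circle_integrable continuous_intros)
  also have "\<dots> \<le> s / 2 * s^2 + 2 * (s^2)^2 / (2 * s)"
    using assms integral_lacunary_fourth[of A b]
    by (intro add_mono divide_right_mono) (auto simp: integral_lacunary_square)
  also have "\<dots> \<le> 2 * s ^ 3"
    using assms(3) by (simp add: field_simps power2_eq_square power3_eq_cube)
  finally show ?thesis .
qed

text \<open>One threshold \<open>d\<close> serves every block above it, because \<open>f\<close>
  will be fixed before the block is chosen. Both \<open>lacunary b A\<close> and its square are
  analytic with frequencies above \<open>d\<close> only.\<close>

lemma integral_trig_poly_lacunary:
  assumes "trig_poly f"
  shows "\<exists>d. \<forall>A b. (\<forall>k\<in>A. k > d) \<longrightarrow>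
    (LINT z|\<mu>. f z * lacunary b A z) = 0 \<and>
    (LINT z|\<mu>. f z * (lacunary b A z)^2) = 0"
proof -
  obtain d where d: "\<And>n. n > d \<Longrightarrow> (LINT z|\<mu>. f z * z ^ n) = 0"
    using integral_trig_poly_power[OF assms] by blast
  note cont = trig_poly_continuous_on[OF assms]
  have gt: "d < 2 ^ k" if "d < k" for k :: nat
    using that less_exp[of k] by linarith
  show ?thesis
  proof (intro exI[of _ d] allI impI conjI)
    fix A :: "nat set" and b assume A: "\<forall>k\<in>A. k > d"
    have "(LINT z|\<mu>. f z * lacunary b A z) =
        (LINT z|\<mu>. (\<Sum>k\<in>A. of_real (b k) * (f z * z ^ (2 ^ k))))"
      by (simp add: lacunary_def sum_distrib_left mult_ac)
    also have "\<dots> = (\<Sum>k\<in>A. of_real (b k) * (LINT z|\<mu>. f z * z ^ (2 ^ k)))"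
      by (subst Bochner_Integration.integral_sum
          | intro sum.cong refl continuous_on_circle_integrable continuous_intros cont integral_mult_right_zero)+
    also have "\<dots> = 0"
      using A d gt by (intro sum.neutral) auto
    finally show "(LINT z|\<mu>. f z * lacunary b A z) = 0" .
    have "(LINT z|\<mu>. f z * (lacunary b A z)^2) =
        (LINT z|\<mu>. (\<Sum>j\<in>A. \<Sum>k\<in>A. of_real (b j * b k) * (f z * z ^ (2 ^ j + 2 ^ k))))"
      by (simp add: lacunary_def power2_eq_square sum_product sum_distrib_left power_add mult_ac)
    also have "\<dots> = (\<Sum>j\<in>A. \<Sum>k\<in>A. of_real (b j * b k) * (LINT z|\<mu>. f z * z ^ (2 ^ j + 2 ^ k)))"
      by (subst Bochner_Integration.integral_sum
          | intro sum.cong refl continuous_on_circle_integrable continuous_intros cont integral_mult_right_zero)+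
    also have "\<dots> = 0"
      using A d gt by (intro sum.neutral ballI) (auto simp: trans_less_add1)
    finally show "(LINT z|\<mu>. f z * (lacunary b A z)^2) = 0" .
  qed
qed

text \<open>Against \<open>g\<close>, the function \<open>|lacunary b A|^2\<close> acts like its
  mean: only the diagonal terms survive, since the others have frequencies that \<open>g\<close>
  does not contain.\<close>

lemma integral_real_trig_poly_lacunary:
  fixes g :: "complex \<Rightarrow> real"
  assumes "real_polynomial_function g"
  shows "\<exists>d. \<forall>A b. finite A \<longrightarrow> (\<forall>k\<in>A. k > d) \<longrightarrow>
    (LINT z|\<mu>. g z * (norm (lacunary b A z))^2) = (\<Sum>k\<in>A. (b k)^2) * (LINT z|\<mu>. g z)"
proof -
  define f where "f = (\<lambda>z. complex_of_real (g z))"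
  have f: "trig_poly f" unfolding f_def by (rule trig_poly_real_polynomial_function[OF assms])
  obtain d where d: "\<And>n. n > d \<Longrightarrow> (LINT z|\<mu>. f z * z ^ n) = 0"
    using integral_trig_poly_power[OF f] by blast
  note cont = trig_poly_continuous_on[OF f]
  have off: "(LINT z|\<mu>. f z * (z ^ (2 ^ j) * cnj z ^ (2 ^ k))) = 0" if "k < j" "d < k" for j k :: nat
  proof -
    \<comment> \<open>The gap \<open>2 ^ j - 2 ^ k\<close> is at least the smaller power
      \<open>2 ^ k\<close>, so the frequency of an off-diagonal term stays above
      \<open>d\<close>.\<close>
    have "(2::nat) ^ Suc k \<le> 2 ^ j" using that by (intro power_increasing) auto
    moreover have "d < 2 ^ k" using that less_exp[of k] by linarith
    ultimately have m: "(2::nat) ^ j = (2 ^ j - 2 ^ k) + 2 ^ k" "d < 2 ^ j - 2 ^ k"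
      by auto
    have "f z * (z ^ (2 ^ j) * cnj z ^ (2 ^ k)) = f z * z ^ (2 ^ j - 2 ^ k)" if "z \<in> sphere 0 1" for z
    proof -
      have "z ^ (2 ^ j) * cnj z ^ (2 ^ k) = z ^ (2 ^ j - 2 ^ k) * (cnj z * z) ^ (2 ^ k)"
        by (subst m(1)) (simp add: power_add power_mult_distrib)
      then show ?thesis using cnj_mult_self_circle[OF that] by simp
    qed
    then have "(LINT z|\<mu>. f z * (z ^ (2 ^ j) * cnj z ^ (2 ^ k))) =
        (LINT z|\<mu>. f z * z ^ (2 ^ j - 2 ^ k))"
      by (intro Bochner_Integration.integral_cong) auto
    then show ?thesis using d[OF m(2)] by simp
  qed
  have off': "(LINT z|\<mu>. f z * (z ^ (2 ^ j) * cnj z ^ (2 ^ k))) = 0" if "j < k" "d < j" for j k :: nat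
  proof -
    have "(LINT z|\<mu>. f z * (z ^ (2 ^ j) * cnj z ^ (2 ^ k))) =
        (LINT z|\<mu>. cnj (f z * (z ^ (2 ^ k) * cnj z ^ (2 ^ j))))"
      by (simp add: f_def mult_ac)
    also have "\<dots> = cnj (LINT z|\<mu>. f z * (z ^ (2 ^ k) * cnj z ^ (2 ^ j)))"
      by (rule Bochner_Integration.integral_cnj)
    finally show ?thesis using off[OF that] by simp
  qed
  have diag: "(LINT z|\<mu>. f z * (z ^ n * cnj z ^ n)) = (LINT z|\<mu>. f z)" for n
  proof (intro Bochner_Integration.integral_cong refl)
    fix z :: complex assume "z \<in> space \<mu>"
    then have "(cnj z * z) ^ n = 1" using cnj_mult_self_circle by simp
    then show "f z * (z ^ n * cnj z ^ n) = f z" by (simp add: power_mult_distrib mult_ac)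
  qed
  show ?thesis
  proof (intro exI[of _ d] allI impI)
    fix A :: "nat set" and b assume fin: "finite A" and A: "\<forall>k\<in>A. k > d"
    have "complex_of_real (LINT z|\<mu>. g z * (norm (lacunary b A z))^2) =
        (LINT z|\<mu>. f z * (lacunary b A z * cnj (lacunary b A z)))"
      unfolding integral_complex_of_real[symmetric] f_def
      by (simp only: of_real_mult complex_norm_square)
    also have "\<dots> = (LINT z|\<mu>. (\<Sum>j\<in>A. \<Sum>k\<in>A. of_real (b j * b k) * (f z * (z ^ (2 ^ j) * cnj z ^ (2 ^ k)))))"
    proof (intro Bochner_Integration.integral_cong refl)
      fix z show "f z * (lacunary b A z * cnj (lacunary b A z)) =
          (\<Sum>j\<in>A. \<Sum>k\<in>A. of_real (b j * b k) * (f z * (z ^ (2 ^ j) * cnj z ^ (2 ^ k))))"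
        unfolding lacunary_def cnj_sum sum_product unfolding sum_distrib_left
        by (intro sum.cong refl) (simp add: mult_ac)
    qed
    also have "\<dots> = (\<Sum>j\<in>A. \<Sum>k\<in>A. of_real (b j * b k) * (LINT z|\<mu>. f z * (z ^ (2 ^ j) * cnj z ^ (2 ^ k))))"
      by (subst Bochner_Integration.integral_sum
          | intro sum.cong refl continuous_on_circle_integrable continuous_intros cont integral_mult_right_zero)+
    also have "\<dots> = (\<Sum>j\<in>A. \<Sum>k\<in>A. if j = k then of_real (b j * b k) * (LINT z|\<mu>. f z) else 0)"
    proof (intro sum.cong refl)
      fix j k assume "j \<in> A" "k \<in> A"
      then show "of_real (b j * b k) * (LINT z|\<mu>. f z * (z ^ (2 ^ j) * cnj z ^ (2 ^ k))) =
          (if j = k then of_real (b j * b k) * (LINT z|\<mu>. f z) else 0)"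
        using off[of k j] off'[of j k] diag A by (cases j k rule: linorder_cases) auto
    qed
    also have "\<dots> = complex_of_real ((\<Sum>k\<in>A. (b k)^2) * (LINT z|\<mu>. g z))"
      using fin by (simp add: f_def sum_distrib_right power2_eq_square)
    finally show "(LINT z|\<mu>. g z * (norm (lacunary b A z))^2) = (\<Sum>k\<in>A. (b k)^2) * (LINT z|\<mu>. g z)"
      by (simp only: of_real_eq_iff)
  qed
qed

section \<open>One step of the energy argument\<close>

lemma norm_add_scaled_square:
  fixes Z h :: complex
  shows "(norm (Z + of_real s * h))^2 = (norm Z)^2 + 2 * Re (cnj Z * h) * s + (norm h)^2 * s^2"
  unfolding cmod_power2 by (simp add: algebra_simps power2_eq_square)

text \<open>The coefficient of \<open>|h|^2\<close> is a quarter of the Laplacian of \<open>(1 + |Z|^2)^(-a)\<close>. The remainder has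
  a constant independent of \<open>Z\<close> because the third derivatives are bounded.\<close>

lemma powr_radial_taylor:
  fixes Z h :: complex and a :: real
  assumes a: "0 < a" "a \<le> 1"
  defines "u \<equiv> (norm Z)^2"
  shows "(1 + u) powr (- a) - 2 * a * (1 + u) powr (- a - 1) * Re (cnj Z * h)
      + a * (a * u - 1) * (1 + u) powr (- a - 2) * (norm h)^2
      + a * (a + 1) * (1 + u) powr (- a - 2) * Re ((cnj Z * h)^2) - 12 * (norm h) ^ 3
    \<le> (1 + (norm (Z + h))^2) powr (- a)"
proof -
  define \<beta> where "\<beta> = Re (cnj Z * h)"
  define H where "H = (norm h)^2"
  \<comment> \<open>Taylor's formula is applied in one variable, along the segment from
    \<open>Z\<close> to \<open>Z + h\<close>: \<open>q s\<close> is the squared modulus at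
    \<open>Z + s h\<close>.\<close>
  define q where "q = (\<lambda>s. u + 2 * \<beta> * s + H * s^2)"
  define q' where "q' = (\<lambda>s. 2 * \<beta> + 2 * H * s)"
  have q_eq: "q s = (norm (Z + of_real s * h))^2" for s
    by (simp only: q_def u_def \<beta>_def H_def norm_add_scaled_square)
  have q_nonneg: "q s \<ge> 0" for s unfolding q_eq by simp
  have q'_eq: "q' s = 2 * Re (cnj (Z + of_real s * h) * h)" for s
    unfolding q'_def \<beta>_def H_def cmod_power2 by (simp add: algebra_simps power2_eq_square)
  \<comment> \<open>This comes from \<open>x \<le> 1 + x^2\<close>. Each factor \<open>q'\<close>
    costs one power of \<open>1 + q\<close>, which the negative exponents of the derivatives absorb;
    so the remainder bound is free of \<open>Z\<close>.\<close>
  have q'_le: "\<bar>q' s\<bar> \<le> 2 * (1 + q s) * norm h" for s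
  proof -
    have "\<bar>q' s\<bar> \<le> 2 * norm (cnj (Z + of_real s * h) * h)"
      unfolding q'_eq using abs_Re_le_cmod[of "cnj (Z + of_real s * h) * h"] by simp
    also have "\<dots> = 2 * norm (Z + of_real s * h) * norm h" by (simp only: norm_mult complex_mod_cnj)
    also have "norm (Z + of_real s * h) \<le> 1 + q s"
      unfolding q_eq using zero_le_power2[of "norm (Z + of_real s * h) - 1 / 2"]
      by (simp add: power2_eq_square algebra_simps)
    finally show ?thesis by (simp add: mult_right_mono)
  qed
  have dq: "(q has_real_derivative q' s) (at s)" for s
    unfolding q_def q'_def by (auto intro!: derivative_eq_intros)
  have dq': "(q' has_real_derivative 2 * H) (at s)" for s
    unfolding q'_def by (auto intro!: derivative_eq_intros)
  have dp: "((\<lambda>s. (1 + q s) powr r) has_real_derivative r * (1 + q s) powr (r - 1) * q' s) (at s)" for r s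
    using DERIV_fun_powr[of "\<lambda>s. 1 + q s" "q' s" s r] q_nonneg[of s] dq[of s]
    by (auto intro!: derivative_eq_intros)
  define D where "D = (\<lambda>m::nat. \<lambda>s.
     if m = 0 then (1 + q s) powr (- a)
     else if m = 1 then - a * (1 + q s) powr (- a - 1) * q' s
     else if m = 2 then a * (a + 1) * (1 + q s) powr (- a - 2) * (q' s)^2 - a * (1 + q s) powr (- a - 1) * (2 * H)
     else - a * (a + 1) * (a + 2) * (1 + q s) powr (- a - 3) * (q' s) ^ 3
       + 3 * a * (a + 1) * (1 + q s) powr (- a - 2) * q' s * (2 * H))"
  have "\<exists>t. 0 < t \<and> t < 1 \<and> D 0 1 = (\<Sum>m<3. D m 0 / fact m * 1 ^ m) + D 3 t / fact 3 * 1 ^ 3"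
  proof (rule Maclaurin)
    show "\<forall>m t. m < 3 \<and> 0 \<le> t \<and> t \<le> 1 \<longrightarrow> (D m has_real_derivative D (Suc m) t) (at t)"
    proof (intro allI impI)
      fix m :: nat and t :: real assume "m < 3 \<and> 0 \<le> t \<and> t \<le> 1"
      then consider "m = 0" | "m = 1" | "m = 2" by linarith
      then show "(D m has_real_derivative D (Suc m) t) (at t)"
      proof cases
        case 1
        then show ?thesis using dp[of "- a" t] by (simp add: D_def)
      next
        case 2
        have "((\<lambda>s. - a * (1 + q s) powr (- a - 1) * q' s) has_real_derivative D 2 t) (at t)"
          by (rule derivative_eq_intros dp dq' refl)+
             (simp add: D_def algebra_simps power2_eq_square)
        then show ?thesis using 2 by (simp add: D_def numeral_2_eq_2)
      next
        case 3
        have "((\<lambda>s. a * (a + 1) * (1 + q s) powr (- a - 2) * (q' s)^2 - a * (1 + q s) powr (- a - 1) * (2 * H))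
            has_real_derivative D 3 t) (at t)"
          by (rule derivative_eq_intros dp dq' refl)+
             (simp add: D_def algebra_simps power2_eq_square power3_eq_cube)
        then show ?thesis using 3 by (simp add: D_def)
      qed
    qed
  qed (auto simp: D_def)
  then obtain t where t: "0 < t" "t < 1"
    and eq: "D 0 1 = (\<Sum>m<3. D m 0 / fact m * 1 ^ m) + D 3 t / fact 3 * 1 ^ 3" by blast
  have "D 0 1 = (1 + (norm (Z + h))^2) powr (- a)"
    using q_eq[of 1] by (simp add: D_def)
  moreover have "(\<Sum>m<3. D m 0 / fact m * 1 ^ m) = D 0 0 + D 1 0 + D 2 0 / 2"
    by (simp add: eval_nat_numeral)
  moreover have "D 0 0 = (1 + u) powr (- a)" "D 1 0 = - 2 * a * (1 + u) powr (- a - 1) * Re (cnj Z * h)"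
    by (simp_all add: D_def q_def q'_def \<beta>_def)
  moreover have "D 2 0 / 2 = a * (a * u - 1) * (1 + u) powr (- a - 2) * (norm h)^2
      + a * (a + 1) * (1 + u) powr (- a - 2) * Re ((cnj Z * h)^2)"
  proof -
    define R where "R = Re ((cnj Z * h)^2)"
    define p where "p = (1 + u) powr (- a - 2)"
    \<comment> \<open>The square of a real part splits into a multiple of \<open>|h|^2\<close>,
      which contributes to the Laplacian, and the real part of a square in \<open>h\<close>, whose
      mean is negligible for high frequencies.\<close>
    have \<beta>: "2 * \<beta>^2 = u * H + R"
      unfolding \<beta>_def u_def H_def R_def cmod_power2 by (simp add: power2_eq_square algebra_simps)
    have p: "(1 + u) powr (- a - 1) = (1 + u) * p"
    proof -
      have "1 + (- a - 2) = - a - 1" by simp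
      then show ?thesis
        using powr_add[of "1 + u" 1 "- a - 2"] by (simp only:) (simp add: u_def p_def)
    qed
    have "D 2 0 / 2 = a * (a + 1) * p * (2 * \<beta>^2) - a * (1 + u) powr (- a - 1) * H"
      by (simp add: D_def q_def q'_def power2_eq_square p_def)
    also have "\<dots> = a * (a * u - 1) * p * H + a * (a + 1) * p * R"
      unfolding \<beta> p by (simp add: algebra_simps)
    finally show ?thesis by (simp only: H_def R_def p_def)
  qed
  \<comment> \<open>48 comes from the cubic term (6 times 2^3) and 24 from the mixed one; division
    by \<open>fact 3\<close> gives the 12 of the statement.\<close>
  moreover have "\<bar>D 3 t\<bar> \<le> 72 * (norm h) ^ 3"
  proof -
    define p where "p = 1 + q t"
    have p: "p \<ge> 1" using q_nonneg[of t] by (simp add: p_def)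
    have pw3: "p powr (- a - 3) * p ^ 3 \<le> 1"
    proof -
      have "p powr (- a - 3) * p ^ 3 = p powr (- a)"
        using p powr_add[of p "- a - 3" 3] by simp
      also have "\<dots> \<le> p powr 0" using p a by (intro powr_mono) auto
      finally show ?thesis using p by simp
    qed
    have pw2: "p powr (- a - 2) * p \<le> 1"
    proof -
      have "p powr (- a - 2) * p = p powr (- a - 1)"
      proof -
        have "- a - 2 + 1 = - a - 1" by simp
        then show ?thesis using p powr_add[of p "- a - 2" 1] by (simp only:) simp
      qed
      also have "\<dots> \<le> p powr 0" using p a by (intro powr_mono) auto
      finally show ?thesis using p by simp
    qed
    have "\<bar>a * (a + 1) * (a + 2) * p powr (- a - 3) * (q' t) ^ 3\<bar>
        = a * (a + 1) * (a + 2) * p powr (- a - 3) * \<bar>q' t\<bar> ^ 3"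
      using a by (simp add: abs_mult power_abs)
    also have "\<dots> \<le> 6 * p powr (- a - 3) * (2 * p * norm h) ^ 3"
    proof (intro mult_mono power_mono)
      have "a * (a + 1) * (a + 2) \<le> 1 * 2 * 3" using a by (intro mult_mono) auto
      then show "a * (a + 1) * (a + 2) \<le> 6" by simp
    qed (use a p q'_le[of t] in \<open>auto simp: p_def\<close>)
    also have "\<dots> = 48 * (norm h) ^ 3 * (p powr (- a - 3) * p ^ 3)"
      by (simp add: power_mult_distrib)
    also have "\<dots> \<le> 48 * (norm h) ^ 3 * 1"
      using pw3 by (intro mult_left_mono) auto
    finally have 1: "\<bar>a * (a + 1) * (a + 2) * p powr (- a - 3) * (q' t) ^ 3\<bar> \<le> 48 * (norm h) ^ 3" by simp
    have "\<bar>3 * a * (a + 1) * p powr (- a - 2) * q' t * (2 * H)\<bar> = 3 * (a * (a + 1)) * p powr (- a - 2) * \<bar>q' t\<bar> * (2 * H)"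
      using a by (simp add: abs_mult H_def)
    also have "\<dots> \<le> 3 * 2 * p powr (- a - 2) * (2 * p * norm h) * (2 * H)"
    proof (intro mult_mono)
      have "a * (a + 1) \<le> 1 * 2" using a by (intro mult_mono) auto
      then show "a * (a + 1) \<le> 2" by simp
    qed (use a p q'_le[of t] in \<open>auto simp: p_def H_def\<close>)
    also have "\<dots> = 24 * (norm h) ^ 3 * (p powr (- a - 2) * p)"
      by (simp add: H_def power2_eq_square power3_eq_cube)
    also have "\<dots> \<le> 24 * (norm h) ^ 3 * 1"
      using pw2 by (intro mult_left_mono) auto
    finally have 2: "\<bar>3 * a * (a + 1) * p powr (- a - 2) * q' t * (2 * H)\<bar> \<le> 24 * (norm h) ^ 3" by simp
    have "D 3 t = - (a * (a + 1) * (a + 2) * p powr (- a - 3) * (q' t) ^ 3) + 3 * a * (a + 1) * p powr (- a - 2) * q' t * (2 * H)"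
      by (simp add: D_def p_def)
    then show ?thesis using 1 2 by linarith
  qed
  moreover have "fact 3 = (6::real)" by (simp add: eval_nat_numeral)
  ultimately show ?thesis using eq by (simp add: abs_le_iff)
qed

text \<open>Exact orthogonality to high frequencies is available for trigonometric polynomials
  \<open>f\<close> only; a continuous coefficient \<open>F\<close> costs the uniform distance times
  the L^1 norm of \<open>H\<close>.\<close>

lemma integral_trig_approx_mult:
  fixes F f H :: "complex \<Rightarrow> complex"
  assumes "continuous_on (sphere 0 1) F" "continuous_on (sphere 0 1) f" "continuous_on (sphere 0 1) H"
    and "\<And>z. z \<in> sphere 0 1 \<Longrightarrow> norm (F z - f z) \<le> t"
    and "(LINT z|\<mu>. f z * H z) = 0"
  shows "\<bar>LINT z|\<mu>. Re (F z * H z)\<bar> \<le> t * (LINT z|\<mu>. norm (H z))"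
proof -
  have "(LINT z|\<mu>. Re (F z * H z)) = Re (LINT z|\<mu>. F z * H z)"
    by (intro integral_Re continuous_on_circle_integrable continuous_intros assms)
  also have "(LINT z|\<mu>. F z * H z) = (LINT z|\<mu>. (F z - f z) * H z + f z * H z)"
    by (simp add: algebra_simps)
  also have "\<dots> = (LINT z|\<mu>. (F z - f z) * H z)"
    using assms(5)
    by (subst Bochner_Integration.integral_add)
       (auto intro!: continuous_on_circle_integrable continuous_intros assms(1-3))
  finally have "\<bar>LINT z|\<mu>. Re (F z * H z)\<bar> \<le> norm (LINT z|\<mu>. (F z - f z) * H z)"
    using abs_Re_le_cmod by simp
  also have "\<dots> \<le> (LINT z|\<mu>. norm ((F z - f z) * H z))"
    by (rule integral_norm_bound)
  also have "\<dots> \<le> (LINT z|\<mu>. t * norm (H z))"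
    using assms(4)
    by (intro integral_circle_mono continuous_intros assms(1-3)) (auto simp: norm_mult intro!: mult_right_mono)
  finally show ?thesis by simp
qed

text \<open>This is the coefficient of \<open>|h|^2\<close> in the Taylor estimate. As it is
  bounded, replacing the cutoff by a trigonometric polynomial changes the gain only by a multiple of
  the uniform error.\<close>

lemma powr_decay_bound:
  fixes a u :: real
  assumes "0 < a" "a \<le> 1" "u \<ge> 0"
  shows "\<bar>a * (a * u - 1) * (1 + u) powr (- a - 2)\<bar> \<le> 1"
proof -
  have "\<bar>a * u - 1\<bar> \<le> 1 + u"
  proof -
    have "0 \<le> a * u" "a * u \<le> 1 * u" using assms mult_right_mono[of a 1 u] by auto
    then show ?thesis using assms(3) unfolding abs_le_iff by linarith
  qed
  moreover have "(1 + u) * (1 + u) powr (- a - 2) \<le> 1"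
  proof -
    have "(1 + u) * (1 + u) powr (- a - 2) = (1 + u) powr (1 + (- a - 2))"
      using assms by (subst powr_add) auto
    also have "\<dots> \<le> (1 + u) powr 0" using assms by (intro powr_mono) auto
    finally show ?thesis using assms by simp
  qed
  ultimately have "\<bar>a * u - 1\<bar> * (1 + u) powr (- a - 2) \<le> 1"
    by (intro order_trans[OF mult_right_mono[of "\<bar>a * u - 1\<bar>" "1 + u" "(1 + u) powr (- a - 2)"]]) auto
  then have "a * (\<bar>a * u - 1\<bar> * (1 + u) powr (- a - 2)) \<le> 1 * 1"
    using assms by (intro mult_mono) auto
  then show ?thesis using assms by (simp add: abs_mult)
qed

lemma integral_indicator_le:
  fixes f :: "complex \<Rightarrow> real"
  assumes "continuous_on (sphere 0 1) f" "S \<in> sets \<mu>"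
    "\<And>z. z \<in> sphere 0 1 \<Longrightarrow> 0 \<le> f z" "\<And>z. z \<in> S \<Longrightarrow> c \<le> f z"
  shows "c * measure \<mu> S \<le> (LINT z|\<mu>. f z)"
proof -
  have "c * measure \<mu> S = (LINT z|\<mu>. c * indicator S z)"
    using assms(2) sets.sets_into_space[OF assms(2)] by (simp add: Int_absorb2 Int_commute)
  also have "\<dots> \<le> (LINT z|\<mu>. f z)"
    using assms(2-4)
    by (intro integral_mono continuous_on_circle_integrable[OF assms(1)] integrable_mult_right
          integrable_real_indicator) (auto simp: indicator_def circle.emeasure_eq_measure)
  finally show ?thesis .
qed

lemma sets_circle_closed_vimage:
  fixes f :: "complex \<Rightarrow> real"
  assumes "continuous_on (sphere 0 1) f" "closed C"
  shows "{z \<in> sphere 0 1. f z \<in> C} \<in> sets \<mu>"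
  using measurable_sets[OF continuous_on_circle_measurable[OF assms(1)], of C] assms(2)
  by (simp add: vimage_def Int_def conj_commute)

text \<open>\<open>\<kappa>\<close> and \<open>s\<close> are fixed before \<open>Z\<close>, and
  \<open>T\<close> and \<open>d\<close> before the block \<open>A\<close>, \<open>b\<close>. In the
  Taylor estimate with \<open>h = T * B\<close>, where \<open>B\<close> is the lacunary sum, the
  terms in \<open>B\<close> and \<open>B^2\<close> have almost zero mean, the \<open>|B|^2\<close>
  term gains almost \<open>s^2 * c\<close>, and the remainder is of order \<open>s^3\<close>, so a
  small \<open>s\<close> wins.\<close>

lemma energy_gain:
  fixes a e K :: real
  assumes a: "0 < a" "a \<le> 1" and e: "e > 0" and K: "K > 0"
  obtains \<kappa> s where "\<kappa> > 0" "s > 0"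
    "\<And>Z. continuous_on (sphere 0 1) Z \<Longrightarrow>
       e \<le> measure \<mu> {z \<in> sphere 0 1. (norm (Z z))^2 \<in> {2 / a..K}} \<Longrightarrow>
       \<exists>T d. trig_poly T \<and> (\<forall>A b. finite A \<longrightarrow> (\<forall>k\<in>A. k > d) \<longrightarrow> (\<forall>k. b k \<ge> 0) \<longrightarrow> (\<Sum>k\<in>A. (b k)^2) = s^2 \<longrightarrow>
         (LINT z|\<mu>. (1 + (norm (Z z))^2) powr (- a)) + \<kappa> \<le>
         (LINT z|\<mu>. (1 + (norm (Z z + T z * lacunary b A z))^2) powr (- a)))"
proof -
  \<comment> \<open>Where \<open>2 / a \<le> |Z|^2 \<le> K\<close>, the coefficient of
    \<open>|h|^2\<close> is at least \<open>a * (1 + K) powr (- 3)\<close>; integration over a set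
    of measure \<open>e\<close> gives \<open>c\<close>.\<close>
  define c where "c = a * (1 + K) powr (- 3) * e"
  have c: "c > 0" using a e K by (simp add: c_def)
  \<comment> \<open>1536 = 8 * 192, and 192 = 12 * 2^3 * 2 collects the Taylor remainder, the bound
    2 for \<open>T\<close> and the third moment: the remainder costs at most an eighth of
    \<open>s^2 * c\<close>. The factor \<open>s\<close> in \<open>t\<close> below is for the term
    linear in \<open>B\<close>, whose error is only of order \<open>t * s\<close>.\<close>
  define s where "s = min 1 (c / 1536)"
  define t where "t = min 1 (s * c / 16)"
  have s: "s > 0" "s \<le> 1" "192 * s \<le> c / 8" using c by (auto simp: s_def)
  have t: "t > 0" "t \<le> 1" "t \<le> s * c / 16" using c s by (auto simp: t_def)
  have "s * c \<le> 1 * c" using s c by (intro mult_right_mono) auto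
  then have t': "t \<le> c / 16" using t by simp
  show ?thesis
  proof (rule that[of "s^2 * c / 4" s])
    show "s^2 * c / 4 > 0" "s > 0" using s c by auto
    fix Z :: "complex \<Rightarrow> complex"
    assume cont: "continuous_on (sphere 0 1) Z"
      and big: "e \<le> measure \<mu> {z \<in> sphere 0 1. (norm (Z z))^2 \<in> {2 / a..K}}"
    define u where "u = (\<lambda>z. (norm (Z z))^2)"
    have u: "u z \<ge> 0" for z by (simp add: u_def)
    have u1: "1 + u z \<noteq> 0" for z using u[of z] by linarith
    have contu: "continuous_on (sphere 0 1) u" unfolding u_def by (intro continuous_intros cont)
    have contp: "continuous_on (sphere 0 1) (\<lambda>z. (1 + u z) powr r)" for r
      using u1 by (intro continuous_intros contu) auto
    \<comment> \<open>The coefficient of \<open>|h|^2\<close> has the sign of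
      \<open>a * u - 1\<close>, so it is nonnegative wherever \<open>cut\<close> is not 0. The ramp
      ends at \<open>a * u = 2\<close>, which explains the lower end \<open>2 / a\<close> of the
      interval.\<close>
    define cut where "cut = (\<lambda>z. max 0 (min 1 (a * u z - 1)))"
    have cut: "0 \<le> cut z" "cut z \<le> 1" for z by (auto simp: cut_def)
    have contcut: "continuous_on (sphere 0 1) cut"
      unfolding cut_def by (intro continuous_intros contu)
    obtain T0 where T0: "real_polynomial_function T0" "\<And>z. z \<in> sphere 0 1 \<Longrightarrow> \<bar>cut z - T0 z\<bar> < t"
      using trig_poly_approx_real[OF contcut t(1)] by blast
    define T where "T = (\<lambda>z. complex_of_real (T0 z))"
    have T: "trig_poly T" unfolding T_def by (rule trig_poly_real_polynomial_function[OF T0(1)])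
    note contT = trig_poly_continuous_on[OF T]
    have T2: "norm (T z) \<le> 2" if "z \<in> sphere 0 1" for z
      using T0(2)[OF that] cut[of z] t by (simp add: T_def)
    have contT0: "continuous_on (sphere 0 1) T0"
      using contT continuous_on_Re[of "sphere 0 1" T] by (simp add: T_def)
    \<comment> \<open>Coefficients of \<open>B\<close>, \<open>B^2\<close> and \<open>|B|^2\<close>
      in the Taylor estimate for \<open>h = T * B\<close>, the first one without its factor
      \<open>- 2 * a\<close>.\<close>
    define F1 where "F1 = (\<lambda>z. of_real ((1 + u z) powr (- a - 1)) * cnj (Z z) * T z)"
    define F2 where "F2 = (\<lambda>z. of_real (a * (a + 1) * (1 + u z) powr (- a - 2)) * (cnj (Z z) * T z)^2)"
    define F3 where "F3 = (\<lambda>z. a * (a * u z - 1) * (1 + u z) powr (- a - 2) * (T0 z)^2)"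
    have contF: "continuous_on (sphere 0 1) F1" "continuous_on (sphere 0 1) F2" "continuous_on (sphere 0 1) F3"
      unfolding F1_def F2_def F3_def by (intro continuous_intros contu contp cont contT contT0)+
    obtain f1 where f1: "trig_poly f1" "\<And>z. z \<in> sphere 0 1 \<Longrightarrow> norm (F1 z - f1 z) < t"
      using trig_poly_approx[OF contF(1) t(1)] by blast
    obtain f2 where f2: "trig_poly f2" "\<And>z. z \<in> sphere 0 1 \<Longrightarrow> norm (F2 z - f2 z) < t"
      using trig_poly_approx[OF contF(2) t(1)] by blast
    obtain f3 where f3: "real_polynomial_function f3" "\<And>z. z \<in> sphere 0 1 \<Longrightarrow> \<bar>F3 z - f3 z\<bar> < t"
      using trig_poly_approx_real[OF contF(3) t(1)] by blast
    have contf3: "continuous_on (sphere 0 1) f3"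
      using trig_poly_continuous_on[OF trig_poly_real_polynomial_function[OF f3(1)]]
        continuous_on_Re[of "sphere 0 1" "\<lambda>z. of_real (f3 z)"] by simp
    obtain d1 where d1: "\<forall>A b. (\<forall>k\<in>A. k > d1) \<longrightarrow> (LINT z|\<mu>. f1 z * lacunary b A z) = 0 \<and>
        (LINT z|\<mu>. f1 z * (lacunary b A z)^2) = 0"
      using integral_trig_poly_lacunary[OF f1(1)] ..
    obtain d2 where d2: "\<forall>A b. (\<forall>k\<in>A. k > d2) \<longrightarrow> (LINT z|\<mu>. f2 z * lacunary b A z) = 0 \<and>
        (LINT z|\<mu>. f2 z * (lacunary b A z)^2) = 0"
      using integral_trig_poly_lacunary[OF f2(1)] ..
    obtain d3 where d3: "\<forall>A b. finite A \<longrightarrow> (\<forall>k\<in>A. k > d3) \<longrightarrow>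
        (LINT z|\<mu>. f3 z * (norm (lacunary b A z))^2) = (\<Sum>k\<in>A. (b k)^2) * (LINT z|\<mu>. f3 z)"
      using integral_real_trig_poly_lacunary[OF f3(1)] ..
    have F3_int: "(LINT z|\<mu>. F3 z) \<ge> c - 3 * t"
    proof -
      define D where "D = (\<lambda>z. a * (a * u z - 1) * (1 + u z) powr (- a - 2) * (cut z)^2)"
      define S where "S = {z \<in> sphere 0 1. u z \<in> {2 / a..K}}"
      have contD: "continuous_on (sphere 0 1) D"
        unfolding D_def by (intro continuous_intros contu contp contcut)
      have "a * (1 + K) powr (- 3) * measure \<mu> S \<le> (LINT z|\<mu>. D z)"
      proof (rule integral_indicator_le[OF contD])
        show "S \<in> sets \<mu>"
          unfolding S_def by (intro sets_circle_closed_vimage contu) auto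
        show "0 \<le> D z" for z
        proof (cases "a * u z - 1 \<ge> 0")
          case True
          then show ?thesis using a unfolding D_def by (intro mult_nonneg_nonneg) auto
        next
          case False
          then have "cut z = 0" by (simp add: cut_def)
          then show ?thesis by (simp add: D_def)
        qed
        fix z assume "z \<in> S"
        then have z: "2 / a \<le> u z" "u z \<le> K" by (auto simp: S_def)
        then have au: "a * u z - 1 \<ge> 1" using a by (simp add: field_simps)
        then have "cut z = 1" by (simp add: cut_def)
        have "(1 + K) powr (- 3) \<le> (1 + K) powr (- a - 2)"
          using a K by (intro powr_mono) auto
        also have "\<dots> \<le> (1 + u z) powr (- a - 2)"
          using a K u[of z] z by (intro powr_mono2') auto
        finally have "a * 1 * (1 + K) powr (- 3) \<le> a * (a * u z - 1) * (1 + u z) powr (- a - 2)"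
          using a au by (intro mult_mono) auto
        then show "a * (1 + K) powr (- 3) \<le> D z"
          using \<open>cut z = 1\<close> by (simp add: D_def)
      qed
      moreover have "c \<le> a * (1 + K) powr (- 3) * measure \<mu> S"
        unfolding c_def S_def u_def using a K big by (intro mult_left_mono) auto
      moreover have "(LINT z|\<mu>. D z - 3 * t) \<le> (LINT z|\<mu>. F3 z)"
      proof (intro integral_circle_mono continuous_intros contD contF)
        fix z :: complex assume z: "z \<in> sphere 0 1"
        \<comment> \<open>The second factor is at most \<open>2 + t\<close>, hence at most
          3.\<close>
        have "\<bar>(T0 z)^2 - (cut z)^2\<bar> = \<bar>T0 z - cut z\<bar> * \<bar>T0 z + cut z\<bar>"
          by (simp add: power2_eq_square algebra_simps flip: abs_mult)
        also have "\<dots> \<le> t * 3"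
          using T0(2)[OF z] cut[of z] t by (intro mult_mono) auto
        finally have "\<bar>(T0 z)^2 - (cut z)^2\<bar> \<le> 3 * t" by simp
        then have "\<bar>a * (a * u z - 1) * (1 + u z) powr (- a - 2)\<bar> * \<bar>(T0 z)^2 - (cut z)^2\<bar> \<le> 1 * (3 * t)"
          using powr_decay_bound[OF a u[of z]] by (intro mult_mono) auto
        then have "\<bar>F3 z - D z\<bar> \<le> 3 * t"
          by (simp add: F3_def D_def flip: abs_mult right_diff_distrib)
        then show "D z - 3 * t \<le> F3 z" by linarith
      qed
      moreover have "(LINT z|\<mu>. D z - 3 * t) = (LINT z|\<mu>. D z) - 3 * t"
        by (subst Bochner_Integration.integral_diff)
           (auto intro!: continuous_on_circle_integrable contD)
      ultimately show ?thesis by linarith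
    qed
    show "\<exists>T d. trig_poly T \<and> (\<forall>A b. finite A \<longrightarrow> (\<forall>k\<in>A. k > d) \<longrightarrow> (\<forall>k. b k \<ge> 0) \<longrightarrow> (\<Sum>k\<in>A. (b k)^2) = s^2 \<longrightarrow>
         (LINT z|\<mu>. (1 + (norm (Z z))^2) powr (- a)) + s^2 * c / 4 \<le>
         (LINT z|\<mu>. (1 + (norm (Z z + T z * lacunary b A z))^2) powr (- a)))"
    proof (intro exI[of _ T] exI[of _ "max d1 (max d2 d3)"] conjI T allI impI)
      fix A :: "nat set" and b :: "nat \<Rightarrow> real"
      assume fin: "finite A" and Ad: "\<forall>k\<in>A. max d1 (max d2 d3) < k" and b: "\<forall>k. b k \<ge> 0"
        and bs: "(\<Sum>k\<in>A. (b k)^2) = s^2"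
      define B where "B = lacunary b A"
      have contB: "continuous_on (sphere 0 1) B" unfolding B_def by (intro continuous_intros)
      note int = continuous_on_circle_integrable
      note cont_all = continuous_intros cont contT contT0 contB contF contp contu
      have E1: "(LINT z|\<mu>. norm (B z)) \<le> s"
        unfolding B_def by (rule integral_lacunary_norm[OF fin s(1) bs])
      have E2: "(LINT z|\<mu>. (norm (B z))^2) = s^2"
        unfolding B_def by (simp add: integral_lacunary_square[OF fin] bs)
      have E3: "(LINT z|\<mu>. (norm (B z)) ^ 3) \<le> 2 * s ^ 3"
        unfolding B_def using integral_lacunary_cube[OF fin _ s(1) bs] b by blast
      have I1: "\<bar>LINT z|\<mu>. Re (F1 z * B z)\<bar> \<le> t * s"
      proof -
        have "\<bar>LINT z|\<mu>. Re (F1 z * B z)\<bar> \<le> t * (LINT z|\<mu>. norm (B z))"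
          using d1[rule_format, of A b] Ad f1(2)
          by (intro integral_trig_approx_mult[where f = f1] contF contB trig_poly_continuous_on[OF f1(1)])
             (auto simp: B_def less_imp_le)
        also have "\<dots> \<le> t * s" using E1 t by (intro mult_left_mono) auto
        finally show ?thesis .
      qed
      have I2: "\<bar>LINT z|\<mu>. Re (F2 z * (B z)^2)\<bar> \<le> t * s^2"
      proof -
        have "\<bar>LINT z|\<mu>. Re (F2 z * (B z)^2)\<bar> \<le> t * (LINT z|\<mu>. norm ((B z)^2))"
          using d2[rule_format, of A b] Ad f2(2)
          by (intro integral_trig_approx_mult[where f = f2] contF contB trig_poly_continuous_on[OF f2(1)] continuous_intros)
             (auto simp: B_def less_imp_le)
        also have "\<dots> = t * s^2" using E2 by (simp add: norm_power)
        finally show ?thesis .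
      qed
      \<comment> \<open>Of the five \<open>t\<close>, three come from \<open>T0\<close> in place of
        \<open>cut\<close>, and one each from passing to \<open>f3\<close> and back.\<close>
      have I3: "s^2 * (c - 5 * t) \<le> (LINT z|\<mu>. F3 z * (norm (B z))^2)"
      proof -
        have "(LINT z|\<mu>. F3 z) - t \<le> (LINT z|\<mu>. f3 z)"
        proof -
          have "(LINT z|\<mu>. F3 z) - t = (LINT z|\<mu>. F3 z - t)"
            by (subst Bochner_Integration.integral_diff) (auto intro!: int contF)
          also have "\<dots> \<le> (LINT z|\<mu>. f3 z)"
          proof (intro integral_circle_mono continuous_intros contF contf3)
            show "F3 z - t \<le> f3 z" if "z \<in> sphere 0 1" for z
              using f3(2)[OF that] by linarith
          qed
          finally show ?thesis .
        qed
        then have "s^2 * (c - 4 * t) \<le> s^2 * (LINT z|\<mu>. f3 z)"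
          using F3_int by (intro mult_left_mono) auto
        also have "\<dots> = (LINT z|\<mu>. f3 z * (norm (B z))^2)"
          unfolding B_def using d3[rule_format, OF fin] Ad bs by simp
        also have "\<dots> \<le> (LINT z|\<mu>. F3 z * (norm (B z))^2 + t * (norm (B z))^2)"
        proof (intro integral_circle_mono continuous_intros contF contf3 contB)
          fix z :: complex assume "z \<in> sphere 0 1"
          then have "f3 z \<le> F3 z + t" using f3(2)[of z] by linarith
          then have "f3 z * (norm (B z))^2 \<le> (F3 z + t) * (norm (B z))^2"
            by (intro mult_right_mono) auto
          then show "f3 z * (norm (B z))^2 \<le> F3 z * (norm (B z))^2 + t * (norm (B z))^2"
            by (simp add: algebra_simps)
        qed
        also have "\<dots> = (LINT z|\<mu>. F3 z * (norm (B z))^2) + t * s^2"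
          by (subst Bochner_Integration.integral_add) (auto intro!: int continuous_intros contF contB simp: E2)
        finally show ?thesis by (simp add: algebra_simps)
      qed
      define LB where "LB = (\<lambda>z. (1 + u z) powr (- a) - 2 * a * Re (F1 z * B z) + F3 z * (norm (B z))^2
          + Re (F2 z * (B z)^2) - 96 * (norm (B z)) ^ 3)"
      have c1: "(LINT z|\<mu>. LB z) \<le>
          (LINT z|\<mu>. (1 + (norm (Z z + T z * B z))^2) powr (- a))"
      proof (intro integral_circle_mono)
        show "continuous_on (sphere 0 1) LB"
          unfolding LB_def by (intro cont_all)
        show "continuous_on (sphere 0 1) (\<lambda>z. (1 + (norm (Z z + T z * B z))^2) powr (- a))"
          by (intro cont_all) (auto simp: add_nonneg_eq_0_iff)
        fix z :: complex assume z: "z \<in> sphere 0 1"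
        have "(norm (T z * B z)) ^ 3 \<le> 8 * (norm (B z)) ^ 3"
        proof -
          have "(norm (T z * B z)) ^ 3 = (norm (T z)) ^ 3 * (norm (B z)) ^ 3"
            by (simp add: norm_mult power_mult_distrib)
          also have "\<dots> \<le> 2 ^ 3 * (norm (B z)) ^ 3"
            using T2[OF z] by (intro mult_right_mono power_mono) auto
          finally show ?thesis by simp
        qed
        moreover have "2 * a * Re (F1 z * B z) = 2 * a * (1 + u z) powr (- a - 1) * Re (cnj (Z z) * (T z * B z))"
          unfolding F1_def mult.assoc by (simp only: Re_complex_of_real Im_complex_of_real times_complex.sel mult_zero_left diff_0_right)
        moreover have "Re (F2 z * (B z)^2) = a * (a + 1) * (1 + u z) powr (- a - 2) * Re ((cnj (Z z) * (T z * B z))^2)"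
          unfolding F2_def mult.assoc[of "of_real _"] power_mult_distrib[symmetric] mult.assoc[of "cnj _"]
          by (simp only: Re_complex_of_real Im_complex_of_real times_complex.sel mult_zero_left diff_0_right)
        moreover have "F3 z * (norm (B z))^2 = a * (a * u z - 1) * (1 + u z) powr (- a - 2) * (norm (T z * B z))^2"
          by (simp add: F3_def T_def norm_mult power_mult_distrib)
        ultimately show "LB z \<le> (1 + (norm (Z z + T z * B z))^2) powr (- a)"
          using powr_radial_taylor[OF a, of "Z z" "T z * B z"] unfolding LB_def u_def by linarith
      qed
      have c2: "(LINT z|\<mu>. LB z) = (LINT z|\<mu>. (1 + u z) powr (- a))
          - 2 * a * (LINT z|\<mu>. Re (F1 z * B z)) + (LINT z|\<mu>. F3 z * (norm (B z))^2)
          + (LINT z|\<mu>. Re (F2 z * (B z)^2)) - 96 * (LINT z|\<mu>. (norm (B z)) ^ 3)"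
      proof -
        have i: "integrable \<mu> (\<lambda>z. (1 + u z) powr (- a))"
          "integrable \<mu> (\<lambda>z. Re (F1 z * B z))"
          "integrable \<mu> (\<lambda>z. F3 z * (norm (B z))^2)"
          "integrable \<mu> (\<lambda>z. Re (F2 z * (B z)^2))"
          "integrable \<mu> (\<lambda>z. (norm (B z)) ^ 3)"
          by (intro int cont_all)+
        show ?thesis unfolding LB_def
          by (simp only: i Bochner_Integration.integral_add Bochner_Integration.integral_diff
              integrable_mult_right Bochner_Integration.integrable_add
              Bochner_Integration.integrable_diff integral_mult_right_zero)
      qed
      have c3: "2 * a * (LINT z|\<mu>. Re (F1 z * B z)) \<le> s^2 * c / 8"
      proof -
        have "2 * a * (LINT z|\<mu>. Re (F1 z * B z)) \<le> 2 * 1 * (t * s)"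
          using I1 a mult_mono[of "2 * a" 2 "LINT z|\<mu>. Re (F1 z * B z)" "t * s"]
          by (cases "(LINT z|\<mu>. Re (F1 z * B z)) \<ge> 0")
             (auto intro: order_trans[of _ 0] simp: mult_nonneg_nonpos t(1) s(1) less_imp_le)
        also have "\<dots> \<le> 2 * 1 * (s * c / 16 * s)"
          using t s by (intro mult_mono) auto
        finally show ?thesis by (simp add: power2_eq_square algebra_simps)
      qed
      have c4: "t * s^2 \<le> s^2 * c / 16"
        using mult_right_mono[OF t', of "s^2"] by (simp add: mult.commute)
      have c5: "96 * (LINT z|\<mu>. (norm (B z)) ^ 3) \<le> s^2 * c / 8"
      proof -
        have "96 * (LINT z|\<mu>. (norm (B z)) ^ 3) \<le> s^2 * (192 * s)"
          using E3 by (simp add: power2_eq_square power3_eq_cube)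
        also have "\<dots> \<le> s^2 * (c / 8)" using s by (intro mult_left_mono) auto
        finally show ?thesis by simp
      qed
      have c6: "s^2 * c - 5 * (t * s^2) \<le> (LINT z|\<mu>. F3 z * (norm (B z))^2)"
        using I3 by (simp add: algebra_simps)
      have c7: "- (t * s^2) \<le> (LINT z|\<mu>. Re (F2 z * (B z)^2))"
        using I2 by (simp add: abs_le_iff)
      have c8: "0 \<le> s^2 * c" using c by simp
      \<comment> \<open>The balance in units of \<open>s^2 * c\<close>: 1 - 5/16 - 1/16 - 1/8 - 1/8
        = 3/8, more than the 1/4 that is claimed.\<close>
      have arith: "I0 + q / 4 \<le> R"
        if "L \<le> R" "L = I0 - A1 + J3 + J2 - A4" "A1 \<le> q / 8" "ts \<le> q / 16" "A4 \<le> q / 8"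
          "q - 5 * ts \<le> J3" "- ts \<le> J2" "0 \<le> q" for I0 q R L A1 J3 J2 A4 ts :: real
        using that by linarith
      show "(LINT z|\<mu>. (1 + (norm (Z z))^2) powr (- a)) + s^2 * c / 4 \<le>
         (LINT z|\<mu>. (1 + (norm (Z z + T z * lacunary b A z))^2) powr (- a))"
        using arith[OF c1 c2 c3 c4 c5 c6 c7 c8] unfolding B_def u_def .
    qed
  qed
qed

section \<open>The Bloch-type space\<close>

locale majorant_weight =
  fixes w :: "real \<Rightarrow> real" and \<alpha> :: real
  assumes cont_w: "continuous_on {0..1} w"
    and mono_w: "mono_on {0..1} w"
    and pos_w: "\<And>t. 0 < t \<Longrightarrow> t \<le> 1 \<Longrightarrow> 0 < w t"
    and \<alpha>: "0 < \<alpha>" "\<alpha> < 1"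
    and anti: "antimono_on {0<..1} (\<lambda>t. w t / t powr \<alpha>)"
    and lim: "filterlim (\<lambda>t. w t / t powr \<alpha>) at_top (at_right 0)"
begin

lemma w_mono: "0 \<le> s \<Longrightarrow> s \<le> t \<Longrightarrow> t \<le> 1 \<Longrightarrow> w s \<le> w t"
  using mono_w by (auto simp: mono_on_def)

lemma w_scale: 
  assumes "0 < s" "s \<le> t" "t \<le> 1"
  shows "w t * s powr \<alpha> \<le> w s * t powr \<alpha>"
proof -
  have "w t / t powr \<alpha> \<le> w s / s powr \<alpha>"
    using anti assms by (auto simp: monotone_on_def)
  then show ?thesis using assms by (simp add: field_simps)
qed

text \<open>\<open>t / w t\<close> is \<open>t powr (1 - \<alpha>)\<close> divided by
  \<open>w t / t powr \<alpha>\<close>, an increasing function over a decreasing one. Consequently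
  the Bloch weight is largest at the centre of the disc.\<close>

lemma weight_mono:
  assumes "0 < s" "s \<le> t" "t \<le> 1"
  shows "s / w s \<le> t / w t"
proof -
  have "w t * s = (w t * s powr \<alpha>) * s powr (1 - \<alpha>)"
    using assms by (simp add: mult.assoc flip: powr_add)
  also have "\<dots> \<le> (w s * t powr \<alpha>) * t powr (1 - \<alpha>)"
    using assms pos_w[of s] \<alpha> by (intro mult_mono[OF w_scale[OF assms]] powr_mono2 mult_nonneg_nonneg) auto
  also have "\<dots> = w s * t"
    using assms by (simp add: mult.assoc flip: powr_add)
  finally show ?thesis using pos_w[of s] pos_w[of t] assms by (simp add: field_simps)
qed

lemma weight_tendsto_0: "((\<lambda>t. t / w t) \<longlongrightarrow> 0) (at_right 0)"
proof -
  have 1: "((\<lambda>t. t powr (1 - \<alpha>) * inverse (w t / t powr \<alpha>)) \<longlongrightarrow> 0 * 0) (at_right 0)"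
  proof (rule tendsto_mult)
    show "((\<lambda>t. t powr (1 - \<alpha>)) \<longlongrightarrow> 0) (at_right 0)"
      using \<alpha> by real_asymp
    show "((\<lambda>t. inverse (w t / t powr \<alpha>)) \<longlongrightarrow> 0) (at_right 0)"
      by (rule tendsto_inverse_0_at_top[OF lim])
  qed
  have 2: "\<forall>\<^sub>F t in at_right 0. t powr (1 - \<alpha>) * inverse (w t / t powr \<alpha>) = t / w t"
    using eventually_at_right_less[of 0]
  proof eventually_elim
    case (elim t)
    have "t powr (1 - \<alpha>) * inverse (w t / t powr \<alpha>) = (t powr (1 - \<alpha>) * t powr \<alpha>) / w t"
      by (simp add: field_simps)
    also have "t powr (1 - \<alpha>) * t powr \<alpha> = t" using elim by (simp flip: powr_add)
    finally show ?case .
  qed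
  show ?thesis using Lim_transform_eventually[OF 1 2] by simp
qed

definition \<rho> :: "complex \<Rightarrow> real" where
  "\<rho> z = (1 - norm z) / w (1 - norm z)"

lemma \<rho>_pos: "z \<in> unit_disc \<Longrightarrow> \<rho> z > 0"
  unfolding \<rho>_def by (intro divide_pos_pos pos_w) auto

lemma \<rho>_mono: "z \<in> unit_disc \<Longrightarrow> norm z' \<le> norm z \<Longrightarrow> \<rho> z \<le> \<rho> z'"
  unfolding \<rho>_def by (intro weight_mono) auto

text \<open>Membership guarantees that the supremum in \<open>bloch_norm\<close> is a genuine
  one.\<close>

definition fin_norm :: "(complex \<Rightarrow> complex) set" where
  "fin_norm = {f. f holomorphic_on unit_disc \<and> bdd_above ((\<lambda>z. \<rho> z * norm (deriv f z)) ` unit_disc)}"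

text \<open>\<open>bloch0 w\<close> without the extensionality clause, so that polynomials and
  differences of members belong to it without being restricted to the disc.\<close>

definition little :: "(complex \<Rightarrow> complex) set" where
  "little = {f. f holomorphic_on unit_disc \<and>
     (\<forall>e>0. \<exists>R<1. \<forall>z\<in>unit_disc. R < norm z \<longrightarrow> \<rho> z * norm (deriv f z) < e)}"

lemma bloch_norm_eq: "bloch_norm w f = norm (f 0) + (SUP z\<in>unit_disc. \<rho> z * norm (deriv f z))"
  by (simp add: bloch_norm_def \<rho>_def)

lemma bloch_norm_leI:
  assumes "\<And>z. z \<in> unit_disc \<Longrightarrow> \<rho> z * norm (deriv f z) \<le> c"
  shows "bloch_norm w f \<le> norm (f 0) + c"
  unfolding bloch_norm_eq using assms by (intro add_left_mono cSUP_least) auto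

lemma fin_normI:
  assumes "f holomorphic_on unit_disc" "\<And>z. z \<in> unit_disc \<Longrightarrow> \<rho> z * norm (deriv f z) \<le> c"
  shows "f \<in> fin_norm"
  using assms unfolding fin_norm_def by (auto intro!: bdd_aboveI2)

lemma bloch_norm_ge:
  assumes "f \<in> fin_norm" "z \<in> unit_disc"
  shows "norm (f 0) + \<rho> z * norm (deriv f z) \<le> bloch_norm w f"
  unfolding bloch_norm_eq using assms unfolding fin_norm_def
  by (intro add_left_mono cSUP_upper) auto

lemma bloch_norm_nonneg: "f \<in> fin_norm \<Longrightarrow> 0 \<le> bloch_norm w f"
  using bloch_norm_ge[of f 0] \<rho>_pos[of 0] by (smt (verit) centre_in_ball mult_nonneg_nonneg norm_ge_zero zero_less_one)

lemma norm_0_le_bloch_norm: "f \<in> fin_norm \<Longrightarrow> norm (f 0) \<le> bloch_norm w f"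
  using bloch_norm_ge[of f 0] \<rho>_pos[of 0] by (smt (verit) centre_in_ball mult_nonneg_nonneg norm_ge_zero zero_less_one)

lemma deriv_le_bloch_norm: "f \<in> fin_norm \<Longrightarrow> z \<in> unit_disc \<Longrightarrow> \<rho> z * norm (deriv f z) \<le> bloch_norm w f"
  using bloch_norm_ge[of f z] by (smt (verit) norm_ge_zero)

lemma deriv_cong_disc:
  assumes "\<And>z. z \<in> unit_disc \<Longrightarrow> f z = g z" "z \<in> unit_disc"
  shows "deriv f z = deriv g z"
  using assms by (intro deriv_cong_ev eventually_nhds_in_open[THEN eventually_mono, of unit_disc]) auto

lemma bloch_norm_cong:
  assumes "\<And>z. z \<in> unit_disc \<Longrightarrow> f z = g z"
  shows "bloch_norm w f = bloch_norm w g"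
proof -
  have "(\<lambda>z. \<rho> z * norm (deriv f z)) ` unit_disc = (\<lambda>z. \<rho> z * norm (deriv g z)) ` unit_disc"
    using deriv_cong_disc[of f g] assms by (intro image_cong) auto
  then show ?thesis using assms[of 0] unfolding bloch_norm_eq by simp
qed

lemma little_cong:
  assumes "\<And>z. z \<in> unit_disc \<Longrightarrow> f z = g z"
  shows "f \<in> little \<longleftrightarrow> g \<in> little"
proof -
  have "f holomorphic_on unit_disc \<longleftrightarrow> g holomorphic_on unit_disc"
    using assms by (intro holomorphic_cong) auto
  moreover have "(\<forall>z\<in>unit_disc. R < norm z \<longrightarrow> \<rho> z * norm (deriv f z) < e) \<longleftrightarrow>
      (\<forall>z\<in>unit_disc. R < norm z \<longrightarrow> \<rho> z * norm (deriv g z) < e)" for R e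
    using deriv_cong_disc[of f g] assms by (intro ball_cong refl) simp
  ultimately show ?thesis unfolding little_def by simp
qed

lemma bloch0_eq: "bloch0 w = extensional unit_disc \<inter> little"
proof -
  have "((\<lambda>z. of_real ((1 - norm z) / w (1 - norm z)) * deriv f z) \<longlongrightarrow> 0) (filtercomap norm (at_left 1)) \<longleftrightarrow>
      (\<forall>e>0. \<exists>R<1. \<forall>z\<in>unit_disc. R < norm z \<longrightarrow> \<rho> z * norm (deriv f z) < e)" for f :: "complex \<Rightarrow> complex"
  proof -
    have n: "norm (of_real ((1 - norm z) / w (1 - norm z)) * deriv f z) = \<rho> z * norm (deriv f z)" if "z \<in> unit_disc" for z
      using abs_of_pos[OF \<rho>_pos[OF that]] by (simp only: norm_mult norm_of_real \<rho>_def)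
    have "(\<forall>\<^sub>F z in filtercomap norm (at_left 1). dist (of_real ((1 - norm z) / w (1 - norm z)) * deriv f z) 0 < e) \<longleftrightarrow>
        (\<exists>R<1. \<forall>z\<in>unit_disc. R < norm z \<longrightarrow> \<rho> z * norm (deriv f z) < e)" (is "?L \<longleftrightarrow> ?R") for e
    proof
      assume ?L
      then obtain Q where Q: "eventually Q (at_left (1::real))"
        "\<And>z. Q (norm z) \<Longrightarrow> norm (of_real ((1 - norm z) / w (1 - norm z)) * deriv f z) < e"
        unfolding eventually_filtercomap dist_0_norm dist_norm diff_zero by blast
      then obtain b where b: "b < 1" "\<And>y. y > b \<Longrightarrow> y < 1 \<Longrightarrow> Q y" unfolding eventually_at_left_field by blast
      show ?R
      proof (intro exI[of _ b] conjI ballI impI b(1))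
        fix z :: complex assume z: "z \<in> unit_disc" "b < norm z"
        then have "Q (norm z)" using b(2)[of "norm z"] by simp
        then show "\<rho> z * norm (deriv f z) < e" unfolding n[OF z(1), symmetric] by (rule Q(2))
      qed
    next
      assume ?R
      then obtain R where R: "R < 1" "\<And>z. z \<in> unit_disc \<Longrightarrow> R < norm z \<Longrightarrow> \<rho> z * norm (deriv f z) < e" by blast
      have "\<forall>\<^sub>F y in at_left (1::real). R < y \<and> y < 1"
        unfolding eventually_at_left_field using R(1) by blast
      then show ?L unfolding eventually_filtercomap dist_norm diff_zero
        using R(2) n by (intro exI[of _ "\<lambda>y. R < y \<and> y < 1"]) (auto simp del: of_real_divide of_real_diff)
    qed
    then show ?thesis unfolding tendsto_iff by simp
  qed
  then show ?thesis unfolding bloch0_def little_def by auto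
qed

lemma little_fin_norm:
  assumes "f \<in> little"
  shows "f \<in> fin_norm"
proof -
  have hol: "f holomorphic_on unit_disc" using assms by (simp add: little_def)
  obtain R where R: "R < 1" "\<And>z. z \<in> unit_disc \<Longrightarrow> R < norm z \<Longrightarrow> \<rho> z * norm (deriv f z) < 1"
    using assms unfolding little_def by (auto dest: spec[of _ 1])
  have "continuous_on (cball 0 R) (deriv f)"
    using R(1) by (intro holomorphic_on_imp_continuous_on holomorphic_on_subset[OF holomorphic_deriv[OF hol]]) auto
  then have "bounded (deriv f ` cball 0 R)"
    by (intro compact_imp_bounded compact_continuous_image) auto
  then obtain C where C: "C > 0" "\<And>z. norm z \<le> R \<Longrightarrow> norm (deriv f z) \<le> C"
    unfolding bounded_pos by (auto simp: dist_norm)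
  show ?thesis
  proof (rule fin_normI[OF hol])
    fix z assume z: "z \<in> unit_disc"
    show "\<rho> z * norm (deriv f z) \<le> 1 + \<rho> 0 * C"
    proof (cases "R < norm z")
      case True
      then show ?thesis using R(2)[OF z True] \<rho>_pos[of 0] C(1) by (simp add: add_increasing2)
    next
      case False
      then have "\<rho> z * norm (deriv f z) \<le> \<rho> 0 * C"
        using C(2)[of z] \<rho>_mono[OF z, of 0] \<rho>_pos[OF z] \<rho>_pos[of 0] C(1) by (intro mult_mono) auto
      then show ?thesis by simp
    qed
  qed
qed

lemma deriv_add_disc:
  assumes "f holomorphic_on unit_disc" "g holomorphic_on unit_disc" "z \<in> unit_disc"
  shows "deriv (\<lambda>z. c * f z + d * g z) z = c * deriv f z + d * deriv g z"
proof (rule DERIV_imp_deriv)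
  have "(f has_field_derivative deriv f z) (at z)" "(g has_field_derivative deriv g z) (at z)"
    using assms by (auto intro!: holomorphic_derivI[of _ unit_disc])
  then show "((\<lambda>z. c * f z + d * g z) has_field_derivative c * deriv f z + d * deriv g z) (at z)"
    by (auto intro!: derivative_eq_intros)
qed

lemma \<rho>_lincomb:
  assumes "f holomorphic_on unit_disc" "g holomorphic_on unit_disc" "z \<in> unit_disc"
  shows "\<rho> z * norm (deriv (\<lambda>z. c * f z + d * g z) z) \<le>
    norm c * (\<rho> z * norm (deriv f z)) + norm d * (\<rho> z * norm (deriv g z))"
proof -
  have "norm (c * deriv f z + d * deriv g z) \<le> norm c * norm (deriv f z) + norm d * norm (deriv g z)"
    using norm_triangle_ineq[of "c * deriv f z" "d * deriv g z"] by (simp add: norm_mult)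
  then have "\<rho> z * norm (c * deriv f z + d * deriv g z) \<le> \<rho> z * (norm c * norm (deriv f z) + norm d * norm (deriv g z))"
    using \<rho>_pos[OF assms(3)] by (intro mult_left_mono) auto
  then show ?thesis unfolding deriv_add_disc[OF assms] by (simp add: algebra_simps)
qed

lemma bloch_norm_lincomb:
  assumes f: "f \<in> fin_norm" and g: "g \<in> fin_norm"
  shows "(\<lambda>z. c * f z + d * g z) \<in> fin_norm"
    and "bloch_norm w (\<lambda>z. c * f z + d * g z) \<le> norm c * bloch_norm w f + norm d * bloch_norm w g"
proof -
  have hol: "f holomorphic_on unit_disc" "g holomorphic_on unit_disc"
    using f g by (auto simp: fin_norm_def)
  have bd: "\<rho> z * norm (deriv (\<lambda>z. c * f z + d * g z) z) \<le>
      norm c * (bloch_norm w f - norm (f 0)) + norm d * (bloch_norm w g - norm (g 0))" if z: "z \<in> unit_disc" for z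
  proof -
    have "norm c * (\<rho> z * norm (deriv f z)) \<le> norm c * (bloch_norm w f - norm (f 0))"
      "norm d * (\<rho> z * norm (deriv g z)) \<le> norm d * (bloch_norm w g - norm (g 0))"
      using bloch_norm_ge[OF f z] bloch_norm_ge[OF g z] by (auto intro!: mult_left_mono)
    then show ?thesis using \<rho>_lincomb[OF hol z, of c d] by linarith
  qed
  show "(\<lambda>z. c * f z + d * g z) \<in> fin_norm"
    by (rule fin_normI[OF _ bd]) (intro holomorphic_intros hol)
  have "bloch_norm w (\<lambda>z. c * f z + d * g z) \<le> norm (c * f 0 + d * g 0) +
      (norm c * (bloch_norm w f - norm (f 0)) + norm d * (bloch_norm w g - norm (g 0)))"
    by (rule bloch_norm_leI[OF bd])
  moreover have "norm (c * f 0 + d * g 0) \<le> norm c * norm (f 0) + norm d * norm (g 0)"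
    using norm_triangle_ineq[of "c * f 0" "d * g 0"] by (simp add: norm_mult)
  ultimately show "bloch_norm w (\<lambda>z. c * f z + d * g z) \<le> norm c * bloch_norm w f + norm d * bloch_norm w g"
    by (simp add: algebra_simps)
qed

lemma little_lincomb:
  assumes f: "f \<in> little" and g: "g \<in> little"
  shows "(\<lambda>z. c * f z + d * g z) \<in> little"
proof -
  have hol: "f holomorphic_on unit_disc" "g holomorphic_on unit_disc"
    using f g by (auto simp: little_def)
  have "\<exists>R<1. \<forall>z\<in>unit_disc. R < norm z \<longrightarrow> \<rho> z * norm (deriv (\<lambda>z. c * f z + d * g z) z) < e" if e: "e > 0" for e
  proof -
    define M where "M = norm c + norm d + 1"
    have M: "M > 0" by (auto simp: M_def intro: add_nonneg_pos)
    obtain R1 where R1: "R1 < 1" "\<And>z. z \<in> unit_disc \<Longrightarrow> R1 < norm z \<Longrightarrow> \<rho> z * norm (deriv f z) < e / M"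
      using f e M unfolding little_def by (auto dest: spec[of _ "e / M"])
    obtain R2 where R2: "R2 < 1" "\<And>z. z \<in> unit_disc \<Longrightarrow> R2 < norm z \<Longrightarrow> \<rho> z * norm (deriv g z) < e / M"
      using g e M unfolding little_def by (auto dest: spec[of _ "e / M"])
    show ?thesis
    proof (intro exI[of _ "max R1 R2"] conjI ballI impI)
      fix z assume z: "z \<in> unit_disc" "max R1 R2 < norm z"
      have "\<rho> z * norm (deriv (\<lambda>z. c * f z + d * g z) z) \<le> norm c * (e / M) + norm d * (e / M)"
        using \<rho>_lincomb[OF hol z(1), of c d] R1(2)[of z] R2(2)[of z] z
          mult_left_mono[of "\<rho> z * norm (deriv f z)" "e / M" "norm c"]
          mult_left_mono[of "\<rho> z * norm (deriv g z)" "e / M" "norm d"] by simp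
      also have "\<dots> = (norm c + norm d) * (e / M)" by (simp add: algebra_simps)
      also have "\<dots> < M * (e / M)" using M e by (intro mult_strict_right_mono) (auto simp: M_def)
      also have "\<dots> = e" using M by simp
      finally show "\<rho> z * norm (deriv (\<lambda>z. c * f z + d * g z) z) < e" .
    qed (use R1 R2 in auto)
  qed
  moreover have "(\<lambda>z. c * f z + d * g z) holomorphic_on unit_disc" by (intro holomorphic_intros hol)
  ultimately show ?thesis unfolding little_def by blast
qed

lemma \<rho>_tendsto_0:
  assumes "e > 0"
  obtains R where "R < 1" "\<And>z. z \<in> unit_disc \<Longrightarrow> R < norm z \<Longrightarrow> \<rho> z < e"
proof -
  have "\<forall>\<^sub>F t in at_right 0. t / w t < e"
    using weight_tendsto_0 assms by (rule order_tendstoD)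
  then obtain b where b: "b > 0" "\<And>t. 0 < t \<Longrightarrow> t < b \<Longrightarrow> t / w t < e"
    unfolding eventually_at_right_field by auto
  show ?thesis
    by (rule that[of "1 - b"]) (use b in \<open>auto simp: \<rho>_def\<close>)
qed

lemma bounded_deriv_little:
  assumes hol: "f holomorphic_on unit_disc" and C: "\<And>z. z \<in> unit_disc \<Longrightarrow> norm (deriv f z) \<le> C"
  shows "f \<in> little"
proof -
  have "\<exists>R<1. \<forall>z\<in>unit_disc. R < norm z \<longrightarrow> \<rho> z * norm (deriv f z) < e" if e: "e > 0" for e
  proof -
    have C0: "C \<ge> 0" using C[of 0] by (smt (verit) centre_in_ball norm_ge_zero zero_less_one)
    obtain R where R: "R < 1" "\<And>z. z \<in> unit_disc \<Longrightarrow> R < norm z \<Longrightarrow> \<rho> z < e / (C + 1)"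
      using \<rho>_tendsto_0[of "e / (C + 1)"] e C0 by (auto simp: field_simps)
    show ?thesis
    proof (intro exI[of _ R] conjI R ballI impI)
      fix z assume z: "z \<in> unit_disc" "R < norm z"
      have "\<rho> z * norm (deriv f z) \<le> \<rho> z * C"
        using C[OF z(1)] \<rho>_pos[OF z(1)] by (intro mult_left_mono) auto
      also have "\<dots> < e / (C + 1) * (C + 1)"
        using R(2)[OF z] \<rho>_pos[OF z(1)] C0 e by (intro mult_strict_mono) auto
      finally show "\<rho> z * norm (deriv f z) < e" using C0 by simp
    qed
  qed
  then show ?thesis using hol unfolding little_def by blast
qed

lemma poly_bounded_disc:
  fixes p :: "complex poly"
  obtains C where "C > 0" "\<And>z. z \<in> cball 0 1 \<Longrightarrow> norm (poly p z) \<le> C"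
proof -
  have "bounded (poly p ` cball 0 1)"
    by (intro compact_imp_bounded compact_continuous_image continuous_intros compact_cball)
  then show ?thesis using that unfolding bounded_pos by auto
qed

lemma deriv_poly [simp]: "deriv (poly p) z = poly (pderiv p) z"
  by (rule DERIV_imp_deriv[OF poly_DERIV])

lemma poly_little: "poly p \<in> little"
proof -
  obtain C where C: "C > 0" "\<And>z. z \<in> cball 0 1 \<Longrightarrow> norm (poly (pderiv p) z) \<le> C"
    using poly_bounded_disc by blast
  show ?thesis
    by (rule bounded_deriv_little[where C = C]) (use C in \<open>auto intro!: holomorphic_intros\<close>)
qed

lemma poly_fin_norm: "poly p \<in> fin_norm"
  by (rule little_fin_norm[OF poly_little])

lemma bloch_norm_poly_add: "bloch_norm w (poly (p + q)) \<le> bloch_norm w (poly p) + bloch_norm w (poly q)"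
  using bloch_norm_lincomb(2)[OF poly_fin_norm poly_fin_norm, of 1 p 1 q] by (simp add: poly_add[abs_def])

lemma bloch_norm_poly_smult: "bloch_norm w (poly (smult c p)) \<le> norm c * bloch_norm w (poly p)"
  using bloch_norm_lincomb(2)[OF poly_fin_norm poly_fin_norm, of c p 0 0] by (simp add: poly_smult[abs_def])

text \<open>Serves to keep \<open>p * S\<close> small when \<open>S\<close> is small. In the
  derivative of the product the term with \<open>pderiv p\<close> requires a bound of
  \<open>q\<close> itself, obtained by integrating the derivative of \<open>q\<close> from the
  centre.\<close>

lemma bloch_norm_poly_mult:
  obtains C where "C > 0" "\<And>q. bloch_norm w (poly (p * q)) \<le> C * bloch_norm w (poly q)"
proof -
  obtain C where C: "C > 0" "\<And>z. z \<in> cball 0 1 \<Longrightarrow> norm (poly p z) \<le> C"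
    using poly_bounded_disc by blast
  obtain C' where C': "C' > 0" "\<And>z. z \<in> cball 0 1 \<Longrightarrow> norm (poly (pderiv p) z) \<le> C'"
    using poly_bounded_disc by blast
  have \<rho>0: "\<rho> 0 > 0" by (rule \<rho>_pos) simp
  show ?thesis
  proof (rule that[of "C + (C' * (\<rho> 0 + 1) + C)"])
    show "C + (C' * (\<rho> 0 + 1) + C) > 0" using C C' \<rho>0 by (simp add: add_pos_pos)
    fix q :: "complex poly"
    define N where "N = bloch_norm w (poly q)"
    have N: "N \<ge> 0" unfolding N_def by (rule bloch_norm_nonneg[OF poly_fin_norm])
    have q0: "norm (poly q 0) \<le> N"
      unfolding N_def by (rule norm_0_le_bloch_norm[OF poly_fin_norm])
    have q': "\<rho> z * norm (poly (pderiv q) z) \<le> N" if "z \<in> unit_disc" for z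
      using deriv_le_bloch_norm[OF poly_fin_norm that, of q] by (simp add: N_def)
    \<comment> \<open>As \<open>\<rho>\<close> decreases in \<open>|z|\<close>, the derivative on the segment from \<open>0\<close> to \<open>z\<close> is at most \<open>N / \<rho> z\<close>.\<close>
    have growth: "\<rho> z * norm (poly q z) \<le> (\<rho> 0 + 1) * N" if z: "z \<in> unit_disc" for z
    proof -
      have "norm (poly q z - poly q 0) \<le> (N / \<rho> z) * norm (z - 0)"
      proof (rule field_differentiable_bound[of "cball 0 (norm z)"])
        show "(poly q has_field_derivative poly (pderiv q) x) (at x within cball 0 (norm z))" for x
          by (rule DERIV_subset[OF poly_DERIV]) simp
        fix x :: complex assume x: "x \<in> cball 0 (norm z)"
        then have "x \<in> unit_disc" using z by auto
        have "\<rho> z * norm (poly (pderiv q) x) \<le> \<rho> x * norm (poly (pderiv q) x)"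
          using \<rho>_mono[OF z, of x] x by (intro mult_right_mono) auto
        also have "\<dots> \<le> N" by (rule q'[OF \<open>x \<in> unit_disc\<close>])
        finally show "norm (poly (pderiv q) x) \<le> N / \<rho> z" using \<rho>_pos[OF z] by (simp add: field_simps)
      qed auto
      then have "\<rho> z * norm (poly q z - poly q 0) \<le> \<rho> z * ((N / \<rho> z) * norm z)"
        using \<rho>_pos[OF z] by (intro mult_left_mono) auto
      also have "\<dots> = N * norm z" using \<rho>_pos[OF z] by simp
      also have "\<dots> \<le> N * 1" using z N by (intro mult_left_mono) auto
      finally have "\<rho> z * norm (poly q z - poly q 0) \<le> N" by simp
      moreover have "\<rho> z * norm (poly q 0) \<le> \<rho> 0 * N"
        using q0 \<rho>_mono[OF z, of 0] \<rho>_pos[OF z] \<rho>0 by (intro mult_mono) auto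
      moreover have "\<rho> z * norm (poly q z) \<le> \<rho> z * (norm (poly q z - poly q 0) + norm (poly q 0))"
        using \<rho>_pos[OF z] norm_triangle_sub[of "poly q z" "poly q 0"] by (intro mult_left_mono) auto
      ultimately show ?thesis by (simp add: algebra_simps)
    qed
    have "bloch_norm w (poly (p * q)) \<le> norm (poly (p * q) 0) + (C' * (\<rho> 0 + 1) + C) * N"
    proof (rule bloch_norm_leI)
      fix z assume z: "z \<in> unit_disc"
      then have zc: "z \<in> cball 0 1" by auto
      have "norm (deriv (poly (p * q)) z) \<le> norm (poly p z) * norm (poly (pderiv q) z) + norm (poly (pderiv p) z) * norm (poly q z)"
        using norm_triangle_ineq[of "poly p z * poly (pderiv q) z" "poly (pderiv p) z * poly q z"]
        by (simp add: pderiv_mult norm_mult mult.commute)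
      also have "\<dots> \<le> C * norm (poly (pderiv q) z) + C' * norm (poly q z)"
        using C(2)[OF zc] C'(2)[OF zc] by (intro add_mono mult_right_mono) auto
      finally have "\<rho> z * norm (deriv (poly (p * q)) z) \<le> \<rho> z * (C * norm (poly (pderiv q) z) + C' * norm (poly q z))"
        using \<rho>_pos[OF z] by (intro mult_left_mono) auto
      also have "\<dots> = C * (\<rho> z * norm (poly (pderiv q) z)) + C' * (\<rho> z * norm (poly q z))"
        by (simp add: algebra_simps)
      also have "\<dots> \<le> C * N + C' * ((\<rho> 0 + 1) * N)"
        using q'[OF z] growth[OF z] C(1) C'(1) by (intro add_mono mult_left_mono) auto
      finally show "\<rho> z * norm (deriv (poly (p * q)) z) \<le> (C' * (\<rho> 0 + 1) + C) * N" by (simp add: algebra_simps)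
    qed
    moreover have "norm (poly (p * q) 0) \<le> C * N"
      using C q0 by (simp add: norm_mult) (intro mult_mono, auto)
    ultimately show "bloch_norm w (poly (p * q)) \<le> (C + (C' * (\<rho> 0 + 1) + C)) * bloch_norm w (poly q)"
      unfolding N_def[symmetric] by (simp add: algebra_simps)
  qed
qed

end

lemma majorant_weightE:
  assumes "majorant w"
  obtains \<alpha> where "majorant_weight w \<alpha>"
  using assms unfolding majorant_def majorant_weight_def by auto

section \<open>Lacunary polynomials in the Bloch norm\<close>

text \<open>Quadratic decay in \<open>n * t\<close> is what is needed: one power pays for the factor
  \<open>2 ^ k\<close> produced by differentiation, the other one makes the dyadic sum
  converge.\<close>

lemma power_one_minus_le:
  fixes t :: real
  assumes "0 < t" "t \<le> 1" "n > 0"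
  shows "(1 - t) ^ n \<le> 2 / (n * t)^2"
proof -
  have "(1 - t) ^ n \<le> exp (- t) ^ n"
    using assms exp_ge_add_one_self[of "- t"] by (intro power_mono) auto
  also have "\<dots> = inverse (exp (n * t))"
    by (simp add: exp_minus power_inverse flip: exp_of_nat_mult)
  also have "\<dots> \<le> inverse ((n * t)^2 / 2)"
  proof (rule le_imp_inverse_le)
    have "0 \<le> n * t" using assms by simp
    then show "(n * t)^2 / 2 \<le> exp (n * t)"
      using exp_lower_Taylor_quadratic[of "n * t"] by linarith
  qed (use assms in simp)
  finally show ?thesis by simp
qed

lemma pderiv_sum: "pderiv (\<Sum>i\<in>A. f i) = (\<Sum>i\<in>A. pderiv (f i))"
  by (induction A rule: infinite_finite_induct) (simp_all add: pderiv_add)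

context majorant_weight
begin

text \<open>At frequencies below \<open>1 / t\<close> the power is bounded by 1 and the growth
  condition on \<open>w\<close> does the work: relative to \<open>w t / t\<close> the terms decay
  geometrically towards small \<open>k\<close>, because \<open>\<alpha> < 1\<close>.\<close>

lemma dyadic_term_small:
  assumes t: "0 < t" "t \<le> 1" and k: "k \<ge> 1" "2 ^ k * t \<le> 1"
  shows "w (1 / 2 ^ k) * 2 ^ k * (1 - t) ^ (2 ^ (k - 1)) \<le> (w t / t) * (2 ^ k * t) powr (1 - \<alpha>)"
proof -
  have tk: "t \<le> 1 / 2 ^ k" using k by (simp add: field_simps)
  have "w (1 / 2 ^ k) * 2 ^ k * (1 - t) ^ (2 ^ (k - 1)) \<le> w (1 / 2 ^ k) * 2 ^ k * 1"
    using t pos_w[of "1 / 2 ^ k"] by (intro mult_left_mono power_le_one) (auto simp: less_imp_le)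
  also have "w (1 / 2 ^ k) * 2 ^ k \<le> (w t / t) * (2 ^ k * t) powr (1 - \<alpha>)"
  proof -
    have "w (1 / 2 ^ k) * t powr \<alpha> \<le> w t * (1 / 2 ^ k) powr \<alpha>"
      by (rule w_scale[OF t(1) tk]) simp
    then have "w (1 / 2 ^ k) \<le> w t * (1 / 2 ^ k) powr \<alpha> / t powr \<alpha>"
      using t by (simp add: field_simps)
    also have "\<dots> = w t * inverse ((2 ^ k * t) powr \<alpha>)"
      using t by (simp add: powr_mult powr_divide field_simps)
    finally have "w (1 / 2 ^ k) * 2 ^ k \<le> w t * inverse ((2 ^ k * t) powr \<alpha>) * 2 ^ k"
      by (intro mult_right_mono) auto
    also have "\<dots> = (w t / t) * ((2 ^ k * t) * inverse ((2 ^ k * t) powr \<alpha>))"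
      using t by (simp add: field_simps)
    also have "(2 ^ k * t) * inverse ((2 ^ k * t) powr \<alpha>) = (2 ^ k * t) powr (1 - \<alpha>)"
      using t by (simp add: powr_diff divide_inverse)
    finally show ?thesis .
  qed
  finally show ?thesis by simp
qed

text \<open>At frequencies above \<open>1 / t\<close> monotonicity of \<open>w\<close> and the decay
  of the power suffice. 8 = 2 * 2^2, the square being due to the exponent \<open>2 ^ (k - 1)\<close>
  in place of \<open>2 ^ k\<close>.\<close>

lemma dyadic_term_large:
  assumes t: "0 < t" "t \<le> 1" and k: "k \<ge> 1" "1 \<le> 2 ^ k * t"
  shows "w (1 / 2 ^ k) * 2 ^ k * (1 - t) ^ (2 ^ (k - 1)) \<le> (w t / t) * (8 / (2 ^ k * t))"
proof -
  have tk: "1 / 2 ^ k \<le> t" using k by (simp add: field_simps)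
  have e: "(2::real) ^ k = 2 * 2 ^ (k - 1)" using k(1) by (metis One_nat_def Suc_le_eq Suc_pred power_Suc)
  have "(1 - t) ^ (2 ^ (k - 1)) \<le> 2 / (real (2 ^ (k - 1)) * t)^2"
    using t by (intro power_one_minus_le) auto
  also have "\<dots> = 8 / (2 ^ k * t)^2"
    unfolding e by (simp add: power2_eq_square)
  finally have "w (1 / 2 ^ k) * 2 ^ k * (1 - t) ^ (2 ^ (k - 1)) \<le> w t * 2 ^ k * (8 / (2 ^ k * t)^2)"
    using t w_mono[OF _ tk] pos_w[of t] by (intro mult_mono) auto
  also have "\<dots> = (w t / t) * (8 / (2 ^ k * t))"
    using t by (simp add: field_simps power2_eq_square)
  finally show ?thesis .
qed

text \<open>Two geometric series, on either side of the scale where \<open>2 ^ k\<close> is about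
  \<open>1 / t\<close>, bound the sum by a multiple of \<open>w t / t\<close>. So lacunary series
  with coefficients below \<open>w (1 / 2 ^ k)\<close> have bounded Bloch norm. The exponent
  \<open>2 ^ (k - 1)\<close> leaves room for lowering the frequencies by a constant.\<close>

lemma dyadic_sum_le:
  obtains C where "C > 0" "\<And>t A. 0 < t \<Longrightarrow> t \<le> 1 \<Longrightarrow> finite A \<Longrightarrow> \<forall>k\<in>A. k \<ge> 1 \<Longrightarrow>
    (\<Sum>k\<in>A. w (1 / 2 ^ k) * 2 ^ k * (1 - t) ^ (2 ^ (k - 1))) \<le> C * (w t / t)"
proof -
  define r where "r = (1 / 2) powr (1 - \<alpha>)"
  have r: "0 < r" "r < 1" using \<alpha> powr_less_mono'[of "1 / 2" 0 "1 - \<alpha>"] by (auto simp: r_def)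
  show ?thesis
  \<comment> \<open>The first summand is the series of ratio \<open>r\<close> below the critical
    scale, the second one bounds 8 times the series of ratio 1/2 above it.\<close>
  proof (rule that[of "1 / (1 - r) + 16"])
    show "1 / (1 - r) + 16 > 0" using r by (simp add: add_pos_pos)
    fix t :: real and A :: "nat set"
    assume t: "0 < t" "t \<le> 1" and fin: "finite A" and A1: "\<forall>k\<in>A. k \<ge> 1"
    have "\<exists>k::nat. 1 < 2 ^ k * t"
    proof -
      obtain k :: nat where "1 / t < 2 ^ k" using real_arch_pow[of 2 "1 / t"] by auto
      then show ?thesis using t by (intro exI[of _ k]) (simp add: field_simps)
    qed
    then obtain K :: nat where K: "1 < 2 ^ K * t" "\<And>k. k < K \<Longrightarrow> 2 ^ k * t \<le> 1"
      using exists_least_iff[of "\<lambda>k::nat. 1 < 2 ^ k * t"] by (metis not_le)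
    have wt: "w t / t > 0" using t pos_w by simp
    define g where "g = (\<lambda>k. if k < K then r ^ (K - Suc k) else 8 * (1 / 2) ^ (k - K))"
    have g0: "g k \<ge> 0" for k using r by (simp add: g_def)
    have tb: "w (1 / 2 ^ k) * 2 ^ k * (1 - t) ^ (2 ^ (k - 1)) \<le> (w t / t) * g k" if k: "k \<ge> 1" for k
    proof (cases "k < K")
      case True
      have "2 ^ (K - 1) * t \<le> 1" using K(2)[of "K - 1"] True by simp
      moreover have "(2::real) ^ (K - 1) = 2 ^ k * 2 ^ (K - Suc k)"
        using True by (simp flip: power_add)
      ultimately have "2 ^ k * t \<le> (1 / 2) ^ (K - Suc k)" by (simp add: power_one_over field_simps)
      then have "(2 ^ k * t) powr (1 - \<alpha>) \<le> ((1 / 2) ^ (K - Suc k)) powr (1 - \<alpha>)"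
        using t \<alpha> by (intro powr_mono2) auto
      also have "\<dots> = r ^ (K - Suc k)"
        by (simp add: r_def powr_powr mult.commute flip: powr_realpow)
      finally show ?thesis
        using dyadic_term_small[OF t k K(2)[OF True]] True wt
          mult_left_mono[of "(2 ^ k * t) powr (1 - \<alpha>)" "r ^ (K - Suc k)" "w t / t"]
        by (simp add: g_def)
    next
      case False
      have e: "(2::real) ^ k = 2 ^ K * 2 ^ (k - K)" using False by (simp flip: power_add)
      have "1 * 2 ^ (k - K) \<le> (2 ^ K * t) * (2::real) ^ (k - K)" using K(1) by (intro mult_right_mono) auto
      then have le: "2 ^ (k - K) \<le> 2 ^ k * t" unfolding e by (simp add: mult_ac)
      have "1 \<le> (2::real) ^ (k - K)" by simp
      then have "1 \<le> 2 ^ k * t" using le by linarith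
      moreover have "8 / (2 ^ k * t) \<le> 8 / 2 ^ (k - K)" using le by (intro divide_left_mono) (auto intro!: mult_pos_pos t)
      ultimately show ?thesis
        using dyadic_term_large[OF t k] False wt
          mult_left_mono[of "8 / (2 ^ k * t)" "8 / 2 ^ (k - K)" "w t / t"]
        by (simp add: g_def power_one_over)
    qed
    define n where "n = Suc (Max (insert 0 A))"
    have An: "A \<subseteq> {..<K + n}"
    proof
      fix k assume "k \<in> A"
      then have "k \<le> Max (insert 0 A)" using fin by (intro Max_ge) auto
      then show "k \<in> {..<K + n}" by (simp add: n_def)
    qed
    have "sum g A \<le> sum g {..<K + n}" using An g0 by (intro sum_mono2) auto
    also have "{..<K + n} = {..<K} \<union> {K..<K + n}" by auto
    also have "sum g \<dots> = sum g {..<K} + sum g {K..<K + n}" by (intro sum.union_disjoint) auto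
    also have "sum g {..<K} = (\<Sum>j<K. r ^ j)"
      using sum.nat_diff_reindex[of "\<lambda>j. r ^ j" K] by (simp add: g_def cong: sum.cong_simp)
    also have "\<dots> \<le> 1 / (1 - r)"
    proof -
      have "(\<Sum>j<K. r ^ j) = (1 - r ^ K) / (1 - r)" using r by (simp add: sum_gp_strict)
      also have "\<dots> \<le> 1 / (1 - r)" using r by (intro divide_right_mono) auto
      finally show ?thesis .
    qed
    also have "sum g {K..<K + n} = (\<Sum>j<n. 8 * (1 / 2) ^ j)"
      using sum.shift_bounds_nat_ivl[of g 0 K n] by (simp add: g_def add.commute lessThan_atLeast0)
    also have "\<dots> = 8 * (\<Sum>j<n. (1 / 2) ^ j)" by (simp add: sum_distrib_left)
    also have "(\<Sum>j<n. (1 / 2 :: real) ^ j) \<le> 2" by (simp add: sum_gp_strict)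
    finally have g: "sum g A \<le> 1 / (1 - r) + 16" by simp
    have "(\<Sum>k\<in>A. w (1 / 2 ^ k) * 2 ^ k * (1 - t) ^ (2 ^ (k - 1))) \<le> (\<Sum>k\<in>A. (w t / t) * g k)"
      using A1 by (intro sum_mono tb) auto
    also have "\<dots> = sum g A * (w t / t)"
      unfolding sum_distrib_left[symmetric] by (rule mult.commute)
    also have "\<dots> \<le> (1 / (1 - r) + 16) * (w t / t)"
      using g wt by (intro mult_right_mono) auto
    finally show "(\<Sum>k\<in>A. w (1 / 2 ^ k) * 2 ^ k * (1 - t) ^ (2 ^ (k - 1))) \<le> (1 / (1 - r) + 16) * (w t / t)" .
  qed
qed

lemma pderiv_monom_mult_le:
  fixes p :: "complex poly"
  assumes C: "\<And>z. z \<in> cball 0 1 \<Longrightarrow> norm (poly p z) \<le> C" "\<And>z. z \<in> cball 0 1 \<Longrightarrow> norm (poly (pderiv p) z) \<le> C"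
    and n: "2 ^ (k - 1) \<le> n" "n < 2 ^ k" and z: "z \<in> unit_disc"
  shows "norm (poly (pderiv (monom 1 (Suc n) * p)) z) \<le> 2 * C * 2 ^ k * (norm z) ^ (2 ^ (k - 1))"
proof -
  have zc: "z \<in> cball 0 1" and z1: "norm z \<le> 1" using z by auto
  have C0: "0 \<le> C" using C(1)[OF zc] norm_ge_zero order_trans by blast
  have zn: "norm z ^ n \<le> norm z ^ (2 ^ (k - 1))" using n z1 by (intro power_decreasing) auto
  have k1: "(1::real) \<le> 2 ^ k" by simp
  have "poly (pderiv (monom 1 (Suc n) * p)) z = z ^ Suc n * poly (pderiv p) z + of_nat (Suc n) * z ^ n * poly p z"
    by (simp add: pderiv_mult pderiv_monom poly_monom)
  also have "norm \<dots> \<le> norm z ^ Suc n * C + real (Suc n) * norm z ^ n * C"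
  proof (rule order_trans[OF norm_triangle_ineq], rule add_mono)
    show "norm (z ^ Suc n * poly (pderiv p) z) \<le> norm z ^ Suc n * C"
      unfolding norm_mult norm_power using C(2)[OF zc] by (intro mult_left_mono) auto
    show "norm (of_nat (Suc n) * z ^ n * poly p z) \<le> real (Suc n) * norm z ^ n * C"
      unfolding norm_mult norm_power norm_of_nat using C(1)[OF zc] by (intro mult_left_mono) auto
  qed
  also have "\<dots> \<le> (norm z ^ (2 ^ (k - 1)) * 2 ^ k) * C + (2 ^ k * norm z ^ (2 ^ (k - 1))) * C"
  proof (intro add_mono mult_right_mono C0)
    have "norm z ^ Suc n \<le> norm z ^ n * 1" using z1 by (simp add: mult_left_le_one_le)
    also have "\<dots> \<le> norm z ^ (2 ^ (k - 1)) * 2 ^ k" using zn k1 by (intro mult_mono) auto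
    finally show "norm z ^ Suc n \<le> norm z ^ (2 ^ (k - 1)) * 2 ^ k" .
    have "real (Suc n) \<le> real (2 ^ k)" using n(2) by (simp only: of_nat_le_iff Suc_le_eq)
    then show "real (Suc n) * norm z ^ n \<le> 2 ^ k * norm z ^ (2 ^ (k - 1))" using zn by (intro mult_mono) auto
  qed
  finally show ?thesis by (simp add: algebra_simps)
qed

text \<open>Frequencies \<open>2 ^ k\<close> beyond \<open>d + m\<close> absorb the negative
  frequencies of \<open>T\<close> and still leave the factor \<open>z ^ m\<close>. \<open>C\<close>
  and \<open>k0\<close> depend on \<open>T\<close> and \<open>m\<close> but not on the block, so
  \<open>\<delta>\<close> can be chosen after them.\<close>

lemma lacunary_poly:
  fixes T :: "complex \<Rightarrow> complex" and m :: nat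
  assumes "trig_poly T"
  obtains C k0 where "C > 0" "\<And>A b \<delta>. finite A \<Longrightarrow> \<forall>k\<in>A. k > k0 \<Longrightarrow> \<delta> \<ge> 0 \<Longrightarrow>
    \<forall>k\<in>A. 0 \<le> b k \<and> b k \<le> \<delta> * w (1 / 2 ^ k) \<Longrightarrow>
    \<exists>P. (\<forall>z\<in>sphere 0 1. z ^ m * poly P z = T z * lacunary b A z) \<and> bloch_norm w (poly P) \<le> C * \<delta>"
proof -
  obtain d p where p: "\<forall>z\<in>sphere 0 1. T z * z ^ d = poly p z"
    using assms unfolding trig_poly_def by blast
  obtain Ca where Ca: "Ca > 0" "\<And>z. z \<in> cball 0 1 \<Longrightarrow> norm (poly p z) \<le> Ca"
    using poly_bounded_disc[of p] by blast
  obtain Cb where Cb: "Cb > 0" "\<And>z. z \<in> cball 0 1 \<Longrightarrow> norm (poly (pderiv p) z) \<le> Cb"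
    using poly_bounded_disc[of "pderiv p"] by blast
  define C0 where "C0 = max Ca Cb"
  have C0: "C0 > 0" "\<And>z. z \<in> cball 0 1 \<Longrightarrow> norm (poly p z) \<le> C0"
    "\<And>z. z \<in> cball 0 1 \<Longrightarrow> norm (poly (pderiv p) z) \<le> C0"
    using Ca Cb by (fastforce simp: C0_def)+
  obtain C1 where C1: "C1 > 0" "\<And>t A. 0 < t \<Longrightarrow> t \<le> 1 \<Longrightarrow> finite A \<Longrightarrow> \<forall>k\<in>A. k \<ge> 1 \<Longrightarrow>
    (\<Sum>k\<in>A. w (1 / 2 ^ k) * 2 ^ k * (1 - t) ^ (2 ^ (k - 1))) \<le> C1 * (w t / t)"
    using dyadic_sum_le by blast
  \<comment> \<open>The additional 1 writes the remaining exponent \<open>2 ^ k - d - m\<close> as a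
    successor; hence \<open>P\<close> vanishes at 0 and its Bloch norm consists of the derivative
    part alone.\<close>
  define D where "D = d + m + 1"
  show ?thesis
  proof (rule that[of "2 * C0 * C1" D])
    show "2 * C0 * C1 > 0" using C0 C1 by simp
    fix A :: "nat set" and b :: "nat \<Rightarrow> real" and \<delta> :: real
    assume fin: "finite A" and A: "\<forall>k\<in>A. k > D" and \<delta>: "\<delta> \<ge> 0"
      and b: "\<forall>k\<in>A. 0 \<le> b k \<and> b k \<le> \<delta> * w (1 / 2 ^ k)"
    define n where "n = (\<lambda>k::nat. 2 ^ k - D)"
    have n: "2 ^ k = Suc (n k) + (d + m)" "2 ^ (k - 1) \<le> n k" "n k < 2 ^ k" "k \<ge> 1" if "k \<in> A" for k
    proof -
      have kD: "k > D" using A that by blast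
      have "(2::nat) ^ k = 2 * 2 ^ (k - 1)" using kD by (metis gr_implies_not0 power_eq_if)
      moreover have "k - 1 < (2::nat) ^ (k - 1)" by (rule less_exp)
      ultimately show "2 ^ k = Suc (n k) + (d + m)" "2 ^ (k - 1) \<le> n k" "n k < 2 ^ k" "k \<ge> 1"
        using kD unfolding n_def D_def by linarith+
    qed
    define P where "P = (\<Sum>k\<in>A. smult (of_real (b k)) (monom 1 (Suc (n k)) * p))"
    show "\<exists>P. (\<forall>z\<in>sphere 0 1. z ^ m * poly P z = T z * lacunary b A z) \<and> bloch_norm w (poly P) \<le> 2 * C0 * C1 * \<delta>"
    proof (intro exI[of _ P] conjI ballI)
      fix z :: complex assume z: "z \<in> sphere 0 1"
      have "z ^ m * poly P z = (\<Sum>k\<in>A. of_real (b k) * (z ^ m * z ^ Suc (n k) * poly p z))"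
        by (simp add: P_def poly_sum poly_monom sum_distrib_left mult_ac)
      also have "\<dots> = (\<Sum>k\<in>A. of_real (b k) * (T z * z ^ (2 ^ k)))"
      proof (intro sum.cong refl)
        fix k assume k: "k \<in> A"
        show "of_real (b k) * (z ^ m * z ^ Suc (n k) * poly p z) = of_real (b k) * (T z * z ^ (2 ^ k))"
          unfolding n(1)[OF k] p[rule_format, OF z, symmetric] by (simp add: power_add mult_ac)
      qed
      also have "\<dots> = T z * lacunary b A z"
        by (simp add: lacunary_def sum_distrib_left mult_ac)
      finally show "z ^ m * poly P z = T z * lacunary b A z" .
    next
      have "bloch_norm w (poly P) \<le> norm (poly P 0) + 2 * C0 * C1 * \<delta>"
      proof (rule bloch_norm_leI)
        fix z assume z: "z \<in> unit_disc"
        define t where "t = 1 - norm z"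
        have t: "0 < t" "t \<le> 1" using z by (auto simp: t_def)
        have "norm (deriv (poly P) z) = norm (\<Sum>k\<in>A. of_real (b k) * poly (pderiv (monom 1 (Suc (n k)) * p)) z)"
          by (simp add: P_def pderiv_sum pderiv_smult poly_sum)
        also have "\<dots> \<le> (\<Sum>k\<in>A. b k * norm (poly (pderiv (monom 1 (Suc (n k)) * p)) z))"
          using b by (intro sum_norm_le) (simp add: norm_mult)
        also have "\<dots> \<le> (\<Sum>k\<in>A. (\<delta> * w (1 / 2 ^ k)) * (2 * C0 * 2 ^ k * (norm z) ^ (2 ^ (k - 1))))"
        proof (intro sum_mono mult_mono)
          fix k assume k: "k \<in> A"
          show "norm (poly (pderiv (monom 1 (Suc (n k)) * p)) z) \<le> 2 * C0 * 2 ^ k * (norm z) ^ (2 ^ (k - 1))"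
            by (rule pderiv_monom_mult_le[OF C0(2,3) n(2,3)[OF k] z])
          show "0 \<le> \<delta> * w (1 / 2 ^ k)" using b k by fastforce
        qed (use b in auto)
        also have "\<dots> = 2 * C0 * \<delta> * (\<Sum>k\<in>A. w (1 / 2 ^ k) * 2 ^ k * (1 - t) ^ (2 ^ (k - 1)))"
          by (simp add: sum_distrib_left t_def mult_ac)
        also have "\<dots> \<le> 2 * C0 * \<delta> * (C1 * (w t / t))"
          using C0 \<delta> C1(2)[OF t fin] n(4) by (intro mult_left_mono) auto
        finally have "\<rho> z * norm (deriv (poly P) z) \<le> \<rho> z * (2 * C0 * \<delta> * (C1 * (w t / t)))"
          using \<rho>_pos[OF z] by (intro mult_left_mono) auto
        also have "\<dots> = 2 * C0 * C1 * \<delta>"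
          using t pos_w[of t] by (simp add: \<rho>_def flip: t_def)
        finally show "\<rho> z * norm (deriv (poly P) z) \<le> 2 * C0 * C1 * \<delta>" .
      qed
      moreover have "poly P 0 = 0" by (simp add: P_def poly_sum poly_monom)
      ultimately show "bloch_norm w (poly P) \<le> 2 * C0 * C1 * \<delta>" by simp
    qed
  qed
qed

end

section \<open>Density of the analytic polynomials in the Bloch norm\<close>

lemma holomorphic_disc_poly_approx:
  assumes hol: "g holomorphic_on unit_disc" and r: "0 < r" "r < 1" and e: "e > 0"
  obtains a :: "nat \<Rightarrow> complex" and n where "\<And>z. z \<in> cball 0 r \<Longrightarrow> norm (g z - (\<Sum>i<n. a i * z ^ i)) < e"
proof -
  define a where "a = (\<lambda>n. (deriv ^^ n) g 0 / fact n)"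
  have sums: "(\<lambda>n. a n * z ^ n) sums g z" if "z \<in> unit_disc" for z
    using holomorphic_power_series[OF hol that] by (simp add: a_def)
  define r' where "r' = (1 + r) / 2"
  have r': "r < r'" "r' < 1" using r by (auto simp: r'_def)
  have "summable (\<lambda>n. a n * of_real r' ^ n)"
    using sums[of "of_real r'"] r r' by (auto simp: sums_iff)
  then have "ereal r' \<le> conv_radius a"
    using conv_radius_geI[of a "of_real r'"] r r' by simp
  then have "ereal r < conv_radius a" using r'(1) by (meson ereal_less(2) less_ereal.simps(1) order_less_le_trans)
  then have "uniform_limit (cball 0 r) (\<lambda>n x. \<Sum>i<n. a i * (x - 0) ^ i) (\<lambda>x. \<Sum>i. a i * (x - 0) ^ i) sequentially"
    by (rule powser_uniform_limit)
  then have "\<forall>\<^sub>F n in sequentially. \<forall>x\<in>cball 0 r. dist (\<Sum>i<n. a i * (x - 0) ^ i) (\<Sum>i. a i * (x - 0) ^ i) < e"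
    using e by (rule uniform_limitD)
  then obtain n where n: "\<forall>x\<in>cball 0 r. dist (\<Sum>i<n. a i * (x - 0) ^ i) (\<Sum>i. a i * (x - 0) ^ i) < e"
    by (auto simp: eventually_sequentially)
  show ?thesis
  proof (rule that[of a n])
    fix z :: complex assume z: "z \<in> cball 0 r"
    then have "(\<Sum>i. a i * z ^ i) = g z" using sums[of z] r by (auto simp: sums_iff)
    then show "norm (g z - (\<Sum>i<n. a i * z ^ i)) < e"
      using n[rule_format, OF z] by (simp add: dist_norm norm_minus_commute)
  qed
qed

context majorant_weight
begin

text \<open>The subtracted term is the derivative of the dilation \<open>f (r z)\<close>. Near the
  circle both derivatives are small separately, since the weight at \<open>z\<close> is at most that
  at \<open>r z\<close>; on a compact disc uniform continuity applies.\<close>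

lemma dilation_approx:
  assumes f: "f \<in> little" and e: "e > 0"
  obtains r where "0 < r" "r < 1"
    "\<And>z. z \<in> unit_disc \<Longrightarrow> \<rho> z * norm (deriv f z - of_real r * deriv f (of_real r * z)) \<le> e"
proof -
  have hol: "f holomorphic_on unit_disc" using f by (simp add: little_def)
  obtain R0 where R0: "R0 < 1" "\<And>z. z \<in> unit_disc \<Longrightarrow> R0 < norm z \<Longrightarrow> \<rho> z * norm (deriv f z) < e / 2"
    using f e unfolding little_def by (auto dest: spec[of _ "e / 2"])
  define R where "R = max R0 (1 / 2)"
  have R: "0 < R" "R < 1" "\<And>z. z \<in> unit_disc \<Longrightarrow> R < norm z \<Longrightarrow> \<rho> z * norm (deriv f z) < e / 2"
    using R0 by (auto simp: R_def)
  define R1 where "R1 = (1 + R) / 2"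
  have R1: "R < R1" "R1 < 1" "0 < R1" using R by (auto simp: R1_def)
  have \<rho>0: "\<rho> 0 > 0" by (rule \<rho>_pos) simp
  have cont: "continuous_on (cball 0 R1) (deriv f)"
    using R1 by (intro holomorphic_on_imp_continuous_on holomorphic_on_subset[OF holomorphic_deriv[OF hol]]) auto
  then have "bounded (deriv f ` cball 0 R1)"
    by (intro compact_imp_bounded compact_continuous_image) auto
  then obtain M where M: "M > 0" "\<And>z. z \<in> cball 0 R1 \<Longrightarrow> norm (deriv f z) \<le> M"
    unfolding bounded_pos by auto
  define \<eta> where "\<eta> = e / (2 * \<rho> 0)"
  have \<eta>: "\<eta> > 0" using e \<rho>0 by (simp add: \<eta>_def)
  have "uniformly_continuous_on (cball 0 R1) (deriv f)"
    using cont by (rule compact_uniformly_continuous) simp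
  then obtain \<delta> where \<delta>: "\<delta> > 0" "\<And>x y. x \<in> cball 0 R1 \<Longrightarrow> y \<in> cball 0 R1 \<Longrightarrow> dist y x < \<delta> \<Longrightarrow> dist (deriv f y) (deriv f x) < \<eta>"
    unfolding uniformly_continuous_on_def using \<eta> by metis
  \<comment> \<open>In this order: uniform continuity, positivity of \<open>r\<close>, a harmless
    factor \<open>r\<close> in front of the derivative, and \<open>r z\<close> still beyond
    \<open>R\<close> whenever \<open>z\<close> is beyond \<open>R1\<close>.\<close>
  define h where "h = Min {\<delta> / 2, 1 / 2, \<eta> / M, 1 - R / R1}"
  have h: "h > 0" "h \<le> \<delta> / 2" "h \<le> 1 / 2" "h \<le> \<eta> / M" "h \<le> 1 - R / R1"
  proof -
    show "h > 0" using \<delta> \<eta> M R1 R by (simp add: h_def)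
  qed (unfold h_def, (rule Min_le; simp)+)
  define r where "r = 1 - h"
  have r: "0 < r" "r < 1" using h by (auto simp: r_def)
  have rR: "R \<le> r * R1" using h(5) R1 by (simp add: r_def field_simps)
  show ?thesis
  proof (rule that[OF r])
    fix z assume z: "z \<in> unit_disc"
    have nrz: "norm (of_real r * z) = r * norm z" using r by (simp add: norm_mult)
    have rz: "of_real r * z \<in> unit_disc" "norm (of_real r * z) \<le> norm z"
      using z r nrz by (auto simp: mult_left_le_one_le intro: order_le_less_trans[rotated])
    show "\<rho> z * norm (deriv f z - of_real r * deriv f (of_real r * z)) \<le> e"
    proof (cases "norm z > R1")
      case True
      have "r * R1 < r * norm z" using True r by simp
      then have big: "R < norm (of_real r * z)" using rR nrz by linarith
      have "\<rho> z * norm (deriv f z - of_real r * deriv f (of_real r * z)) \<le>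
          \<rho> z * (norm (deriv f z) + norm (of_real r * deriv f (of_real r * z)))"
        using \<rho>_pos[OF z] by (intro mult_left_mono norm_triangle_ineq4) auto
      also have "norm (of_real r * deriv f (of_real r * z)) \<le> norm (deriv f (of_real r * z))"
        using r by (simp add: norm_mult mult_left_le_one_le)
      also have "\<rho> z * (norm (deriv f z) + norm (deriv f (of_real r * z))) \<le>
          \<rho> z * norm (deriv f z) + \<rho> (of_real r * z) * norm (deriv f (of_real r * z))"
        using \<rho>_mono[OF z rz(2)] by (simp add: distrib_left mult_right_mono)
      also have "\<dots> \<le> e / 2 + e / 2"
        using R(3)[OF z] R(3)[OF rz(1) big] True R1 by simp
      finally show ?thesis using \<rho>_pos[OF z] by simp
    next
      case False
      have zin: "z \<in> cball 0 R1" "of_real r * z \<in> cball 0 R1" using False rz by auto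
      have "z - of_real r * z = of_real h * z" by (simp add: r_def algebra_simps)
      then have "dist z (of_real r * z) = h * norm z" using h by (simp add: dist_norm norm_mult)
      also have "\<dots> \<le> h * 1" using z h by (intro mult_left_mono) auto
      also have "\<dots> < \<delta>" using h \<delta> by linarith
      finally have d: "norm (deriv f z - deriv f (of_real r * z)) < \<eta>"
        using \<delta>(2)[OF zin(2,1)] by (simp add: dist_norm)
      have "norm (of_real h * deriv f (of_real r * z)) \<le> (\<eta> / M) * M"
        unfolding norm_mult using h M zin(2) \<eta> by (intro mult_mono) auto
      then have d': "norm (of_real h * deriv f (of_real r * z)) \<le> \<eta>" using M by simp
      have eq: "deriv f z - of_real r * deriv f (of_real r * z) =
          (deriv f z - deriv f (of_real r * z)) + of_real h * deriv f (of_real r * z)"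
        by (simp add: r_def algebra_simps)
      have "norm (deriv f z - of_real r * deriv f (of_real r * z)) \<le>
          norm (deriv f z - deriv f (of_real r * z)) + norm (of_real h * deriv f (of_real r * z))"
        unfolding eq by (rule norm_triangle_ineq)
      then have "norm (deriv f z - of_real r * deriv f (of_real r * z)) \<le> 2 * \<eta>"
        using d d' by linarith
      then have "\<rho> z * norm (deriv f z - of_real r * deriv f (of_real r * z)) \<le> \<rho> 0 * (2 * \<eta>)"
        using \<rho>_mono[OF z, of 0] \<rho>_pos[OF z] \<rho>0 by (intro mult_mono) auto
      also have "\<dots> = e" using \<rho>0 by (simp add: \<eta>_def)
      finally show ?thesis .
    qed
  qed
qed

text \<open>Dilation comes first, because Taylor sums converge uniformly only on smaller discs. The
  approximation is made for the derivative and then integrated.\<close>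

lemma little_poly_dense:
  assumes f: "f \<in> little" and e: "e > 0"
  obtains Q where "bloch_norm w (\<lambda>z. f z - poly Q z) < e"
proof -
  have hol: "f holomorphic_on unit_disc" using f by (simp add: little_def)
  have \<rho>0: "\<rho> 0 > 0" by (rule \<rho>_pos) simp
  obtain r where r: "0 < r" "r < 1"
    "\<And>z. z \<in> unit_disc \<Longrightarrow> \<rho> z * norm (deriv f z - of_real r * deriv f (of_real r * z)) \<le> e / 4"
    using dilation_approx[OF f, of "e / 4"] e by auto
  have "deriv f holomorphic_on unit_disc" by (intro holomorphic_deriv hol) simp
  then obtain a :: "nat \<Rightarrow> complex" and n where an: "\<And>z. z \<in> cball 0 r \<Longrightarrow> norm (deriv f z - (\<Sum>i<n. a i * z ^ i)) < e / (4 * \<rho> 0)"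
    using holomorphic_disc_poly_approx[of "deriv f" r "e / (4 * \<rho> 0)"] r e \<rho>0 by auto
  \<comment> \<open>Antiderivative of \<open>r\<close> times the Taylor sum at \<open>r z\<close>,
    computed coefficient by coefficient. The constant term makes the value at 0 exact.\<close>
  define Q where "Q = [:f 0:] + (\<Sum>i<n. monom (a i * of_real r ^ Suc i / of_nat (Suc i)) (Suc i))"
  have Q': "poly (pderiv Q) z = of_real r * (\<Sum>i<n. a i * (of_real r * z) ^ i)" for z
  proof -
    have "poly (pderiv Q) z = (\<Sum>i<n. of_nat (Suc i) * (a i * of_real r ^ Suc i / of_nat (Suc i)) * z ^ i)"
      by (simp add: Q_def pderiv_add pderiv_pCons pderiv_sum poly_sum pderiv_monom poly_monom del: of_nat_Suc)
    also have "\<dots> = (\<Sum>i<n. of_real r * (a i * (of_real r * z) ^ i))"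
      by (intro sum.cong refl) (simp add: power_mult_distrib del: of_nat_Suc)
    finally show ?thesis by (simp add: sum_distrib_left)
  qed
  have "bloch_norm w (\<lambda>z. f z - poly Q z) \<le> norm (f 0 - poly Q 0) + e / 2"
  proof (rule bloch_norm_leI)
    fix z assume z: "z \<in> unit_disc"
    have rz: "of_real r * z \<in> cball 0 r"
      using z r by (simp add: norm_mult mult_left_le)
    have "deriv (\<lambda>z. f z - poly Q z) z = deriv f z - poly (pderiv Q) z"
      using deriv_add_disc[OF hol, of "poly Q" z 1 "-1"] z by (simp add: holomorphic_intros)
    also have "\<dots> = (deriv f z - of_real r * deriv f (of_real r * z)) +
        of_real r * (deriv f (of_real r * z) - (\<Sum>i<n. a i * (of_real r * z) ^ i))"
      by (simp add: Q' algebra_simps)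
    also have "norm \<dots> \<le> norm (deriv f z - of_real r * deriv f (of_real r * z)) + 1 * (e / (4 * \<rho> 0))"
    proof (rule order_trans[OF norm_triangle_ineq], rule add_left_mono)
      show "norm (of_real r * (deriv f (of_real r * z) - (\<Sum>i<n. a i * (of_real r * z) ^ i))) \<le> 1 * (e / (4 * \<rho> 0))"
        unfolding norm_mult using an[OF rz] r by (intro mult_mono) auto
    qed
    finally have "\<rho> z * norm (deriv (\<lambda>z. f z - poly Q z) z) \<le>
        \<rho> z * (norm (deriv f z - of_real r * deriv f (of_real r * z)) + 1 * (e / (4 * \<rho> 0)))"
      using \<rho>_pos[OF z] by (intro mult_left_mono) auto
    also have "\<dots> = \<rho> z * norm (deriv f z - of_real r * deriv f (of_real r * z)) + \<rho> z * (e / (4 * \<rho> 0))"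
      by (simp add: algebra_simps)
    also have "\<rho> z * (e / (4 * \<rho> 0)) \<le> \<rho> 0 * (e / (4 * \<rho> 0))"
      using \<rho>_mono[OF z, of 0] e \<rho>0 by (intro mult_right_mono) auto
    also have "\<rho> 0 * (e / (4 * \<rho> 0)) = e / 4" using \<rho>0 by simp
    finally show "\<rho> z * norm (deriv (\<lambda>z. f z - poly Q z) z) \<le> e / 2" using r(3)[OF z] by simp
  qed
  moreover have "poly Q 0 = f 0" by (simp add: Q_def poly_sum poly_monom)
  ultimately have "bloch_norm w (\<lambda>z. f z - poly Q z) < e" using e by simp
  then show ?thesis by (rule that)
qed

section \<open>Divergence of the dyadic sum and iteration of the energy step\<close>

lemma dyadic_diverges:
  assumes "(\<integral>\<^sup>+t\<in>{0<..1}. ennreal ((w t)^2 / t) \<partial>lborel) = \<infinity>"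
  shows "\<not> summable (\<lambda>k. (w (1 / 2 ^ k))^2)"
proof
  assume sum: "summable (\<lambda>k. (w (1 / 2 ^ k))^2)"
  \<comment> \<open>On \<open>I k\<close> the majorant is at most its value at the right end and
    \<open>1 / t\<close> is at most \<open>2 ^ Suc k\<close>, a factor that the length of the
    interval cancels.\<close>
  define I where "I = (\<lambda>k::nat. {1 / 2 ^ Suc k<..1 / 2 ^ k :: real})"
  have "(\<integral>\<^sup>+t\<in>{0<..1}. ennreal ((w t)^2 / t) \<partial>lborel) \<le>
      (\<integral>\<^sup>+t. (\<Sum>k. ennreal (2 ^ Suc k * (w (1 / 2 ^ k))^2) * indicator (I k) t) \<partial>lborel)"
  proof (intro nn_integral_mono)
    fix t :: real
    show "ennreal ((w t)^2 / t) * indicator {0<..1} t \<le> (\<Sum>k. ennreal (2 ^ Suc k * (w (1 / 2 ^ k))^2) * indicator (I k) t)"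
    proof (cases "t \<in> {0<..1}")
      case True
      have "\<exists>k::nat. 1 < 2 ^ k * t"
      proof -
        obtain k :: nat where "1 / t < 2 ^ k" using real_arch_pow[of 2 "1 / t"] by auto
        then show ?thesis using True by (intro exI[of _ k]) (simp add: field_simps)
      qed
      then obtain K :: nat where K: "1 < 2 ^ K * t" "\<And>k. k < K \<Longrightarrow> 2 ^ k * t \<le> 1"
        using exists_least_iff[of "\<lambda>k::nat. 1 < 2 ^ k * t"] by (metis not_le)
      have "K \<noteq> 0" using K(1) True by (metis greaterThanAtMost_iff mult_1 not_le power_0)
      then obtain k where k: "K = Suc k" using not0_implies_Suc by blast
      have le: "t \<le> 1 / 2 ^ k" "1 / 2 ^ Suc k < t" using K(1) K(2)[of k] k by (simp_all add: field_simps)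
      then have tI: "t \<in> I k" by (simp add: I_def)
      have "(w t)^2 \<le> (w (1 / 2 ^ k))^2"
        using w_mono[of t "1 / 2 ^ k"] True le pos_w[of t] by (intro power_mono) auto
      moreover have "1 / t \<le> 2 ^ Suc k" using le True by (simp add: field_simps)
      ultimately have "(w t)^2 * (1 / t) \<le> (w (1 / 2 ^ k))^2 * 2 ^ Suc k"
        using True by (intro mult_mono) auto
      then have "ennreal ((w t)^2 / t) * indicator {0<..1} t \<le> ennreal (2 ^ Suc k * (w (1 / 2 ^ k))^2) * indicator (I k) t"
        using True tI by (simp add: ennreal_leI mult.commute)
      also have "\<dots> \<le> (\<Sum>k. ennreal (2 ^ Suc k * (w (1 / 2 ^ k))^2) * indicator (I k) t)"
      proof -
        have "F k \<le> (\<Sum>k. F k)" for F :: "nat \<Rightarrow> ennreal"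
          using sum_le_suminf[of F "{k}"] by (simp add: summableI)
        then show ?thesis .
      qed
      finally show ?thesis .
    qed simp
  qed
  also have "\<dots> = (\<Sum>k. \<integral>\<^sup>+t. ennreal (2 ^ Suc k * (w (1 / 2 ^ k))^2) * indicator (I k) t \<partial>lborel)"
    by (rule nn_integral_suminf) (simp add: I_def)
  also have "\<dots> = (\<Sum>k. ennreal ((w (1 / 2 ^ k))^2))"
  proof (intro suminf_cong)
    fix k :: nat
    have "(\<integral>\<^sup>+t. ennreal (2 ^ Suc k * (w (1 / 2 ^ k))^2) * indicator (I k) t \<partial>lborel) =
        ennreal (2 ^ Suc k * (w (1 / 2 ^ k))^2) * ennreal (1 / 2 ^ k - 1 / 2 ^ Suc k)"
    proof -
      have "emeasure lborel (I k) = ennreal (1 / 2 ^ k - 1 / 2 ^ Suc k)"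
        unfolding I_def by (rule emeasure_lborel_Ioc) (simp add: field_simps)
      moreover have "I k \<in> sets lborel" by (simp add: I_def)
      ultimately show ?thesis by (simp only: nn_integral_cmult_indicator)
    qed
    also have "\<dots> = ennreal (2 ^ Suc k * (w (1 / 2 ^ k))^2 * (1 / 2 ^ k - 1 / 2 ^ Suc k))"
      by (rule ennreal_mult[symmetric]) (auto simp: field_simps)
    also have "2 ^ Suc k * (w (1 / 2 ^ k))^2 * (1 / 2 ^ k - 1 / 2 ^ Suc k) = (w (1 / 2 ^ k))^2"
      by (simp add: field_simps)
    finally show "(\<integral>\<^sup>+t. ennreal (2 ^ Suc k * (w (1 / 2 ^ k))^2) * indicator (I k) t \<partial>lborel) = ennreal ((w (1 / 2 ^ k))^2)" .
  qed
  also have "\<dots> = ennreal (\<Sum>k. (w (1 / 2 ^ k))^2)"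
    using sum by (intro suminf_ennreal2) auto
  also have "\<dots> < \<infinity>" by simp
  finally show False using assms by simp
qed

lemma lacunary_block:
  assumes div: "\<not> summable (\<lambda>k. (w (1 / 2 ^ k))^2)" and \<delta>: "\<delta> > 0" and s: "s > 0"
  obtains A b where "finite A" "\<forall>k\<in>A. k > k0" "\<forall>k. b k \<ge> 0" "(\<Sum>k\<in>A. (b k)^2) = s^2"
    "\<forall>k\<in>A. 0 \<le> b k \<and> b k \<le> \<delta> * w (1 / 2 ^ k)"
proof -
  define f where "f = (\<lambda>k. (\<delta> * w (1 / 2 ^ k))^2)"
  have wpos: "w (1 / 2 ^ k) > 0" for k by (rule pos_w) auto
  have "\<not> summable f"
  proof
    assume "summable f"
    then have "summable (\<lambda>k. inverse (\<delta>^2) * f k)" by (rule summable_mult)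
    then show False using div \<delta> by (simp add: f_def power_mult_distrib field_simps)
  qed
  then have "\<not> summable (\<lambda>i. f (i + Suc k0))" by (simp only: summable_iff_shift not_False_eq_True)
  moreover have "summable (\<lambda>i. f (i + Suc k0))" if "\<And>n. (\<Sum>i<n. f (i + Suc k0)) \<le> s^2"
    using that by (rule summableI_nonneg_bounded[rotated]) (simp add: f_def)
  ultimately obtain n where n: "s^2 < (\<Sum>i<n. f (i + Suc k0))"
    by (meson not_le)
  define A where "A = (\<lambda>i. i + Suc k0) ` {..<n}"
  define S where "S = sum f A"
  have "S = (\<Sum>i<n. f (i + Suc k0))"
    unfolding S_def A_def by (subst sum.reindex) (auto simp: inj_on_def)
  then have S: "s^2 < S" using n by simp
  have S0: "S > 0" using S zero_le_power2[of s] by linarith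
  define q where "q = s / sqrt S"
  have q: "0 \<le> q" "q \<le> 1"
  proof -
    show "0 \<le> q" using s S0 by (simp add: q_def)
    have "s \<le> sqrt S" using S by (intro real_le_rsqrt) auto
    then show "q \<le> 1" using S0 by (simp add: q_def)
  qed
  show ?thesis
  proof (rule that[of A "\<lambda>k. q * (\<delta> * w (1 / 2 ^ k))"])
    show "(\<Sum>k\<in>A. (q * (\<delta> * w (1 / 2 ^ k)))^2) = s^2"
    proof -
      have "(\<Sum>k\<in>A. (q * (\<delta> * w (1 / 2 ^ k)))^2) = q^2 * S"
        by (simp add: S_def f_def power_mult_distrib sum_distrib_left)
      then show ?thesis using S0 by (simp add: q_def power_divide)
    qed
    show "\<forall>k\<in>A. 0 \<le> q * (\<delta> * w (1 / 2 ^ k)) \<and> q * (\<delta> * w (1 / 2 ^ k)) \<le> \<delta> * w (1 / 2 ^ k)"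
      using q \<delta> wpos by (auto simp: less_imp_le intro!: mult_left_le_one_le)
  qed (use q \<delta> wpos in \<open>auto simp: A_def less_imp_le\<close>)
qed

text \<open>The Bloch norm is that of \<open>P\<close>, not of \<open>z ^ m * P\<close>: later
  \<open>P\<close> has to imitate \<open>z^(-m)\<close> on a large set, so the factor is taken out
  at every step.\<close>

lemma energy_iterate:
  fixes L :: complex and m :: nat
  assumes div: "\<not> summable (\<lambda>k. (w (1 / 2 ^ k))^2)"
    and a: "0 < a" "a \<le> 1" and e: "e > 0" and K: "K > 0" and \<delta>: "\<delta> > 0"
  obtains P where "bloch_norm w (poly P) \<le> \<delta>"
    "measure \<mu> {z \<in> sphere 0 1. (norm (L + z ^ m * poly P z))^2 \<in> {2 / a..K}} < e"
    "(1 + (norm L)^2) powr (- a) \<le> (LINT z|\<mu>. (1 + (norm (L + z ^ m * poly P z))^2) powr (- a))"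
proof -
  define G where "G = (\<lambda>P. LINT z|\<mu>. (1 + (norm (L + z ^ m * poly P z))^2) powr (- a))"
  define bad where "bad = (\<lambda>P. measure \<mu> {z \<in> sphere 0 1. (norm (L + z ^ m * poly P z))^2 \<in> {2 / a..K}})"
  have nz: "1 + (norm x)^2 \<noteq> 0" for x :: complex by (metis add_nonneg_eq_0_iff zero_le_one zero_le_power2 zero_neq_one)
  have G1: "G P \<le> 1" for P
  proof -
    have "G P \<le> (LINT z|\<mu>. 1)" unfolding G_def
    proof (intro integral_circle_mono continuous_intros)
      show "\<forall>z\<in>sphere 0 1. 1 + (norm (L + z ^ m * poly P z))^2 \<noteq> 0" using nz by blast
      fix z :: complex
      have "(1 + (norm (L + z ^ m * poly P z))^2) powr (- a) \<le> (1 + (norm (L + z ^ m * poly P z))^2) powr 0"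
        using a by (intro powr_mono) auto
      then show "(1 + (norm (L + z ^ m * poly P z))^2) powr (- a) \<le> 1" using nz by simp
    qed
    then show ?thesis by simp
  qed
  obtain \<kappa> s where \<kappa>: "\<kappa> > 0" "s > 0" and gain:
    "\<And>Z. continuous_on (sphere 0 1) Z \<Longrightarrow>
       e \<le> measure \<mu> {z \<in> sphere 0 1. (norm (Z z))^2 \<in> {2 / a..K}} \<Longrightarrow>
       \<exists>T d. trig_poly T \<and> (\<forall>A b. finite A \<longrightarrow> (\<forall>k\<in>A. k > d) \<longrightarrow> (\<forall>k. b k \<ge> 0) \<longrightarrow> (\<Sum>k\<in>A. (b k)^2) = s^2 \<longrightarrow>
         (LINT z|\<mu>. (1 + (norm (Z z))^2) powr (- a)) + \<kappa> \<le>
         (LINT z|\<mu>. (1 + (norm (Z z + T z * lacunary b A z))^2) powr (- a)))"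
    by (rule energy_gain[OF a e K]) blast
  \<comment> \<open>The gain \<open>\<kappa>\<close> is the same for every budget
    \<open>\<delta>\<close>: a smaller budget changes the block, but not its sum of squares.\<close>
  have step: "\<exists>P'. bloch_norm w (poly P') \<le> \<delta> \<and> G P + \<kappa> \<le> G (P + P')" if big: "e \<le> bad P" and \<delta>: "\<delta> > 0" for P \<delta>
  proof -
    have cont: "continuous_on (sphere 0 1) (\<lambda>z. L + z ^ m * poly P z)" by (intro continuous_intros)
    obtain T d where T: "trig_poly T" and Td: "\<forall>A b. finite A \<longrightarrow> (\<forall>k\<in>A. k > d) \<longrightarrow> (\<forall>k. b k \<ge> 0) \<longrightarrow> (\<Sum>k\<in>A. (b k)^2) = s^2 \<longrightarrow>
         G P + \<kappa> \<le> (LINT z|\<mu>. (1 + (norm (L + z ^ m * poly P z + T z * lacunary b A z))^2) powr (- a))"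
      using gain[OF cont] big unfolding G_def bad_def by blast
    obtain C k0 where C: "C > 0" and lac: "\<And>A b \<delta>. finite A \<Longrightarrow> \<forall>k\<in>A. k > k0 \<Longrightarrow> \<delta> \<ge> 0 \<Longrightarrow>
      \<forall>k\<in>A. 0 \<le> b k \<and> b k \<le> \<delta> * w (1 / 2 ^ k) \<Longrightarrow>
      \<exists>P. (\<forall>z\<in>sphere 0 1. z ^ m * poly P z = T z * lacunary b A z) \<and> bloch_norm w (poly P) \<le> C * \<delta>"
      by (rule lacunary_poly[OF T, of m]) blast
    have \<delta>C: "\<delta> / C > 0" using \<delta> C by simp
    obtain A b where A: "finite A" "\<forall>k\<in>A. k > max d k0" "\<forall>k. b k \<ge> 0" "(\<Sum>k\<in>A. (b k)^2) = s^2"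
      "\<forall>k\<in>A. 0 \<le> b k \<and> b k \<le> (\<delta> / C) * w (1 / 2 ^ k)"
      using lacunary_block[OF div \<delta>C \<kappa>(2)] by metis
    have "\<exists>P. (\<forall>z\<in>sphere 0 1. z ^ m * poly P z = T z * lacunary b A z) \<and> bloch_norm w (poly P) \<le> C * (\<delta> / C)"
      using A \<delta>C by (intro lac) auto
    then obtain P' where P': "\<forall>z\<in>sphere 0 1. z ^ m * poly P' z = T z * lacunary b A z" "bloch_norm w (poly P') \<le> \<delta>"
      using C by auto
    have "(LINT z|\<mu>. (1 + (norm (L + z ^ m * poly P z + T z * lacunary b A z))^2) powr (- a)) = G (P + P')"
      unfolding G_def using P'(1) by (intro Bochner_Integration.integral_cong refl) (simp add: algebra_simps)
    moreover have "G P + \<kappa> \<le> (LINT z|\<mu>. (1 + (norm (L + z ^ m * poly P z + T z * lacunary b A z))^2) powr (- a))"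
      using A by (intro Td[rule_format]) auto
    ultimately show ?thesis using P'(2) by auto
  qed
  \<comment> \<open>Either the bad set is already small or \<open>n\<close> gains have been
    collected. \<open>\<delta>\<close> is arbitrary in the induction so that the last step and all
    earlier ones may use half of the budget each.\<close>
  have "\<exists>P. bloch_norm w (poly P) \<le> \<delta> \<and> G 0 \<le> G P \<and> (bad P < e \<or> G 0 + real n * \<kappa> \<le> G P)" if "\<delta> > 0" for n \<delta>
    using that
  proof (induction n arbitrary: \<delta>)
    case 0
    have "bloch_norm w (poly 0) \<le> norm (poly 0 (0::complex)) + 0"
      by (rule bloch_norm_leI) simp
    then have "bloch_norm w (poly 0) \<le> 0" by simp
    then have "bloch_norm w (poly 0) \<le> \<delta>" using 0 by linarith
    show ?case by (intro exI[of _ 0] conjI) (fact, simp_all)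
  next
    case (Suc n)
    then obtain P where P: "bloch_norm w (poly P) \<le> \<delta> / 2" "G 0 \<le> G P" "bad P < e \<or> G 0 + real n * \<kappa> \<le> G P"
      by (meson half_gt_zero)
    show ?case
    proof (cases "bad P < e")
      case True
      then show ?thesis using P Suc.prems by (intro exI[of _ P]) auto
    next
      case False
      then obtain P' where P': "bloch_norm w (poly P') \<le> \<delta> / 2" "G P + \<kappa> \<le> G (P + P')"
        using step[of P "\<delta> / 2"] Suc.prems by auto
      have "bloch_norm w (poly (P + P')) \<le> \<delta>"
        using bloch_norm_poly_add[of P P'] P(1) P'(1) by simp
      moreover have "G 0 + real (Suc n) * \<kappa> \<le> G (P + P')"
      proof -
        have "real (Suc n) * \<kappa> = real n * \<kappa> + \<kappa>" by (simp add: algebra_simps)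
        then show ?thesis using P(3) P'(2) False by linarith
      qed
      moreover have "G 0 \<le> G (P + P')" using P(2) P'(2) \<kappa>(1) by linarith
      ultimately show ?thesis by blast
    qed
  qed
  moreover obtain n where n: "1 < real n * \<kappa>" using reals_Archimedean3[OF \<kappa>(1)] by blast
  ultimately obtain P where P: "bloch_norm w (poly P) \<le> \<delta>" "G 0 \<le> G P" "bad P < e \<or> G 0 + real n * \<kappa> \<le> G P"
    using \<delta> by blast
  have "G 0 = (LINT z|\<mu>. (1 + (norm L)^2) powr (- a))" by (simp add: G_def)
  then have G0: "G 0 = (1 + (norm L)^2) powr (- a)" by simp
  have "G 0 \<ge> 0" unfolding G0 by simp
  then have "bad P < e" using P(3) n G1[of P] by linarith
  then show ?thesis using that[OF P(1)] P(2) unfolding G0 unfolding G_def bad_def by blast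
qed

end

section \<open>Polynomials close to one on a large set\<close>

text \<open>The limit rests on \<open>a log (1 + c / a)\<close> tending to 0. It is applied to the
  initial value of the mean, where \<open>c / a\<close> is the squared starting point.\<close>

lemma powr_parameter_limit:
  fixes c :: real
  assumes "c > 0"
  shows "((\<lambda>a. (1 + c / a) powr (- a)) \<longlongrightarrow> 1) (at_right 0)"
  using assms by real_asymp

text \<open>A union bound: 1/4 + 1/8 + ... = 1/2, so at least half of the circle remains.\<close>

lemma closed_circle_complement_measure:
  assumes "\<And>i. B i \<in> sets \<mu>" "\<And>i. measure \<mu> (B i) \<le> (1 / 2) ^ (i + 2)"
  shows "sphere 0 1 - (\<Union>i. B i) \<in> sets \<mu>"
    and "measure \<mu> (sphere 0 1 - (\<Union>i. B i)) > 0"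
proof -
  have U: "(\<Union>i. B i) \<in> sets \<mu>" using assms(1) by auto
  show "sphere 0 1 - (\<Union>i. B i) \<in> sets \<mu>"
    using sets.compl_sets[OF U] by simp
  have geo: "(\<lambda>i. (1 / 2 :: real) ^ (i + 2)) sums (1 / 2)"
    using sums_mult[OF geometric_sums[of "1 / 2 :: real"], of "1 / 4"] by (simp add: power_add)
  have sm: "summable (\<lambda>i. measure \<mu> (B i))"
    using assms(2) by (intro summable_comparison_test'[OF sums_summable[OF geo], of 0]) auto
  have "measure \<mu> (\<Union>i. B i) \<le> (\<Sum>i. measure \<mu> (B i))"
    using assms(1) by (intro circle.finite_measure_subadditive_countably sm) auto
  also have "\<dots> \<le> (\<Sum>i. (1 / 2) ^ (i + 2))"
    by (intro suminf_le assms(2) sm sums_summable[OF geo])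
  also have "\<dots> = 1 / 2" using geo by (simp add: sums_iff)
  finally have "measure \<mu> (\<Union>i. B i) \<le> 1 / 2" .
  moreover have "measure \<mu> (sphere 0 1 - (\<Union>i. B i)) = 1 - measure \<mu> (\<Union>i. B i)"
    using circle.prob_compl[OF U] by simp
  ultimately show "measure \<mu> (sphere 0 1 - (\<Union>i. B i)) > 0" by simp
qed

context majorant_weight
begin

text \<open>With \<open>u\<close> the squared modulus of the final position, two kinds of points
  fail: those stuck between \<open>2 / a\<close> and \<open>K\<close>, few by the iteration, and
  those beyond \<open>K\<close>, few by Chebyshev's inequality, because the mean is still close to
  its upper bound 1.\<close>

lemma poly_close_to_one:
  assumes div: "\<not> summable (\<lambda>k. (w (1 / 2 ^ k))^2)" and e: "0 < e" "e \<le> 1"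
  obtains P where "bloch_norm w (poly P) < e"
    "measure \<mu> {z \<in> sphere 0 1. norm (z ^ m * poly P z - 1) \<in> {e..}} \<le> e"
proof -
  \<comment> \<open>The deficit \<open>e / 8\<close> becomes the measure \<open>e / 4\<close> in
    Chebyshev's inequality at level 1/2.\<close>
  have "\<forall>\<^sub>F a in at_right 0. 1 - e / 8 < (1 + (2 / e^2) / a) powr (- a)"
    by (rule order_tendstoD(1)[OF powr_parameter_limit]) (use e in auto)
  moreover have "\<forall>\<^sub>F a in at_right (0::real). a < 1" by (rule eventually_at_rightI[of 0 1]) auto
  moreover have "\<forall>\<^sub>F a in at_right (0::real). a > 0" by (rule eventually_at_right_less)
  ultimately have "\<forall>\<^sub>F a in at_right 0. 0 < a \<and> a < 1 \<and> 1 - e / 8 < (1 + (2 / e^2) / a) powr (- a)"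
    by eventually_elim auto
  then obtain a where a: "0 < a" "a < 1" "1 - e / 8 < (1 + (2 / e^2) / a) powr (- a)"
    using eventually_happens[of _ "at_right (0::real)"] trivial_limit_at_right_real by blast
  define L where "L = sqrt (2 / a) / e"
  have L: "L \<ge> 1" "L^2 = (2 / e^2) / a"
  proof -
    have "1 \<le> sqrt (2 / a)" using a by simp
    then have "e \<le> sqrt (2 / a)" using e by linarith
    then show "L \<ge> 1" unfolding L_def using e by (subst le_divide_eq_1_pos)
    show "L^2 = (2 / e^2) / a" using a by (simp add: L_def power_divide)
  qed
  \<comment> \<open>The squared modulus at which the function has dropped to exactly 1/2.\<close>
  define K where "K = 2 powr (1 / a) - 1"
  have K: "K > 0" "(1 + K) powr (- a) = 1 / 2"
  proof -
    have "2 powr (1 / a) > (2::real) powr 0" using a by (intro powr_less_mono) auto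
    then show "K > 0" by (simp add: K_def)
    show "(1 + K) powr (- a) = 1 / 2" using a by (simp add: K_def powr_powr powr_minus_divide)
  qed
  obtain P where P: "bloch_norm w (poly P) \<le> e / 2"
    "measure \<mu> {z \<in> sphere 0 1. (norm (of_real L + z ^ m * poly P z))^2 \<in> {2 / a..K}} < e / 2"
    "(1 + (norm (complex_of_real L))^2) powr (- a) \<le> (LINT z|\<mu>. (1 + (norm (of_real L + z ^ m * poly P z))^2) powr (- a))"
    using energy_iterate[OF div a(1) less_imp_le[OF a(2)], of "e / 2" K "e / 2" "of_real L" m] e K by auto
  define u where "u = (\<lambda>z. (norm (of_real L + z ^ m * poly P z))^2)"
  have contu: "continuous_on (sphere 0 1) u" unfolding u_def by (intro continuous_intros)
  have u0: "u z \<ge> 0" for z by (simp add: u_def)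
  have contG: "continuous_on (sphere 0 1) (\<lambda>z. (1 + u z) powr (- a))"
    using u0 by (intro continuous_intros contu) (metis add_nonneg_eq_0_iff zero_le_one zero_neq_one)
  have G_le: "(1 + u z) powr (- a) \<le> 1" for z
  proof -
    have "(1 + u z) powr (- a) \<le> (1 + u z) powr 0" using a u0[of z] by (intro powr_mono) auto
    then show ?thesis using u0[of z] by simp
  qed
  have sets: "{z \<in> sphere 0 1. u z \<in> C} \<in> sets \<mu>" if "closed C" for C
    by (rule sets_circle_closed_vimage[OF contu that])
  have "1 - e / 8 \<le> (LINT z|\<mu>. (1 + u z) powr (- a))"
    using P(3) a(3) L unfolding u_def by simp
  moreover have "(1 / 2) * measure \<mu> {z \<in> sphere 0 1. u z \<in> {K..}} \<le>
      (LINT z|\<mu>. 1 - (1 + u z) powr (- a))"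
  proof (rule integral_indicator_le)
    show "continuous_on (sphere 0 1) (\<lambda>z. 1 - (1 + u z) powr (- a))" by (intro continuous_intros contG)
    show "{z \<in> sphere 0 1. u z \<in> {K..}} \<in> sets \<mu>" by (rule sets) simp
    show "0 \<le> 1 - (1 + u z) powr (- a)" for z using G_le[of z] by simp
    fix z assume "z \<in> {z \<in> sphere 0 1. u z \<in> {K..}}"
    then have "(1 + u z) powr (- a) \<le> (1 + K) powr (- a)" using K a by (intro powr_mono2') auto
    then show "1 / 2 \<le> 1 - (1 + u z) powr (- a)" using K(2) by simp
  qed
  moreover have "(LINT z|\<mu>. 1 - (1 + u z) powr (- a)) = 1 - (LINT z|\<mu>. (1 + u z) powr (- a))"
    by (subst Bochner_Integration.integral_diff) (auto intro: continuous_on_circle_integrable contG)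
  ultimately have mK: "measure \<mu> {z \<in> sphere 0 1. u z \<in> {K..}} \<le> e / 4" by simp
  define Q where "Q = smult (- 1 / of_real L) P"
  have "{z \<in> sphere 0 1. norm (z ^ m * poly Q z - 1) \<in> {e..}} \<subseteq>
      {z \<in> sphere 0 1. u z \<in> {2 / a..K}} \<union> {z \<in> sphere 0 1. u z \<in> {K..}}"
  proof
    fix z assume z: "z \<in> {z \<in> sphere 0 1. norm (z ^ m * poly Q z - 1) \<in> {e..}}"
    have "of_real L + z ^ m * poly P z = - of_real L * (z ^ m * poly Q z - 1)"
      using L(1) by (simp add: Q_def field_simps)
    then have "u z = L^2 * (norm (z ^ m * poly Q z - 1))^2"
      by (simp add: u_def norm_mult power_mult_distrib)
    also have "\<dots> \<ge> L^2 * e^2" using z e by (intro mult_left_mono power_mono) auto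
    finally have "2 / a \<le> u z" using L(2) e by simp
    then show "z \<in> {z \<in> sphere 0 1. u z \<in> {2 / a..K}} \<union> {z \<in> sphere 0 1. u z \<in> {K..}}" using z by auto
  qed
  then have "measure \<mu> {z \<in> sphere 0 1. norm (z ^ m * poly Q z - 1) \<in> {e..}} \<le>
      measure \<mu> ({z \<in> sphere 0 1. u z \<in> {2 / a..K}} \<union> {z \<in> sphere 0 1. u z \<in> {K..}})"
    by (intro circle.finite_measure_mono sets.Un sets) auto
  also have "\<dots> \<le> measure \<mu> {z \<in> sphere 0 1. u z \<in> {2 / a..K}} + measure \<mu> {z \<in> sphere 0 1. u z \<in> {K..}}"
    by (intro measure_Un_le sets) auto
  also have "\<dots> \<le> e" using P(2) mK e unfolding u_def by simp
  finally have "measure \<mu> {z \<in> sphere 0 1. norm (z ^ m * poly Q z - 1) \<in> {e..}} \<le> e" .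
  moreover have "bloch_norm w (poly Q) < e"
  proof -
    have "bloch_norm w (poly Q) \<le> norm (- 1 / complex_of_real L) * bloch_norm w (poly P)"
      unfolding Q_def by (rule bloch_norm_poly_smult)
    also have "\<dots> \<le> 1 * (e / 2)"
      using L P(1) bloch_norm_nonneg[OF poly_fin_norm, of P] by (intro mult_mono) (auto simp: norm_divide)
    finally show ?thesis using e by simp
  qed
  ultimately show ?thesis using that by blast
qed

text \<open>The factor \<open>z^d\<close> makes \<open>P\<close> close to \<open>z^(-d)\<close> on \<open>E\<close>, which provides the negative frequencies of
  trigonometric polynomials.\<close>

lemma approximation_set:
  assumes div: "\<not> summable (\<lambda>k. (w (1 / 2 ^ k))^2)"
  obtains E where "E \<in> sets \<mu>" "measure \<mu> E > 0"
    "\<And>d e. e > 0 \<Longrightarrow> \<exists>P. bloch_norm w (poly P) < e \<and> (\<forall>z\<in>E. norm (z ^ d * poly P z - 1) < e)"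
proof -
  define \<epsilon> where "\<epsilon> = (\<lambda>i::nat. (1 / 2 :: real) ^ (i + 2))"
  have \<epsilon>: "0 < \<epsilon> i" "\<epsilon> i \<le> 1" for i
    unfolding \<epsilon>_def by (simp, rule power_le_one) auto
  have "\<forall>i. \<exists>P. bloch_norm w (poly P) < \<epsilon> i \<and>
      measure \<mu> {z \<in> sphere 0 1. norm (z ^ fst (prod_decode i) * poly P z - 1) \<in> {\<epsilon> i..}} \<le> \<epsilon> i"
  proof
    fix i
    show "\<exists>P. bloch_norm w (poly P) < \<epsilon> i \<and>
        measure \<mu> {z \<in> sphere 0 1. norm (z ^ fst (prod_decode i) * poly P z - 1) \<in> {\<epsilon> i..}} \<le> \<epsilon> i"
      by (rule poly_close_to_one[OF div \<epsilon>, of i "fst (prod_decode i)"]) blast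
  qed
  from choice[OF this] obtain P where "\<forall>i. bloch_norm w (poly (P i)) < \<epsilon> i \<and>
      measure \<mu> {z \<in> sphere 0 1. norm (z ^ fst (prod_decode i) * poly (P i) z - 1) \<in> {\<epsilon> i..}} \<le> \<epsilon> i" ..
  then have P: "bloch_norm w (poly (P i)) < \<epsilon> i"
    "measure \<mu> {z \<in> sphere 0 1. norm (z ^ fst (prod_decode i) * poly (P i) z - 1) \<in> {\<epsilon> i..}} \<le> \<epsilon> i" for i
    by blast+
  define B where "B = (\<lambda>i. {z \<in> sphere 0 1. norm (z ^ fst (prod_decode i) * poly (P i) z - 1) \<in> {\<epsilon> i..}})"
  have B: "B i \<in> sets \<mu>" for i
    unfolding B_def by (intro sets_circle_closed_vimage continuous_intros)
  have mB: "measure \<mu> (B i) \<le> (1 / 2) ^ (i + 2)" for i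
    using P(2)[of i] by (simp add: B_def \<epsilon>_def)
  define E where "E = sphere 0 1 - (\<Union>i. B i)"
  have E: "E \<in> sets \<mu>" "measure \<mu> E > 0"
    unfolding E_def using closed_circle_complement_measure[OF B mB] by auto
  show ?thesis
  proof (rule that[OF E])
    fix d :: nat and e :: real assume e: "e > 0"
    obtain j where j: "(1 / 2 :: real) ^ j < e" using real_arch_pow_inv[OF e, of "1 / 2"] by auto
    \<comment> \<open>The pairing function meets each shift \<open>d\<close> infinitely often; as
      \<open>j \<le> i\<close>, the index \<open>i\<close> is also late enough for the precision
      wanted.\<close>
    define i where "i = prod_encode (d, j)"
    have "\<epsilon> i \<le> (1 / 2) ^ j"
      unfolding \<epsilon>_def using le_prod_encode_2[of j d] by (intro power_decreasing) (auto simp: i_def)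
    then have ie: "\<epsilon> i < e" using j by simp
    have dec: "fst (prod_decode i) = d" by (simp add: i_def)
    show "\<exists>P. bloch_norm w (poly P) < e \<and> (\<forall>z\<in>E. norm (z ^ d * poly P z - 1) < e)"
    proof (intro exI[of _ "P i"] conjI ballI)
      show "bloch_norm w (poly (P i)) < e" using P(1)[of i] ie by simp
      fix z assume "z \<in> E"
      then have "z \<in> sphere 0 1" "z \<notin> B i" by (auto simp: E_def)
      then show "norm (z ^ d * poly (P i) z - 1) < e" using ie dec by (auto simp: B_def)
    qed
  qed
qed

end

section \<open>The weak-star topology\<close>

lemma space_restrict_circle [simp]: "E \<in> sets \<mu> \<Longrightarrow> space (\<mu>on E) = E"
  using sets.sets_into_space[of E \<mu>] by (auto simp: space_restrict_space)

lemma sets_subset_circle: "E \<in> sets \<mu> \<Longrightarrow> z \<in> E \<Longrightarrow> z \<in> sphere 0 1"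
  using sets.sets_into_space[of E \<mu>] by auto

lemma finite_measure_restrict_circle: "E \<in> sets \<mu> \<Longrightarrow> finite_measure (\<mu>on E)"
  by (rule finite_measure_restrict_space) (auto intro: circle.finite_measure_axioms)

lemma continuous_on_circle_measurable_restrict:
  fixes f :: "complex \<Rightarrow> 'b :: topological_space"
  assumes "continuous_on (sphere 0 1) f"
  shows "f \<in> borel_measurable (\<mu>on E)"
  by (rule measurable_restrict_space1[OF continuous_on_circle_measurable[OF assms]])

lemma continuous_on_circle_ess_bounded:
  assumes "E \<in> sets \<mu>" "continuous_on (sphere 0 1) f"
  shows "f \<in> ess_bounded E"
proof -
  obtain C where "\<And>z. z \<in> sphere 0 1 \<Longrightarrow> norm (f z) \<le> C"
    using continuous_on_circle_bounded[OF assms(2)] by blast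
  then have "AE z in \<mu>on E. norm (f z) \<le> C"
    using assms(1) sets_subset_circle by (intro AE_I2) auto
  then show ?thesis
    unfolding ess_bounded_def using continuous_on_circle_measurable_restrict[OF assms(2)] by blast
qed

lemma ess_boundedD:
  assumes "g \<in> ess_bounded E"
  obtains C where "C \<ge> 0" "AE z in \<mu>on E. norm (g z) \<le> C"
proof -
  obtain C where C: "AE z in \<mu>on E. norm (g z) \<le> C"
    using assms unfolding ess_bounded_def by blast
  then have "AE z in \<mu>on E. norm (g z) \<le> max C 0" by eventually_elim auto
  then show ?thesis using that[of "max C 0"] by simp
qed

lemma ess_bounded_measurable: "g \<in> ess_bounded E \<Longrightarrow> g \<in> borel_measurable (\<mu>on E)"
  by (simp add: ess_bounded_def)

lemma ess_bounded_diff: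
  assumes "f \<in> ess_bounded E" "g \<in> ess_bounded E"
  shows "(\<lambda>z. f z - g z) \<in> ess_bounded E"
proof -
  obtain C where C: "AE z in \<mu>on E. norm (f z) \<le> C" using ess_boundedD[OF assms(1)] by blast
  obtain D where D: "AE z in \<mu>on E. norm (g z) \<le> D" using ess_boundedD[OF assms(2)] by blast
  have "AE z in \<mu>on E. norm (f z - g z) \<le> C + D"
    using C D by eventually_elim (rule order_trans[OF norm_triangle_ineq4], simp)
  moreover have "(\<lambda>z. f z - g z) \<in> borel_measurable (\<mu>on E)"
    using assms by (intro borel_measurable_diff) (auto dest: ess_bounded_measurable)
  ultimately show ?thesis unfolding ess_bounded_def by blast
qed

lemma integrable_mult_ess_bounded:
  assumes "integrable (\<mu>on E) \<phi>" "g \<in> ess_bounded E"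
  shows "integrable (\<mu>on E) (\<lambda>z. \<phi> z * g z)"
proof -
  obtain C where C: "AE z in \<mu>on E. norm (g z) \<le> C" "C \<ge> 0" using ess_boundedD[OF assms(2)] by blast
  show ?thesis
  proof (rule Bochner_Integration.integrable_bound)
    show "integrable (\<mu>on E) (\<lambda>z. of_real C * \<phi> z)" using assms(1) by simp
    show "(\<lambda>z. \<phi> z * g z) \<in> borel_measurable (\<mu>on E)"
      using assms by (intro borel_measurable_times) (auto dest: ess_bounded_measurable borel_measurable_integrable)
    show "AE z in \<mu>on E. norm (\<phi> z * g z) \<le> norm (of_real C * \<phi> z)"
      using C(1) by eventually_elim (use C(2) in \<open>simp add: norm_mult mult.commute[of C] mult_left_mono\<close>)
  qed
qed

lemma equiv_ae_eq: "equiv (ess_bounded E) (ae_eq E)"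
proof (rule equivI)
  show "refl_on (ess_bounded E) (ae_eq E)" unfolding refl_on_def ae_eq_def by auto
  show "sym (ae_eq E)"
    unfolding ae_eq_def by (rule symI) (auto elim: eventually_mono)
  show "trans (ae_eq E)"
  proof (rule transI)
    fix f g h assume fg: "(f, g) \<in> ae_eq E" and gh: "(g, h) \<in> ae_eq E"
    then have "AE z in \<mu>on E. f z = g z" "AE z in \<mu>on E. g z = h z"
      by (auto simp: ae_eq_def)
    then have "AE z in \<mu>on E. f z = h z" by eventually_elim simp
    then show "(f, h) \<in> ae_eq E" using fg gh by (auto simp: ae_eq_def)
  qed
qed (auto simp: ae_eq_def)

lemma Linf_class_in: "g \<in> ess_bounded E \<Longrightarrow> Linf_class E g \<in> Linf E"
  unfolding Linf_class_def Linf_def by (rule quotientI)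

lemma LinfE:
  assumes "G \<in> Linf E"
  obtains g where "g \<in> ess_bounded E" "G = Linf_class E g"
  using assms unfolding Linf_class_def Linf_def by (elim quotientE)

lemma Linf_class_eq_iff:
  assumes "f \<in> ess_bounded E" "g \<in> ess_bounded E"
  shows "Linf_class E f = Linf_class E g \<longleftrightarrow> (AE z in \<mu>on E. f z = g z)"
  unfolding Linf_class_def using eq_equiv_class_iff[OF equiv_ae_eq assms] assms by (simp add: ae_eq_def)

lemma pairing_Linf_class:
  assumes "integrable (\<mu>on E) \<phi>" "g \<in> ess_bounded E"
  shows "pairing E \<phi> (Linf_class E g) = (LINT z|\<mu>on E. \<phi> z * g z)"
proof -
  define g' where "g' = (SOME h. h \<in> Linf_class E g)"
  have "g \<in> Linf_class E g" unfolding Linf_class_def using assms(2) by (rule equiv_class_self[OF equiv_ae_eq])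
  then have "g' \<in> Linf_class E g" unfolding g'_def by (rule someI[of "\<lambda>h. h \<in> Linf_class E g"])
  then have g': "g' \<in> ess_bounded E" "AE z in \<mu>on E. g z = g' z"
    by (auto simp: Linf_class_def ae_eq_def)
  have "(LINT z|\<mu>on E. \<phi> z * g' z) = (LINT z|\<mu>on E. \<phi> z * g z)"
  proof (rule integral_cong_AE)
    show "AE z in \<mu>on E. \<phi> z * g' z = \<phi> z * g z"
      using g'(2) by eventually_elim simp
  qed (use assms g' in \<open>auto intro!: borel_measurable_times dest: ess_bounded_measurable borel_measurable_integrable\<close>)
  then show ?thesis by (simp add: pairing_def g'_def)
qed

lemma topspace_weak_star: "topspace (weak_star_topology E) = Linf E"
proof -
  have "\<Union>{{G \<in> Linf E. pairing E \<phi> G \<in> U} |\<phi> U. integrable (\<mu>on E) \<phi> \<and> open U} = Linf E"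
  proof
    have "{G \<in> Linf E. pairing E (\<lambda>_. 0) G \<in> UNIV} \<in>
        {{G \<in> Linf E. pairing E \<phi> G \<in> U} |\<phi> U. integrable (\<mu>on E) \<phi> \<and> open U}"
      by (rule CollectI, rule exI[of _ "\<lambda>_. 0"], rule exI[of _ UNIV]) simp
    then show "Linf E \<subseteq> \<Union>{{G \<in> Linf E. pairing E \<phi> G \<in> U} |\<phi> U. integrable (\<mu>on E) \<phi> \<and> open U}"
      by auto
  qed auto
  then show ?thesis unfolding weak_star_topology_def topology_generated_by_topspace .
qed

lemma weak_star_subbasic_open:
  assumes "integrable (\<mu>on E) \<phi>" "open U"
  shows "openin (weak_star_topology E) {G \<in> Linf E. pairing E \<phi> G \<in> U}"
  unfolding weak_star_topology_def using assms by (intro topology_generated_by_Basis) blast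

text \<open>Induction over the generation of the topology from its subbasis: intersections take the
  union of the test sets and the smaller radius. Proving membership in the closure thereby reduces
  to finitely many functionals.\<close>

lemma weak_star_neighbourhood:
  assumes "openin (weak_star_topology E) V" "G \<in> V"
  shows "\<exists>\<Phi> e. finite \<Phi> \<and> (\<forall>\<phi>\<in>\<Phi>. integrable (\<mu>on E) \<phi>) \<and> e > 0 \<and>
    (\<forall>H\<in>Linf E. (\<forall>\<phi>\<in>\<Phi>. norm (pairing E \<phi> H - pairing E \<phi> G) < e) \<longrightarrow> H \<in> V)"
proof -
  have "generate_topology_on {{G \<in> Linf E. pairing E \<phi> G \<in> U} |\<phi> U. integrable (\<mu>on E) \<phi> \<and> open U} V"
    using assms(1) unfolding weak_star_topology_def openin_topology_generated_by_iff .
  then show ?thesis using assms(2)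
  proof (induction rule: generate_topology_on.induct)
    case Empty
    then show ?case by simp
  next
    case (Int a b)
    have "G \<in> a" "G \<in> b" using Int.prems by auto
    obtain \<Phi> e where \<Phi>: "finite \<Phi>" "\<forall>\<phi>\<in>\<Phi>. integrable (\<mu>on E) \<phi>" "e > 0"
      "\<forall>H\<in>Linf E. (\<forall>\<phi>\<in>\<Phi>. norm (pairing E \<phi> H - pairing E \<phi> G) < e) \<longrightarrow> H \<in> a"
      using Int.IH(1)[OF \<open>G \<in> a\<close>] by (elim exE conjE) (rule that)
    obtain \<Psi> e' where \<Psi>: "finite \<Psi>" "\<forall>\<phi>\<in>\<Psi>. integrable (\<mu>on E) \<phi>" "e' > 0"
      "\<forall>H\<in>Linf E. (\<forall>\<phi>\<in>\<Psi>. norm (pairing E \<phi> H - pairing E \<phi> G) < e') \<longrightarrow> H \<in> b"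
      using Int.IH(2)[OF \<open>G \<in> b\<close>] by (elim exE conjE) (rule that)
    show ?case
    proof (intro exI[of _ "\<Phi> \<union> \<Psi>"] exI[of _ "min e e'"] conjI ballI impI)
      fix H assume H: "H \<in> Linf E" "\<forall>\<phi>\<in>\<Phi> \<union> \<Psi>. norm (pairing E \<phi> H - pairing E \<phi> G) < min e e'"
      have "H \<in> a" using H by (intro \<Phi>(4)[rule_format]) auto
      moreover have "H \<in> b" using H by (intro \<Psi>(4)[rule_format]) auto
      ultimately show "H \<in> a \<inter> b" by blast
    qed (use \<Phi> \<Psi> in auto)
  next
    case (UN K)
    then obtain k where k: "k \<in> K" "G \<in> k" by blast
    then show ?case using UN.IH[OF k] by blast
  next
    case (Basis s)
    then obtain \<phi> U where s: "s = {G \<in> Linf E. pairing E \<phi> G \<in> U}" "integrable (\<mu>on E) \<phi>" "open U"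
      by blast
    then obtain e where e: "e > 0" "ball (pairing E \<phi> G) e \<subseteq> U"
      using Basis.prems by (metis (mono_tags, lifting) mem_Collect_eq open_contains_ball)
    show ?case
    proof (intro exI[of _ "{\<phi>}"] exI[of _ e] conjI ballI impI)
      fix H assume H: "H \<in> Linf E" "\<forall>\<psi>\<in>{\<phi>}. norm (pairing E \<psi> H - pairing E \<psi> G) < e"
      then have "pairing E \<phi> H \<in> ball (pairing E \<phi> G) e" by (simp add: dist_norm norm_minus_commute)
      then show "H \<in> s" using s H e by blast
    qed (use s e in auto)
  qed
qed

section \<open>Weak-star density of the trigonometric polynomials\<close>

definition weak_approx :: "complex set \<Rightarrow> (complex \<Rightarrow> complex) set \<Rightarrow> (complex \<Rightarrow> complex) \<Rightarrow> bool" where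
  "weak_approx E \<Phi> g \<longleftrightarrow> g \<in> ess_bounded E \<and> (\<forall>e>0. \<exists>h. trig_poly h \<and>
     (\<forall>\<phi>\<in>\<Phi>. norm ((LINT z|\<mu>on E. \<phi> z * h z) -
        (LINT z|\<mu>on E. \<phi> z * g z)) < e))"

text \<open>A finite \<open>\<Phi>\<close> is fixed throughout, as a weak-star neighbourhood tests
  only finitely many functionals. The approximable functions are then closed under bounded pointwise
  limits of sequences.\<close>

locale weak_density =
  fixes E :: "complex set" and \<Phi> :: "(complex \<Rightarrow> complex) set"
  assumes E: "E \<in> sets \<mu>" and fin: "finite \<Phi>"
    and int: "\<And>\<phi>. \<phi> \<in> \<Phi> \<Longrightarrow> integrable (\<mu>on E) \<phi>"
begin

abbreviation "\<nu> \<equiv> \<mu>on E"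

lemma trig_ess_bounded: "trig_poly h \<Longrightarrow> h \<in> ess_bounded E"
  by (rule continuous_on_circle_ess_bounded[OF E trig_poly_continuous_on])

lemma weak_approx_lincomb:
  assumes f: "weak_approx E \<Phi> f" and g: "weak_approx E \<Phi> g"
  shows "weak_approx E \<Phi> (\<lambda>z. c * f z + g z)"
proof -
  have fb: "f \<in> ess_bounded E" and gb: "g \<in> ess_bounded E" using f g by (auto simp: weak_approx_def)
  obtain C where C: "AE z in \<nu>. norm (f z) \<le> C" using ess_boundedD[OF fb] by blast
  obtain D where D: "AE z in \<nu>. norm (g z) \<le> D" using ess_boundedD[OF gb] by blast
  have "AE z in \<nu>. norm (c * f z + g z) \<le> norm c * C + D"
    using C D by eventually_elim
      (rule order_trans[OF norm_triangle_ineq], auto simp: norm_mult intro!: add_mono mult_left_mono)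
  moreover have "(\<lambda>z. c * f z + g z) \<in> borel_measurable \<nu>"
    using ess_bounded_measurable[OF fb] ess_bounded_measurable[OF gb] by measurable
  ultimately have b: "(\<lambda>z. c * f z + g z) \<in> ess_bounded E" unfolding ess_bounded_def by blast
  have "\<exists>h. trig_poly h \<and> (\<forall>\<phi>\<in>\<Phi>. norm ((LINT z|\<nu>. \<phi> z * h z) - (LINT z|\<nu>. \<phi> z * (c * f z + g z))) < e)" if e: "e > 0" for e
  proof -
    define e1 where "e1 = e / (2 * (norm c + 1))"
    have e1: "e1 > 0" using e by (auto simp: e1_def add_nonneg_pos intro!: divide_pos_pos)
    obtain h1 where h1: "trig_poly h1" "\<forall>\<phi>\<in>\<Phi>. norm ((LINT z|\<nu>. \<phi> z * h1 z) - (LINT z|\<nu>. \<phi> z * f z)) < e1"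
      using f e1 unfolding weak_approx_def by blast
    obtain h2 where h2: "trig_poly h2" "\<forall>\<phi>\<in>\<Phi>. norm ((LINT z|\<nu>. \<phi> z * h2 z) - (LINT z|\<nu>. \<phi> z * g z)) < e / 2"
      using g e unfolding weak_approx_def by (meson half_gt_zero)
    show ?thesis
    proof (intro exI[of _ "\<lambda>z. c * h1 z + h2 z"] conjI ballI)
      show "trig_poly (\<lambda>z. c * h1 z + h2 z)" by (intro trig_poly_add trig_poly_mult trig_poly_const h1 h2)
      fix \<phi> assume \<phi>: "\<phi> \<in> \<Phi>"
      have lin: "(LINT z|\<nu>. \<phi> z * (c * u z + v z)) = c * (LINT z|\<nu>. \<phi> z * u z) + (LINT z|\<nu>. \<phi> z * v z)"
        if "u \<in> ess_bounded E" "v \<in> ess_bounded E" for u v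
      proof -
        have "(LINT z|\<nu>. \<phi> z * (c * u z + v z)) = (LINT z|\<nu>. c * (\<phi> z * u z) + \<phi> z * v z)"
          by (simp add: algebra_simps)
        then show ?thesis using integrable_mult_ess_bounded[OF int[OF \<phi>]] that by simp
      qed
      have "norm ((LINT z|\<nu>. \<phi> z * (c * h1 z + h2 z)) - (LINT z|\<nu>. \<phi> z * (c * f z + g z))) =
         norm (c * ((LINT z|\<nu>. \<phi> z * h1 z) - (LINT z|\<nu>. \<phi> z * f z)) + ((LINT z|\<nu>. \<phi> z * h2 z) - (LINT z|\<nu>. \<phi> z * g z)))"
        using lin[OF trig_ess_bounded trig_ess_bounded, OF h1(1) h2(1)] lin[OF fb gb] by (simp add: algebra_simps)
      also have "\<dots> \<le> norm c * norm ((LINT z|\<nu>. \<phi> z * h1 z) - (LINT z|\<nu>. \<phi> z * f z)) + norm ((LINT z|\<nu>. \<phi> z * h2 z) - (LINT z|\<nu>. \<phi> z * g z))"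
        by (rule order_trans[OF norm_triangle_ineq]) (simp add: norm_mult)
      also have "\<dots> < e / 2 + e / 2"
      proof (rule add_le_less_mono)
        have "norm c * norm ((LINT z|\<nu>. \<phi> z * h1 z) - (LINT z|\<nu>. \<phi> z * f z)) \<le> (norm c + 1) * e1"
          using h1(2) \<phi> by (intro mult_mono) (auto simp: less_imp_le)
        also have "\<dots> = e / 2" by (simp add: e1_def add_nonneg_eq_0_iff field_simps)
        finally show "norm c * norm ((LINT z|\<nu>. \<phi> z * h1 z) - (LINT z|\<nu>. \<phi> z * f z)) \<le> e / 2" .
        show "norm ((LINT z|\<nu>. \<phi> z * h2 z) - (LINT z|\<nu>. \<phi> z * g z)) < e / 2" using h2(2) \<phi> by blast
      qed
      finally show "norm ((LINT z|\<nu>. \<phi> z * (c * h1 z + h2 z)) - (LINT z|\<nu>. \<phi> z * (c * f z + g z))) < e" by simp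
    qed
  qed
  then show ?thesis unfolding weak_approx_def using b by blast
qed

lemma weak_approx_trig: "trig_poly h \<Longrightarrow> weak_approx E \<Phi> h"
  unfolding weak_approx_def using trig_ess_bounded by (auto intro!: exI[of _ h])

lemma weak_approx_sum:
  assumes "\<And>i. i \<in> I \<Longrightarrow> weak_approx E \<Phi> (f i)"
  shows "weak_approx E \<Phi> (\<lambda>z. \<Sum>i\<in>I. c i * f i z)"
  using assms
proof (induction I rule: infinite_finite_induct)
  case (insert i I)
  then show ?case using weak_approx_lincomb[of "f i" "\<lambda>z. \<Sum>i\<in>I. c i * f i z" "c i"] by simp
qed (simp_all add: weak_approx_trig[OF trig_poly_const])

lemma weak_approx_AE:
  assumes "weak_approx E \<Phi> f" "g \<in> ess_bounded E" "AE z in \<nu>. f z = g z"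
  shows "weak_approx E \<Phi> g"
proof -
  have fb: "f \<in> ess_bounded E" using assms(1) by (simp add: weak_approx_def)
  have "(LINT z|\<nu>. \<phi> z * f z) = (LINT z|\<nu>. \<phi> z * g z)" if "\<phi> \<in> \<Phi>" for \<phi>
    by (rule integral_cong_AE)
       (use assms(2,3) fb int[OF that] in \<open>auto intro!: borel_measurable_times dest: ess_bounded_measurable borel_measurable_integrable\<close>)
  then show ?thesis using assms(1,2) unfolding weak_approx_def by simp
qed

text \<open>Dominated convergence with majorant \<open>C * |\<phi>|\<close>, for all
  \<open>\<phi>\<close> at once by finiteness. It carries the class from trigonometric polynomials
  through continuous functions and indicators of closed, Borel and Lebesgue sets to all essentially
  bounded functions.\<close>

lemma weak_approx_limit:
  assumes f: "\<And>n. weak_approx E \<Phi> (f n)" and C: "\<And>n z. z \<in> E \<Longrightarrow> norm (f n z) \<le> C"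
    and lim: "\<And>z. z \<in> E \<Longrightarrow> (\<lambda>n. f n z) \<longlonglongrightarrow> g z"
  shows "weak_approx E \<Phi> g"
proof -
  have fb: "f n \<in> ess_bounded E" for n using f by (simp add: weak_approx_def)
  have gm: "g \<in> borel_measurable \<nu>"
    by (rule borel_measurable_LIMSEQ_metric[of f]) (use ess_bounded_measurable[OF fb] lim E in auto)
  have gC: "norm (g z) \<le> C" if "z \<in> E" for z
    using lim[OF that] C[OF that] by (intro LIMSEQ_le_const2[OF tendsto_norm]) auto
  then have gb: "g \<in> ess_bounded E"
    unfolding ess_bounded_def using gm E by (auto intro!: exI[of _ C] AE_I2)
  have conv: "(\<lambda>n. LINT z|\<nu>. \<phi> z * f n z) \<longlonglongrightarrow> (LINT z|\<nu>. \<phi> z * g z)" if \<phi>: "\<phi> \<in> \<Phi>" for \<phi>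
  proof (rule integral_dominated_convergence[where w = "\<lambda>z. C * norm (\<phi> z)"])
    show "integrable \<nu> (\<lambda>z. C * norm (\<phi> z))" using int[OF \<phi>] by simp
    show "AE z in \<nu>. (\<lambda>n. \<phi> z * f n z) \<longlonglongrightarrow> \<phi> z * g z"
      using lim E by (intro AE_I2 tendsto_mult) auto
    show "AE z in \<nu>. norm (\<phi> z * f n z) \<le> C * norm (\<phi> z)" for n
      using C E by (intro AE_I2) (auto simp: norm_mult mult.commute[of C] intro!: mult_left_mono)
  qed (use int[OF \<phi>] fb gb in \<open>auto intro!: borel_measurable_times dest: ess_bounded_measurable borel_measurable_integrable\<close>)
  have "\<exists>h. trig_poly h \<and> (\<forall>\<phi>\<in>\<Phi>. norm ((LINT z|\<nu>. \<phi> z * h z) - (LINT z|\<nu>. \<phi> z * g z)) < e)" if e: "e > 0" for e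
  proof -
    have "\<forall>\<^sub>F n in sequentially. \<forall>\<phi>\<in>\<Phi>. norm ((LINT z|\<nu>. \<phi> z * f n z) - (LINT z|\<nu>. \<phi> z * g z)) < e / 2"
      using tendstoD[OF conv, of _ "e / 2"] e by (intro eventually_ball_finite fin ballI) (simp add: dist_norm)
    then obtain n where n: "\<forall>\<phi>\<in>\<Phi>. norm ((LINT z|\<nu>. \<phi> z * f n z) - (LINT z|\<nu>. \<phi> z * g z)) < e / 2"
      by (auto simp: eventually_sequentially)
    obtain h where h: "trig_poly h" "\<forall>\<phi>\<in>\<Phi>. norm ((LINT z|\<nu>. \<phi> z * h z) - (LINT z|\<nu>. \<phi> z * f n z)) < e / 2"
      using f[of n] e unfolding weak_approx_def by (meson half_gt_zero)
    show ?thesis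
    proof (intro exI[of _ h] conjI ballI h(1))
      fix \<phi> assume \<phi>: "\<phi> \<in> \<Phi>"
      show "norm ((LINT z|\<nu>. \<phi> z * h z) - (LINT z|\<nu>. \<phi> z * g z)) < e"
        using norm_diff_triangle_less[OF h(2)[rule_format, OF \<phi>] n[rule_format, OF \<phi>]] by simp
    qed
  qed
  then show ?thesis unfolding weak_approx_def using gb by blast
qed

lemma weak_approx_continuous:
  assumes "continuous_on (sphere 0 1) g"
  shows "weak_approx E \<Phi> g"
proof -
  obtain C where C: "\<And>z. z \<in> sphere 0 1 \<Longrightarrow> norm (g z) \<le> C"
    using continuous_on_circle_bounded[OF assms] by blast
  have "\<exists>h. trig_poly h \<and> (\<forall>z\<in>sphere 0 1. norm (g z - h z) < inverse (real (Suc n)))" for n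
    using trig_poly_approx[OF assms, of "inverse (real (Suc n))"] by (metis inverse_positive_iff_positive of_nat_0_less_iff zero_less_Suc)
  then obtain h where h: "\<And>n. trig_poly (h n)" "\<And>n z. z \<in> sphere 0 1 \<Longrightarrow> norm (g z - h n z) < inverse (real (Suc n))"
    by metis
  show ?thesis
  proof (rule weak_approx_limit)
    show "weak_approx E \<Phi> (h n)" for n by (rule weak_approx_trig[OF h(1)])
    fix z assume "z \<in> E"
    then have z: "z \<in> sphere 0 1" using sets_subset_circle[OF E] by blast
    show "norm (h n z) \<le> C + 1" for n
    proof -
      have "inverse (real (Suc n)) \<le> 1" by (simp add: inverse_le_1_iff)
      then show ?thesis using C[OF z] h(2)[OF z, of n] norm_triangle_sub[of "h n z" "g z"]
        by (simp add: norm_minus_commute)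
    qed
    show "(\<lambda>n. h n z) \<longlonglongrightarrow> g z"
    proof (rule LIMSEQ_I)
      fix r :: real assume "r > 0"
      then obtain N where N: "inverse (real (Suc N)) < r" using reals_Archimedean by blast
      show "\<exists>no. \<forall>n\<ge>no. norm (h n z - g z) < r"
      proof (intro exI[of _ N] allI impI)
        fix n assume "n \<ge> N"
        then have "inverse (real (Suc n)) \<le> inverse (real (Suc N))" by simp
        then show "norm (h n z - g z) < r"
          using h(2)[OF z, of n] N unfolding norm_minus_commute[of "h n z"] by linarith
      qed
    qed
  qed
qed

lemma weak_approx_closed:
  assumes "closed C"
  shows "weak_approx E \<Phi> (indicator C)"
proof (cases "C = {}")
  \<comment> \<open>Treated apart because \<open>infdist\<close> to the empty set is 0 by
    convention, so the functions used below would all be constantly 1.\<close>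
  case True
  then have "(indicator C :: complex \<Rightarrow> complex) = (\<lambda>z. 0)" by (auto simp: indicator_def)
  then show ?thesis using weak_approx_trig[OF trig_poly_const[of 0]] by simp
next
  case False
  show ?thesis
  proof (rule weak_approx_limit)
    show "weak_approx E \<Phi> (\<lambda>z. of_real (max 0 (1 - real n * infdist z C)))" for n
      by (intro weak_approx_continuous continuous_intros)
    show "norm (complex_of_real (max 0 (1 - real n * infdist z C))) \<le> 1" for n z
      using infdist_nonneg[of z C] by (simp add: max_def)
    fix z
    show "(\<lambda>n. complex_of_real (max 0 (1 - real n * infdist z C))) \<longlonglongrightarrow> indicator C z"
    proof (cases "z \<in> C")
      case True
      then show ?thesis by simp
    next
      case z: False
      have "infdist z C > 0"
        using z False assms infdist_nonneg[of z C] in_closed_iff_infdist_zero[OF assms False, of z] by linarith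
      then obtain N :: nat where N: "1 < real N * infdist z C" using reals_Archimedean3 by blast
      have "complex_of_real (max 0 (1 - real n * infdist z C)) = indicator C z" if "n \<ge> N" for n
      proof -
        have "real N * infdist z C \<le> real n * infdist z C" using that by (intro mult_right_mono infdist_nonneg) auto
        then show ?thesis using N z by (simp add: max_def)
      qed
      then show ?thesis by (intro tendsto_eventually) (auto simp: eventually_sequentially)
    qed
  qed
qed

text \<open>Dynkin's argument with the closed sets as intersection-stable generator; partial unions
  of a disjoint family converge boundedly.\<close>

lemma weak_approx_borel:
  assumes "A \<in> sets borel"
  shows "weak_approx E \<Phi> (indicator A)"
proof -
  have A: "A \<in> sigma_sets UNIV (Collect closed)" using assms by (simp add: borel_eq_closed)
  show ?thesis
  proof (rule sigma_sets_induct_disjoint[OF _ _ A])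
    show "Int_stable (Collect closed)" by (auto simp: Int_stable_def)
    show "weak_approx E \<Phi> (indicator C)" if "C \<in> Collect closed" for C :: "complex set"
      using that by (intro weak_approx_closed) simp
    show "weak_approx E \<Phi> (indicator {})" by (intro weak_approx_closed) simp
    show "weak_approx E \<Phi> (indicator (UNIV - B))" if "weak_approx E \<Phi> (indicator B)" for B :: "complex set"
    proof -
      have "indicator (UNIV - B) = (\<lambda>z. (- 1) * indicator B z + 1 :: complex)"
        by (auto simp: indicator_def)
      then show ?thesis using weak_approx_lincomb[OF that weak_approx_trig[OF trig_poly_const[of 1]], of "- 1"] by simp
    qed
    fix B :: "nat \<Rightarrow> complex set"
    assume disj: "disjoint_family B" and B: "\<And>i. weak_approx E \<Phi> (indicator (B i))"
    have sums: "(\<Sum>i<n. 1 * indicator (B i) z) = (indicator (\<Union>i<n. B i) z :: complex)" for n z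
      using disj by (simp add: indicator_UN_disjoint disjoint_family_on_def)
    show "weak_approx E \<Phi> (indicator (\<Union>i. B i))"
    proof (rule weak_approx_limit)
      show "weak_approx E \<Phi> (\<lambda>z. \<Sum>i<n. 1 * indicator (B i) z)" for n by (rule weak_approx_sum) (rule B)
      show "norm (\<Sum>i<n. 1 * indicator (B i) z :: complex) \<le> 1" for n z
        unfolding sums by (simp add: indicator_def)
      show "(\<lambda>n. \<Sum>i<n. 1 * indicator (B i) z :: complex) \<longlonglongrightarrow> indicator (\<Union>i. B i) z" for z
        unfolding sums by (rule LIMSEQ_indicator_UN)
    qed
  qed simp
qed

lemma ess_bounded_indicator:
  assumes "A \<in> sets \<mu>"
  shows "indicator A \<in> ess_bounded E"
proof -
  have "(indicator A :: complex \<Rightarrow> complex) \<in> borel_measurable \<nu>"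
    by (intro measurable_restrict_space1 borel_measurable_indicator assms)
  moreover have "AE z in \<nu>. norm (indicator A z :: complex) \<le> 1" by (simp add: indicator_def)
  ultimately show ?thesis unfolding ess_bounded_def by blast
qed

text \<open>A set measurable for the completed measure differs from a Borel set only within a null
  set, which no functional sees.\<close>

lemma weak_approx_indicator:
  assumes A: "A \<in> sets \<mu>"
  shows "weak_approx E \<Phi> (indicator A)"
proof -
  define M where "M = distr (uniform_measure lborel {0..1}) (restrict_space borel (sphere 0 1)) (\<lambda>t::real. cis (2 * pi * t))"
  have cm: "\<mu> = completion M" by (simp add: M_def circle_measure_def)
  obtain S N N' where S: "A = S \<union> N" "N \<subseteq> N'" "N' \<in> null_sets M" "S \<in> sets M"
    using A unfolding cm by (elim sets_completionE)
  obtain B where B: "B \<in> sets borel" "S = B \<inter> sphere 0 1"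
    using S(4) by (auto simp: M_def sets_restrict_space)
  have N': "N' \<in> null_sets \<mu>" unfolding cm using S(3) by (rule null_sets_completionI)
  have "AE z in \<mu>. z \<in> E \<longrightarrow> indicator B z = (indicator A z :: complex)"
    using AE_not_in[OF N'] AE_space
  proof eventually_elim
    case (elim z)
    then show ?case using S B by (auto simp: indicator_def)
  qed
  then have "AE z in \<nu>. indicator B z = (indicator A z :: complex)"
    using E sets.sets_into_space[OF E] by (subst AE_restrict_space_iff) (auto simp: Int_absorb2)
  then show ?thesis
    by (rule weak_approx_AE[OF weak_approx_borel[OF B(1)] ess_bounded_indicator[OF A]])
qed

lemma weak_approx_ess_bounded:
  assumes g: "g \<in> ess_bounded E"
  shows "weak_approx E \<Phi> g"
proof -
  obtain C where C: "C \<ge> 0" "AE z in \<nu>. norm (g z) \<le> C" using ess_boundedD[OF g] by blast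
  note gm [measurable] = ess_bounded_measurable[OF g]
  \<comment> \<open>\<open>g\<close> is bounded almost everywhere only, while the limit argument
    needs a bound at every point of \<open>E\<close>.\<close>
  define g' where "g' = (\<lambda>z. if norm (g z) \<le> C then g z else 0)"
  have g'm: "g' \<in> borel_measurable \<nu>" unfolding g'_def by measurable
  have g'C: "norm (g' z) \<le> C" for z using C(1) by (simp add: g'_def)
  obtain F where F: "\<And>i. simple_function \<nu> (F i)" "\<And>z. z \<in> space \<nu> \<Longrightarrow> (\<lambda>i. F i z) \<longlonglongrightarrow> g' z"
    "\<And>i z. z \<in> space \<nu> \<Longrightarrow> dist (F i z) 0 \<le> 2 * dist (g' z) 0"
    using borel_measurable_implies_sequence_metric[OF g'm, of 0] by blast
  have "weak_approx E \<Phi> g'"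
  proof (rule weak_approx_limit[of "\<lambda>i z. \<Sum>y\<in>F i ` E. y * indicator (F i -` {y} \<inter> E) z"])
    have eq: "(\<Sum>y\<in>F i ` E. y * indicator (F i -` {y} \<inter> E) z) = F i z" if z: "z \<in> E" for i z
    proof -
      have finF: "finite (F i ` E)" using simple_functionD(1)[OF F(1)[of i]] E by simp
      have "(\<Sum>y\<in>F i ` E. y * indicator (F i -` {y} \<inter> E) z) = (\<Sum>y\<in>F i ` E. if y = F i z then y else 0)"
        using z by (intro sum.cong refl) (auto simp: indicator_def)
      also have "\<dots> = F i z" using finF z by (simp add: sum.delta)
      finally show ?thesis .
    qed
    show "weak_approx E \<Phi> (\<lambda>z. \<Sum>y\<in>F i ` E. y * indicator (F i -` {y} \<inter> E) z)" for i
    proof (intro weak_approx_sum weak_approx_indicator)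
      fix y
      have "F i -` {y} \<inter> space \<nu> \<in> sets \<nu>" by (rule simple_functionD(2)[OF F(1)])
      then show "F i -` {y} \<inter> E \<in> sets \<mu>"
        using E sets_restrict_space_iff[of E \<mu>] sets.Int_space_eq2[OF E] by simp
    qed
    fix z assume z: "z \<in> E"
    show "norm (\<Sum>y\<in>F i ` E. y * indicator (F i -` {y} \<inter> E) z) \<le> 2 * C" for i
      unfolding eq[OF z] using F(3)[of z i] g'C[of z] z E by simp
    show "(\<lambda>i. \<Sum>y\<in>F i ` E. y * indicator (F i -` {y} \<inter> E) z) \<longlonglongrightarrow> g' z"
      unfolding eq[OF z] using F(2)[of z] z E by simp
  qed
  moreover have "AE z in \<nu>. g' z = g z" using C(2) by eventually_elim (simp add: g'_def)
  ultimately show ?thesis using weak_approx_AE g by blast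
qed

end

section \<open>Simultaneous approximation and rigidity\<close>

lemma norm_integral_mult_le:
  assumes E: "E \<in> sets \<mu>" and \<phi>: "integrable (\<mu>on E) \<phi>"
    and h: "h \<in> ess_bounded E" and c: "\<And>z. z \<in> E \<Longrightarrow> norm (h z) \<le> c"
  shows "norm (LINT z|\<mu>on E. \<phi> z * h z) \<le>
    c * (LINT z|\<mu>on E. norm (\<phi> z))"
proof -
  have "norm (LINT z|\<mu>on E. \<phi> z * h z) \<le>
      (LINT z|\<mu>on E. norm (\<phi> z * h z))"
    by (rule integral_norm_bound)
  also have "\<dots> \<le> (LINT z|\<mu>on E. c * norm (\<phi> z))"
    using integrable_mult_ess_bounded[OF \<phi> h] \<phi> c E
    by (intro integral_mono integrable_norm integrable_mult_right)
       (auto simp: norm_mult mult.commute[of c] intro!: mult_left_mono)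
  finally show ?thesis by simp
qed

section \<open>The closure of the polynomials and the SA-property\<close>

context majorant_weight
begin

lemma bloch_norm_eq_0:
  assumes f: "f \<in> little" and z: "bloch_norm w f = 0" "z \<in> unit_disc"
  shows "f z = 0"
proof -
  note ff = little_fin_norm[OF f]
  have hol: "f holomorphic_on unit_disc" using f by (simp add: little_def)
  have "deriv f x = 0" if x: "x \<in> unit_disc" for x
  proof -
    have "\<rho> x * norm (deriv f x) \<le> 0" using deriv_le_bloch_norm[OF ff x] z(1) by simp
    then have "norm (deriv f x) \<le> 0" using \<rho>_pos[OF x] by (simp add: mult_le_0_iff)
    then show ?thesis by simp
  qed
  then have "(f has_field_derivative 0) (at x within unit_disc)" if "x \<in> unit_disc" for x
    using holomorphic_derivI[OF hol open_ball that] that by simp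
  then obtain c where "\<And>x. x \<in> unit_disc \<Longrightarrow> f x = c"
    using has_field_derivative_zero_constant[of unit_disc f] by auto
  moreover have "f 0 = 0" using norm_0_le_bloch_norm[OF ff] z(1) by simp
  ultimately show ?thesis using z(2) by (metis centre_in_ball zero_less_one)
qed

lemma zero_little: "(\<lambda>z. 0) \<in> little"
proof -
  have e: "poly 0 = (\<lambda>z. 0 :: complex)" by (rule ext) simp
  show ?thesis using poly_little[of 0] unfolding e .
qed

lemma little_diff: "f \<in> little \<Longrightarrow> g \<in> little \<Longrightarrow> (\<lambda>z. f z - g z) \<in> little"
  using little_lincomb[of f g 1 "-1"] by simp

lemma bloch_norm_diff_triangle:
  assumes "f \<in> little" "g \<in> little" "h \<in> little"
  shows "bloch_norm w (\<lambda>z. f z - h z) \<le> bloch_norm w (\<lambda>z. f z - g z) + bloch_norm w (\<lambda>z. g z - h z)"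
  using bloch_norm_lincomb(2)[of "\<lambda>z. f z - g z" "\<lambda>z. g z - h z" 1 1] assms
  by (simp add: little_fin_norm little_diff)

lemma bloch_norm_diff_commute:
  assumes "f \<in> little" "g \<in> little"
  shows "bloch_norm w (\<lambda>z. f z - g z) = bloch_norm w (\<lambda>z. g z - f z)"
proof -
  have le: "bloch_norm w (\<lambda>z. f z - g z) \<le> bloch_norm w (\<lambda>z. g z - f z)"
    if "f \<in> little" "g \<in> little" for f g
    using bloch_norm_lincomb(2)[of "\<lambda>z. g z - f z" "\<lambda>z. 0" "-1" 0] that
      zero_little by (simp add: little_fin_norm little_diff)
  show ?thesis using le[OF assms] le[OF assms(2,1)] by simp
qed

abbreviation "dist_w \<equiv> (\<lambda>f g. if f \<in> bloch0 w \<and> g \<in> bloch0 w then bloch_norm w (\<lambda>z. f z - g z) else 0)"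

lemma bloch0_little: "f \<in> bloch0 w \<Longrightarrow> f \<in> little"
  by (simp add: bloch0_eq)

lemma bloch_metric: "Metric_space (bloch0 w) dist_w"
proof
  fix f g h :: "complex \<Rightarrow> complex"
  show "0 \<le> dist_w f g"
    by (auto dest!: bloch0_little intro!: bloch_norm_nonneg little_fin_norm little_diff)
  show "dist_w f g = dist_w g f"
    using bloch_norm_diff_commute[of f g] bloch0_little by auto
  show "dist_w f h \<le> dist_w f g + dist_w g h" if "f \<in> bloch0 w" "g \<in> bloch0 w" "h \<in> bloch0 w"
    using bloch_norm_diff_triangle[of f g h] that bloch0_little by auto
  show "dist_w f g = 0 \<longleftrightarrow> f = g" if fg: "f \<in> bloch0 w" "g \<in> bloch0 w"
  proof
    assume "dist_w f g = 0"
    then have "bloch_norm w (\<lambda>z. f z - g z) = 0" using fg by simp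
    then have "f z - g z = 0" if "z \<in> unit_disc" for z
      using bloch_norm_eq_0[OF little_diff[OF bloch0_little bloch0_little], of f g z] fg that by simp
    then show "f = g"
      using fg by (intro extensionalityI[of _ unit_disc]) (auto simp: bloch0_eq)
  next
    assume "f = g"
    then show "dist_w f g = 0"
      using bloch_norm_leI[of "\<lambda>z. 0" 0] bloch_norm_nonneg[OF little_fin_norm[OF zero_little]] by simp
  qed
qed

interpretation bm: Metric_space "bloch0 w" dist_w
  by (rule bloch_metric)

lemma norm_topology_eq: "norm_topology (bloch0 w) (bloch_norm w) = bm.mtopology"
  by (simp add: norm_topology_def)

lemma restrict_poly_bloch0: "restrict (poly Q) unit_disc \<in> bloch0 w"
  using little_cong[of "restrict (poly Q) unit_disc" "poly Q"] poly_little[of Q] by (simp add: bloch0_eq)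

lemma bloch_norm_diff_restrict:
  "bloch_norm w (\<lambda>z. f z - restrict (poly Q) unit_disc z) = bloch_norm w (\<lambda>z. f z - poly Q z)"
  by (rule bloch_norm_cong) simp

lemma poly_continuous_circle: "continuous_on (sphere 0 1) (poly (Q :: complex poly))"
  by (intro continuous_intros)

lemma poly_ess_bounded: "E \<in> sets \<mu> \<Longrightarrow> poly Q \<in> ess_bounded E"
  by (rule continuous_on_circle_ess_bounded[OF _ poly_continuous_circle])

text \<open>A neighbourhood of \<open>(f, G)\<close> contains a ball times a set given by finitely
  many functionals; the smaller of the two radii serves as the common \<open>e\<close>.\<close>

lemma in_poly_closureI:
  assumes E: "E \<in> sets \<mu>" and f: "f \<in> bloch0 w" and G: "G \<in> Linf E"
    and approx: "\<And>\<Phi> e. finite \<Phi> \<Longrightarrow> \<forall>\<phi>\<in>\<Phi>. integrable (\<mu>on E) \<phi> \<Longrightarrow> e > 0 \<Longrightarrow>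
      \<exists>Q. bloch_norm w (\<lambda>z. f z - poly Q z) < e \<and>
        (\<forall>\<phi>\<in>\<Phi>. norm (pairing E \<phi> (Linf_class E (poly Q)) - pairing E \<phi> G) < e)"
  shows "(f, G) \<in> poly_closure (bloch0 w) (bloch_norm w) E"
  unfolding poly_closure_def in_closure_of norm_topology_eq
proof (intro conjI allI impI)
  show "(f, G) \<in> topspace (prod_topology bm.mtopology (weak_star_topology E))"
    using f G by (simp add: topspace_weak_star)
  fix T assume T: "(f, G) \<in> T \<and> openin (prod_topology bm.mtopology (weak_star_topology E)) T"
  then obtain U V where UV: "openin bm.mtopology U" "openin (weak_star_topology E) V" "f \<in> U" "G \<in> V" "U \<times> V \<subseteq> T"
    unfolding openin_prod_topology_alt by blast
  obtain r where r: "r > 0" "bm.mball f r \<subseteq> U" using UV(1,3) unfolding bm.openin_mtopology by blast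
  obtain \<Phi> e where \<Phi>: "finite \<Phi>" "\<forall>\<phi>\<in>\<Phi>. integrable (\<mu>on E) \<phi>" "e > 0"
    "\<forall>H\<in>Linf E. (\<forall>\<phi>\<in>\<Phi>. norm (pairing E \<phi> H - pairing E \<phi> G) < e) \<longrightarrow> H \<in> V"
    using weak_star_neighbourhood[OF UV(2,4)] by (elim exE conjE) (rule that)
  have "min r e > 0" using r(1) \<Phi>(3) by simp
  then obtain Q where Q: "bloch_norm w (\<lambda>z. f z - poly Q z) < min r e"
    "\<forall>\<phi>\<in>\<Phi>. norm (pairing E \<phi> (Linf_class E (poly Q)) - pairing E \<phi> G) < min r e"
    using approx[OF \<Phi>(1,2)] by blast
  have "restrict (poly Q) unit_disc \<in> U"
    using r(2) Q(1) f restrict_poly_bloch0[of Q] bloch_norm_diff_restrict[of f Q] by auto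
  moreover have "Linf_class E (poly Q) \<in> V"
    using Q(2) Linf_class_in[OF poly_ess_bounded[OF E]] by (intro \<Phi>(4)[rule_format]) auto
  ultimately show "\<exists>y. y \<in> {(restrict (poly Q) unit_disc, Linf_class E (poly Q)) |Q. True} \<and> y \<in> T"
    using UV(5) by blast
qed

lemma poly_closure_subset: "poly_closure (bloch0 w) (bloch_norm w) E \<subseteq> bloch0 w \<times> Linf E"
  unfolding poly_closure_def norm_topology_eq
  using closure_of_subset_topspace[of "prod_topology bm.mtopology (weak_star_topology E)"]
  by (simp add: topspace_weak_star)

text \<open>A single functional is enough for the rigidity argument, so a subbasic weak-star
  neighbourhood will do.\<close>

lemma in_poly_closureD:
  assumes "E \<in> sets \<mu>" "(f, G) \<in> poly_closure (bloch0 w) (bloch_norm w) E"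
    and \<phi>: "integrable (\<mu>on E) \<phi>" and e: "e > 0"
  obtains Q where "bloch_norm w (\<lambda>z. f z - poly Q z) < e"
    "norm (pairing E \<phi> (Linf_class E (poly Q)) - pairing E \<phi> G) < e"
proof -
  have fG: "f \<in> bloch0 w" "G \<in> Linf E" using assms(2) poly_closure_subset by auto
  define V where "V = {H \<in> Linf E. pairing E \<phi> H \<in> ball (pairing E \<phi> G) e}"
  have "openin (prod_topology bm.mtopology (weak_star_topology E)) (bm.mball f e \<times> V)"
    unfolding V_def by (intro openin_prod_Times_iff[THEN iffD2] disjI2 conjI bm.openin_mball weak_star_subbasic_open \<phi>) simp
  moreover have "(f, G) \<in> bm.mball f e \<times> V" using fG e bm.centre_in_mball_iff[of f e] by (simp add: V_def del: bm.in_mball)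
  ultimately obtain y where y: "y \<in> {(restrict (poly Q) unit_disc, Linf_class E (poly Q)) |Q. True}" "y \<in> bm.mball f e \<times> V"
  proof -
    assume o: "openin (prod_topology bm.mtopology (weak_star_topology E)) (bm.mball f e \<times> V)"
      and i: "(f, G) \<in> bm.mball f e \<times> V"
    have "\<forall>T. (f, G) \<in> T \<and> openin (prod_topology bm.mtopology (weak_star_topology E)) T \<longrightarrow>
        (\<exists>y. y \<in> {(restrict (poly Q) unit_disc, Linf_class E (poly Q)) |Q. True} \<and> y \<in> T)"
      using assms(2) unfolding poly_closure_def in_closure_of norm_topology_eq by (rule conjunct2)
    from mp[OF spec[OF this] conjI[OF i o]] show thesis by (elim exE conjE) (rule that)
  qed
  from y(1) obtain Q where yQ: "y = (restrict (poly Q) unit_disc, Linf_class E (poly Q))" by blast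
  have Q: "restrict (poly Q) unit_disc \<in> bm.mball f e" "Linf_class E (poly Q) \<in> V"
    using y(2) unfolding yQ by (simp_all only: mem_Times_iff fst_conv snd_conv)
  show ?thesis
  proof (rule that)
    show "bloch_norm w (\<lambda>z. f z - poly Q z) < e"
      using Q(1) restrict_poly_bloch0[of Q] bloch_norm_diff_restrict[of f Q] by auto
    show "norm (pairing E \<phi> (Linf_class E (poly Q)) - pairing E \<phi> G) < e"
      using Q(2) by (simp add: V_def dist_norm norm_minus_commute)
  qed
qed

text \<open>Take \<open>P0\<close> near \<open>f\<close> in norm and a trigonometric polynomial
  \<open>h\<close> weakly near \<open>g - P0\<close>, with \<open>h = z^(-d) p\<close> on the
  circle. If \<open>S\<close> has tiny norm and is close to \<open>z^(-d)\<close> on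
  \<open>E\<close>, then \<open>P0 + p * S\<close> is still near \<open>f\<close> and weakly near
  \<open>g\<close>.\<close>

lemma SA_property_of_approximation_set:
  assumes E: "E \<in> sets \<mu>"
    and approx: "\<And>d e. e > 0 \<Longrightarrow> \<exists>P. bloch_norm w (poly P) < e \<and> (\<forall>z\<in>E. norm (z ^ d * poly P z - 1) < e)"
  shows "SA_property (bloch0 w) (bloch_norm w) E"
  unfolding SA_property_def
proof (rule antisym[OF poly_closure_subset], rule subsetI, clarify)
  fix f G assume f: "f \<in> bloch0 w" and G: "G \<in> Linf E"
  show "(f, G) \<in> poly_closure (bloch0 w) (bloch_norm w) E"
  proof (rule in_poly_closureI[OF E f G])
    fix \<Phi> :: "(complex \<Rightarrow> complex) set" and e :: real
    assume fin: "finite \<Phi>" and \<Phi>: "\<forall>\<phi>\<in>\<Phi>. integrable (\<mu>on E) \<phi>" and e: "e > 0"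
    define \<nu> where "\<nu> = \<mu>on E"
    interpret weak_density E \<Phi> using E fin \<Phi> by unfold_locales auto
    obtain g where g: "g \<in> ess_bounded E" "G = Linf_class E g" using LinfE[OF G] .
    have fl: "f \<in> little" by (rule bloch0_little[OF f])
    obtain P0 where P0: "bloch_norm w (\<lambda>z. f z - poly P0 z) < e / 2"
      using little_poly_dense[OF fl, of "e / 2"] e by auto
    define g1 where "g1 = (\<lambda>z. g z - poly P0 z)"
    have g1: "g1 \<in> ess_bounded E" unfolding g1_def by (intro ess_bounded_diff g poly_ess_bounded E)
    obtain h where h: "trig_poly h" "\<forall>\<phi>\<in>\<Phi>. norm ((LINT z|\<nu>. \<phi> z * h z) - (LINT z|\<nu>. \<phi> z * g1 z)) < e / 2"
      using weak_approx_ess_bounded[OF g1] e unfolding weak_approx_def \<nu>_def by (meson half_gt_zero)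
    obtain d p where p: "\<forall>z\<in>sphere 0 1. h z * z ^ d = poly p z" using h(1) unfolding trig_poly_def by blast
    obtain C where C: "C > 0" "\<And>q. bloch_norm w (poly (p * q)) \<le> C * bloch_norm w (poly q)"
      using bloch_norm_poly_mult[of p] by blast
    obtain M where M: "M > 0" "\<And>z. z \<in> sphere 0 1 \<Longrightarrow> norm (h z) \<le> M"
      using continuous_on_circle_bounded[OF trig_poly_continuous_on[OF h(1)]] by blast
    define J where "J = 1 + (\<Sum>\<phi>\<in>\<Phi>. LINT z|\<nu>. norm (\<phi> z))"
    have J: "J > 0" "\<And>\<phi>. \<phi> \<in> \<Phi> \<Longrightarrow> (LINT z|\<nu>. norm (\<phi> z)) \<le> J"
    proof -
      show "J > 0" unfolding J_def by (intro add_pos_nonneg sum_nonneg) auto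
      show "(LINT z|\<nu>. norm (\<phi> z)) \<le> J" if "\<phi> \<in> \<Phi>" for \<phi>
        using member_le_sum[of \<phi> \<Phi> "\<lambda>\<phi>. LINT z|\<nu>. norm (\<phi> z)"] fin that by (simp add: J_def)
    qed
    \<comment> \<open>\<open>C\<close> bounds multiplication by \<open>p\<close> in the Bloch norm,
      \<open>M\<close> bounds \<open>h\<close> on the circle and \<open>J\<close> bounds the L^1
      norms of all functionals.\<close>
    define e' where "e' = min (e / (2 * C)) (e / (2 * (M * J)))"
    have e': "e' > 0" "C * e' \<le> e / 2" "M * e' * J \<le> e / 2"
    proof -
      show "e' > 0" using e C M J by (simp add: e'_def)
      have "C * e' \<le> C * (e / (2 * C))" using C by (intro mult_left_mono) (auto simp: e'_def)
      then show "C * e' \<le> e / 2" using C by simp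
      have "M * J * e' \<le> M * J * (e / (2 * (M * J)))" using M J by (intro mult_left_mono) (auto simp: e'_def)
      then show "M * e' * J \<le> e / 2" using M J by (simp add: mult_ac)
    qed
    obtain S where S: "bloch_norm w (poly S) < e'" "\<forall>z\<in>E. norm (z ^ d * poly S z - 1) < e'"
      using approx[OF e'(1)] by blast
    define Q where "Q = P0 + p * S"
    have Qz: "poly Q z = poly P0 z + poly (p * S) z" for z by (simp add: Q_def)
    show "\<exists>Q. bloch_norm w (\<lambda>z. f z - poly Q z) < e \<and>
        (\<forall>\<phi>\<in>\<Phi>. norm (pairing E \<phi> (Linf_class E (poly Q)) - pairing E \<phi> G) < e)"
    proof (intro exI[of _ Q] conjI ballI)
      have "bloch_norm w (\<lambda>z. 1 * (f z - poly P0 z) + (- 1) * poly (p * S) z) \<le>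
          norm (1 :: complex) * bloch_norm w (\<lambda>z. f z - poly P0 z) + norm (- 1 :: complex) * bloch_norm w (poly (p * S))"
        by (rule bloch_norm_lincomb(2)) (intro little_fin_norm little_diff fl poly_little)+
      also have "(\<lambda>z. 1 * (f z - poly P0 z) + (- 1) * poly (p * S) z) = (\<lambda>z. f z - poly Q z)"
        unfolding Qz by (simp add: algebra_simps)
      finally have "bloch_norm w (\<lambda>z. f z - poly Q z) \<le> bloch_norm w (\<lambda>z. f z - poly P0 z) + bloch_norm w (poly (p * S))"
        by (simp only: norm_one norm_minus_cancel mult_1)
      also have "bloch_norm w (poly (p * S)) \<le> C * e'"
        using C(2)[of S] S(1) C(1) mult_left_mono[of "bloch_norm w (poly S)" e' C] by linarith
      finally show "bloch_norm w (\<lambda>z. f z - poly Q z) < e" using P0 e'(2) by linarith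
      fix \<phi> assume \<phi>: "\<phi> \<in> \<Phi>"
      have int\<phi>: "integrable (\<mu>on E) \<phi>" using \<Phi> \<phi> by blast
      define k where "k = (\<lambda>z. poly (p * S) z - h z)"
      have hb: "h \<in> ess_bounded E" by (rule trig_ess_bounded[OF h(1)])
      have kb: "k \<in> ess_bounded E" unfolding k_def by (intro ess_bounded_diff poly_ess_bounded E hb)
      have kle: "norm (k z) \<le> M * e'" if z: "z \<in> E" for z
      proof -
        have zs: "z \<in> sphere 0 1" using sets_subset_circle[OF E z] .
        \<comment> \<open>On the circle \<open>p\<close> is \<open>h\<close> times
          \<open>z ^ d\<close>, so uniform closeness of \<open>z ^ d * S\<close> to 1 passes to
          \<open>p * S\<close> and \<open>h\<close>.\<close>
        have "k z = h z * (z ^ d * poly S z - 1)"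
          using p[rule_format, OF zs] by (simp add: k_def algebra_simps flip: p[rule_format, OF zs])
        then have "norm (k z) = norm (h z) * norm (z ^ d * poly S z - 1)" by (simp only: norm_mult)
        also have "\<dots> \<le> M * e'"
          using M(2)[OF zs] S(2)[rule_format, OF z] M(1) by (intro mult_mono) auto
        finally show ?thesis .
      qed
      have "(LINT z|\<nu>. \<phi> z * poly Q z) - (LINT z|\<nu>. \<phi> z * g z) = (LINT z|\<nu>. \<phi> z * poly Q z - \<phi> z * g z)"
        unfolding \<nu>_def
        by (intro Bochner_Integration.integral_diff[symmetric] integrable_mult_ess_bounded int\<phi> g poly_ess_bounded E)
      also have "(\<lambda>z. \<phi> z * poly Q z - \<phi> z * g z) = (\<lambda>z. (\<phi> z * h z - \<phi> z * g1 z) + \<phi> z * k z)"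
        unfolding Qz k_def g1_def by (auto simp: algebra_simps)
      also have "(LINT z|\<nu>. (\<phi> z * h z - \<phi> z * g1 z) + \<phi> z * k z) =
          ((LINT z|\<nu>. \<phi> z * h z) - (LINT z|\<nu>. \<phi> z * g1 z)) + (LINT z|\<nu>. \<phi> z * k z)"
        unfolding \<nu>_def
        using integrable_mult_ess_bounded[OF int\<phi> hb] integrable_mult_ess_bounded[OF int\<phi> g1]
          integrable_mult_ess_bounded[OF int\<phi> kb] by simp
      finally have "norm ((LINT z|\<nu>. \<phi> z * poly Q z) - (LINT z|\<nu>. \<phi> z * g z)) \<le>
          norm ((LINT z|\<nu>. \<phi> z * h z) - (LINT z|\<nu>. \<phi> z * g1 z)) + norm (LINT z|\<nu>. \<phi> z * k z)"
        by (simp only: norm_triangle_ineq)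
      also have "norm (LINT z|\<nu>. \<phi> z * k z) \<le> M * e' * (LINT z|\<nu>. norm (\<phi> z))"
        unfolding \<nu>_def by (rule norm_integral_mult_le[OF E int\<phi> kb kle])
      also have "\<dots> \<le> M * e' * J" using M e' J(2)[OF \<phi>] by (intro mult_left_mono) auto
      finally have "norm ((LINT z|\<nu>. \<phi> z * poly Q z) - (LINT z|\<nu>. \<phi> z * g z)) < e"
        using h(2)[rule_format, OF \<phi>] e'(3) by linarith
      then show "norm (pairing E \<phi> (Linf_class E (poly Q)) - pairing E \<phi> G) < e"
        unfolding g(2) pairing_Linf_class[OF int\<phi> g(1)] pairing_Linf_class[OF int\<phi> poly_ess_bounded[OF E]] \<nu>_def .
    qed
  qed
qed

section \<open>Convergent integral: the L^2 bound and rigidity\<close>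

lemma hardy_bound:
  assumes fin: "(\<integral>\<^sup>+t\<in>{0<..1}. ennreal ((w t)^2 / t) \<partial>lborel) \<noteq> \<infinity>"
  obtains C where "C \<ge> 0" "\<And>Q. (LINT z|\<mu>. (norm (poly Q z))^2) \<le> C * (bloch_norm w (poly Q))^2"
proof -
  define I where "I = enn2real (\<integral>\<^sup>+t\<in>{0<..1}. ennreal ((w t)^2 / t) \<partial>lborel)"
  have I: "I \<ge> 0" "(\<integral>\<^sup>+t\<in>{0<..1}. ennreal ((w t)^2 / t) \<partial>lborel) = ennreal I"
    using fin by (auto simp: I_def top.not_eq_extremum)
  show ?thesis
  \<comment> \<open>1 accounts for the constant coefficient, 4 for comparing
    \<open>(2 * k + 1) * (2 * k + 2)\<close> with \<open>(Suc k)^2\<close>.\<close>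
  proof (rule that[of "1 + 4 * I"])
    show "1 + 4 * I \<ge> 0" using I by simp
    fix Q :: "complex poly"
    define N where "N = bloch_norm w (poly Q)"
    have N: "N \<ge> 0" unfolding N_def by (rule bloch_norm_nonneg[OF poly_fin_norm])
    define n where "n = degree Q"
    \<comment> \<open>Squared moduli of the Taylor coefficients of the derivative of
      \<open>Q\<close>.\<close>
    define c where "c = (\<lambda>k. (norm (of_nat (Suc k) * coeff Q (Suc k)))^2)"
    have pars: "(\<Sum>k<n. c k * (1 - t) ^ (2 * k)) * t \<le> N^2 * ((w t)^2 / t)" if t: "0 < t" "t \<le> 1" for t
    proof -
      have "(\<Sum>k<n. c k * (1 - t) ^ (2 * k)) = (\<Sum>k<n. (norm (of_nat (Suc k) * coeff Q (Suc k) * of_real (1 - t) ^ k))^2)"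
        using t by (intro sum.cong refl) (simp add: c_def norm_mult norm_power power_mult_distrib power_mult[symmetric] mult.commute power_even_abs del: of_nat_Suc of_real_diff)
      also have "\<dots> = (LINT z|\<mu>. (norm (\<Sum>k<n. (of_nat (Suc k) * coeff Q (Suc k) * of_real (1 - t) ^ k) * z ^ k))^2)"
        by (rule parseval_circle[symmetric]) simp
      also have "\<dots> = (LINT z|\<mu>. (norm (poly (pderiv Q) (of_real (1 - t) * z)))^2)"
      proof (intro Bochner_Integration.integral_cong refl)
        fix z
        have "poly (pderiv Q) x = (\<Sum>k<n. of_nat (Suc k) * coeff Q (Suc k) * x ^ k)" for x
        proof (cases "n = 0")
          case True
          then have "pderiv Q = 0" by (simp add: n_def pderiv_eq_0_iff)
          then show ?thesis using True by simp
        next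
          case False
          then have "{..degree (pderiv Q)} = {..<n}" by (auto simp: degree_pderiv n_def)
          then show ?thesis unfolding poly_altdef by (simp add: coeff_pderiv)
        qed
        then show "(norm (\<Sum>k<n. (of_nat (Suc k) * coeff Q (Suc k) * of_real (1 - t) ^ k) * z ^ k))^2 =
            (norm (poly (pderiv Q) (of_real (1 - t) * z)))^2"
          by (simp add: power_mult_distrib mult_ac del: of_nat_Suc of_real_diff)
      qed
      also have "\<dots> \<le> (LINT z|\<mu>. (N * (w t / t))^2)"
      proof (intro integral_circle_mono continuous_intros power_mono norm_ge_zero)
        fix z :: complex assume z: "z \<in> sphere 0 1"
        have nz: "norm (of_real (1 - t) * z) = 1 - t" using z t by (simp add: norm_mult del: of_real_diff)
        then have "of_real (1 - t) * z \<in> unit_disc" using t by simp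
        from deriv_le_bloch_norm[OF poly_fin_norm this, of Q]
        have "(t / w t) * norm (poly (pderiv Q) (of_real (1 - t) * z)) \<le> N"
          by (simp add: \<rho>_def nz N_def del: of_real_diff)
        then show "norm (poly (pderiv Q) (of_real (1 - t) * z)) \<le> N * (w t / t)"
          using t pos_w[of t] by (simp add: field_simps del: of_real_diff)
      qed
      also have "\<dots> = (N * (w t / t))^2" by simp
      finally have "(\<Sum>k<n. c k * (1 - t) ^ (2 * k)) * t \<le> (N * (w t / t))^2 * t"
        using t by (intro mult_right_mono) auto
      also have "\<dots> = N^2 * ((w t)^2 / t)" using t by (simp add: power_mult_distrib power_divide power2_eq_square)
      finally show ?thesis .
    qed
    \<comment> \<open>Write \<open>t\<close> as \<open>1 - (1 - t)\<close>. The value is comparable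
      to \<open>1 / (k + 1)^2\<close> and so removes the factor that differentiation put into
      \<open>c\<close>.\<close>
    have int: "(\<integral>\<^sup>+t\<in>{0..1}. ennreal ((1 - t) ^ (2 * k) * t) \<partial>lborel) = ennreal (1 / (real (2 * k + 1) * real (2 * k + 2)))" for k :: nat
    proof -
      have dp: "((\<lambda>t. (1 - t) ^ Suc n / real (Suc n)) has_real_derivative - ((1 - t) ^ n)) (at t)" for n and t :: real
      proof -
        have "((\<lambda>t. 1 - t) has_real_derivative - 1) (at t)" by (auto intro!: derivative_eq_intros)
        from DERIV_cdivide[OF DERIV_power[OF this, of "Suc n"], of "real (Suc n)"] show ?thesis
          by (simp del: of_nat_Suc power_Suc)
      qed
      define F where "F = (\<lambda>t::real. (1 - t) ^ Suc (2 * k + 1) / real (Suc (2 * k + 1)) - (1 - t) ^ Suc (2 * k) / real (Suc (2 * k)))"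
      have "(\<integral>\<^sup>+t\<in>{0..1}. ennreal ((1 - t) ^ (2 * k) * t) \<partial>lborel) = ennreal (F 1 - F 0)"
      proof (rule nn_integral_FTC_Icc)
        fix t :: real
        have "- ((1 - t) ^ (2 * k + 1)) - - ((1 - t) ^ (2 * k)) = (1 - t) ^ (2 * k) * t"
          by (simp add: algebra_simps)
        then show "(F has_real_derivative (1 - t) ^ (2 * k) * t) (at t)"
          using DERIV_diff[OF dp[of "2 * k + 1" t] dp[of "2 * k" t]] unfolding F_def by (simp only:)
      qed auto
      also have "F 1 - F 0 = 1 / (real (2 * k + 1) * real (2 * k + 2))"
        by (simp add: F_def field_simps)
      finally show ?thesis .
    qed
    have "(\<Sum>k<n. c k * (1 / (real (2 * k + 1) * real (2 * k + 2)))) \<le> N^2 * I"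
    proof -
      have c0: "c k \<ge> 0" for k by (simp add: c_def)
      have "ennreal (\<Sum>k<n. c k * (1 / (real (2 * k + 1) * real (2 * k + 2)))) =
          (\<Sum>k<n. ennreal (c k) * ennreal (1 / (real (2 * k + 1) * real (2 * k + 2))))"
        using c0 by (simp add: sum_ennreal ennreal_mult[symmetric] del: of_nat_add of_nat_mult of_nat_Suc)
      also have "\<dots> = (\<Sum>k<n. \<integral>\<^sup>+t. ennreal (c k) * (ennreal ((1 - t) ^ (2 * k) * t) * indicator {0..1} t) \<partial>lborel)"
        unfolding int[symmetric] by (intro sum.cong refl nn_integral_cmult[symmetric]) measurable
      also have "\<dots> = (\<integral>\<^sup>+t. (\<Sum>k<n. ennreal (c k) * (ennreal ((1 - t) ^ (2 * k) * t) * indicator {0..1} t)) \<partial>lborel)"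
        by (rule nn_integral_sum[symmetric]) measurable
      also have "\<dots> \<le> (\<integral>\<^sup>+t. ennreal (N^2) * (ennreal ((w t)^2 / t) * indicator {0<..1} t) \<partial>lborel)"
      proof (intro nn_integral_mono)
        fix t :: real
        show "(\<Sum>k<n. ennreal (c k) * (ennreal ((1 - t) ^ (2 * k) * t) * indicator {0..1} t)) \<le>
            ennreal (N^2) * (ennreal ((w t)^2 / t) * indicator {0<..1} t)"
        proof (cases "t \<in> {0<..1}")
          case True
          then have nn: "0 \<le> (1 - t) ^ (2 * k) * t" for k by simp
          have "(\<Sum>k<n. ennreal (c k) * (ennreal ((1 - t) ^ (2 * k) * t) * indicator {0..1} t)) =
              (\<Sum>k<n. ennreal (c k * ((1 - t) ^ (2 * k) * t)))"
            using True by (intro sum.cong refl) (simp add: ennreal_mult[OF c0 nn] del: zero_le_mult_iff)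
          also have "\<dots> = ennreal (\<Sum>k<n. c k * ((1 - t) ^ (2 * k) * t))"
            by (rule sum_ennreal) (rule mult_nonneg_nonneg[OF c0 nn])
          also have "(\<Sum>k<n. c k * ((1 - t) ^ (2 * k) * t)) = (\<Sum>k<n. c k * (1 - t) ^ (2 * k)) * t"
            by (simp only: sum_distrib_right mult.assoc)
          also have "ennreal \<dots> \<le> ennreal (N^2 * ((w t)^2 / t))" using pars[of t] True by (intro ennreal_leI) auto
          also have "\<dots> = ennreal (N^2) * ennreal ((w t)^2 / t)"
            using True by (intro ennreal_mult) auto
          also have "\<dots> = ennreal (N^2) * (ennreal ((w t)^2 / t) * indicator {0<..1} t)"
            using True by simp
          finally show ?thesis .
        next
          case False
          \<comment> \<open>The two indicators differ only at \<open>t = 0\<close>, where the factor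
            \<open>t\<close> makes the left side vanish.\<close>
          then have "t = 0 \<or> t \<notin> {0..1}" by auto
          then show ?thesis by auto
        qed
      qed
      also have "\<dots> = ennreal (N^2) * ennreal I"
      proof -
        have "(\<lambda>t. ennreal ((w t)^2 / t) * indicator {0<..1} t) \<in> borel_measurable lborel"
        proof -
          have "continuous_on {0<..1} (\<lambda>t. (w t)^2 / t)"
            by (intro continuous_intros continuous_on_subset[OF cont_w]) auto
          then have "(\<lambda>t. indicator {0<..1} t *\<^sub>R ((w t)^2 / t)) \<in> borel_measurable borel"
            by (intro borel_measurable_continuous_on_indicator) auto
          then have "(\<lambda>t. ennreal (indicator {0<..1} t *\<^sub>R ((w t)^2 / t))) \<in> borel_measurable borel" by measurable
          also have "(\<lambda>t. ennreal (indicator {0<..1} t *\<^sub>R ((w t)^2 / t))) = (\<lambda>t. ennreal ((w t)^2 / t) * indicator {0<..1} t)"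
            by (auto simp: indicator_def)
          finally show ?thesis by simp
        qed
        then show ?thesis using I(2) by (simp add: nn_integral_cmult)
      qed
      also have "\<dots> = ennreal (N^2 * I)" using I(1) by (simp add: ennreal_mult)
      finally show ?thesis using I(1) by (simp add: ennreal_le_iff)
    qed
    moreover have "(\<Sum>k<n. (norm (coeff Q (Suc k)))^2) \<le> 4 * (\<Sum>k<n. c k * (1 / (real (2 * k + 1) * real (2 * k + 2))))"
      unfolding sum_distrib_left
    proof (intro sum_mono)
      fix k :: nat
      have "1 \<le> 4 * ((real (Suc k))^2 * (1 / (real (2 * k + 1) * real (2 * k + 2))))"
      proof -
        define D where "D = real (2 * k + 1) * real (2 * k + 2)"
        have "D > 0" "D \<le> 4 * (real (Suc k))^2"
          by (simp_all add: D_def power2_eq_square algebra_simps add_pos_nonneg)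
        then have "1 \<le> 4 * ((real (Suc k))^2 * (1 / D))"
          by (simp add: le_divide_eq del: of_nat_Suc)
        then show ?thesis unfolding D_def .
      qed
      then have "(norm (coeff Q (Suc k)))^2 * 1 \<le> (norm (coeff Q (Suc k)))^2 * (4 * ((real (Suc k))^2 * (1 / (real (2 * k + 1) * real (2 * k + 2)))))"
        by (intro mult_left_mono) auto
      also have "\<dots> = 4 * (c k * (1 / (real (2 * k + 1) * real (2 * k + 2))))"
        unfolding c_def norm_mult norm_of_nat power_mult_distrib by (simp only: mult_ac)
      finally show "(norm (coeff Q (Suc k)))^2 \<le> 4 * (c k * (1 / (real (2 * k + 1) * real (2 * k + 2))))" by simp
    qed
    moreover have "(norm (coeff Q 0))^2 \<le> N^2"
      using norm_0_le_bloch_norm[OF poly_fin_norm, of Q] unfolding N_def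
      by (intro power_mono) (auto simp: poly_0_coeff_0)
    moreover have "(LINT z|\<mu>. (norm (poly Q z))^2) = (norm (coeff Q 0))^2 + (\<Sum>k<n. (norm (coeff Q (Suc k)))^2)"
    proof -
      have "(LINT z|\<mu>. (norm (poly Q z))^2) = (LINT z|\<mu>. (norm (\<Sum>k\<le>n. coeff Q k * z ^ k))^2)"
        by (simp add: poly_altdef n_def)
      also have "\<dots> = (\<Sum>k\<le>n. (norm (coeff Q k))^2)" by (rule parseval_circle) simp
      also have "\<dots> = (norm (coeff Q 0))^2 + (\<Sum>k<n. (norm (coeff Q (Suc k)))^2)"
        by (rule sum.atMost_shift)
      finally show ?thesis .
    qed
    ultimately show "(LINT z|\<mu>. (norm (poly Q z))^2) \<le> (1 + 4 * I) * (bloch_norm w (poly Q))^2"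
      unfolding N_def[symmetric] by (simp add: algebra_simps)
  qed
qed

lemma integral_restrict_le:
  fixes f :: "complex \<Rightarrow> real"
  assumes "E \<in> sets \<mu>" "continuous_on (sphere 0 1) f" "\<And>z. z \<in> sphere 0 1 \<Longrightarrow> 0 \<le> f z"
  shows "(LINT z|\<mu>on E. f z) \<le> (LINT z|\<mu>. f z)"
proof -
  have "(LINT z|\<mu>on E. f z) = (LINT z|\<mu>. indicator E z *\<^sub>R f z)"
    using assms(1) sets.sets_into_space[OF assms(1)] by (intro integral_restrict_space) (simp add: Int_absorb2)
  also have "\<dots> \<le> (LINT z|\<mu>. f z)"
    using assms
    by (intro integral_mono integrable_mult_indicator continuous_on_circle_integrable)
       (auto simp: indicator_def)
  finally show ?thesis .
qed

text \<open>The test functional is the conjugate of \<open>D = g1 - g2\<close>, whose pairing with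
  \<open>D\<close> is the squared L^2 norm of \<open>D\<close> on \<open>E\<close>. That pairing is
  close to the one with \<open>R = Q1 - Q2\<close>, where both polynomials are close to
  \<open>f\<close>; hence \<open>R\<close> is small in the Bloch norm, and by the L^2 bound on the
  circle.\<close>

lemma rigidity_of_finite_integral:
  assumes fin: "(\<integral>\<^sup>+t\<in>{0<..1}. ennreal ((w t)^2 / t) \<partial>lborel) \<noteq> \<infinity>"
    and E: "E \<in> sets \<mu>"
  shows "rigidity_set (bloch0 w) (bloch_norm w) E"
  unfolding rigidity_set_def
proof (rule inj_onI, clarsimp)
  fix f G1 G2
  assume cl: "(f, G1) \<in> poly_closure (bloch0 w) (bloch_norm w) E" "(f, G2) \<in> poly_closure (bloch0 w) (bloch_norm w) E"
  define \<nu> where "\<nu> = \<mu>on E"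
  interpret \<nu>: finite_measure \<nu> unfolding \<nu>_def by (rule finite_measure_restrict_circle[OF E])
  have f: "f \<in> little" and G: "G1 \<in> Linf E" "G2 \<in> Linf E"
    using cl poly_closure_subset bloch0_little by auto
  obtain g1 g2 where g: "g1 \<in> ess_bounded E" "G1 = Linf_class E g1" "g2 \<in> ess_bounded E" "G2 = Linf_class E g2"
    using LinfE[OF G(1)] LinfE[OF G(2)] by metis
  define D where "D = (\<lambda>z. g1 z - g2 z)"
  have D: "D \<in> ess_bounded E" unfolding D_def by (intro ess_bounded_diff g)
  obtain C where C: "C \<ge> 0" "AE z in \<nu>. norm (D z) \<le> C" using ess_boundedD[OF D] unfolding \<nu>_def by blast
  define \<phi> where "\<phi> = (\<lambda>z. cnj (D z))"
  have Dm: "D \<in> borel_measurable \<nu>" unfolding \<nu>_def by (rule ess_bounded_measurable[OF D])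
  have \<phi>m: "\<phi> \<in> borel_measurable \<nu>" unfolding \<phi>_def using Dm
    by (intro measurable_compose[OF Dm] borel_measurable_continuous_onI continuous_intros)
  have \<phi>C: "AE z in \<nu>. norm (\<phi> z) \<le> C" using C(2) by (simp add: \<phi>_def)
  have \<phi>: "integrable (\<mu>on E) \<phi>"
    using \<nu>.integrable_const_bound[OF \<phi>C \<phi>m] by (simp add: \<nu>_def)
  note pairing = pairing_Linf_class[OF \<phi>, folded \<nu>_def]
  obtain B where B: "B \<ge> 0" "\<And>Q. (LINT z|\<mu>. (norm (poly Q z))^2) \<le> B * (bloch_norm w (poly Q))^2"
    using hardy_bound[OF fin] by blast
  \<comment> \<open>Each of the two weak approximations contributes \<open>e\<close>. The rest is
    \<open>C\<close> times the L^1 norm of \<open>R\<close>, bounded by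
    \<open>e / 2 + |R|^2 / (2 * e)\<close> pointwise, with the mean of \<open>|R|^2\<close> at most
    \<open>B * (2 * e)^2\<close>.\<close>
  have small: "(LINT z|\<nu>. (norm (D z))^2) \<le> (2 + C * (1 / 2 + 2 * B)) * e" if e: "e > 0" for e
  proof -
    obtain Q1 where Q1: "bloch_norm w (\<lambda>z. f z - poly Q1 z) < e"
      "norm (pairing E \<phi> (Linf_class E (poly Q1)) - pairing E \<phi> G1) < e"
      using in_poly_closureD[OF E cl(1) \<phi> e] .
    obtain Q2 where Q2: "bloch_norm w (\<lambda>z. f z - poly Q2 z) < e"
      "norm (pairing E \<phi> (Linf_class E (poly Q2)) - pairing E \<phi> G2) < e"
      using in_poly_closureD[OF E cl(2) \<phi> e] .
    define R where "R = Q1 - Q2"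
    have Rz: "poly R z = poly Q1 z - poly Q2 z" for z by (simp add: R_def)
    have "bloch_norm w (poly R) = bloch_norm w (\<lambda>z. poly Q1 z - poly Q2 z)"
      by (rule bloch_norm_cong) (rule Rz)
    also have "\<dots> \<le> bloch_norm w (\<lambda>z. poly Q1 z - f z) + bloch_norm w (\<lambda>z. f z - poly Q2 z)"
      by (rule bloch_norm_diff_triangle[OF poly_little f poly_little])
    also have "\<dots> \<le> 2 * e" using Q1(1) Q2(1) bloch_norm_diff_commute[OF poly_little f, of Q1] by simp
    finally have "B * (bloch_norm w (poly R))^2 \<le> B * (2 * e)^2"
      using B(1) bloch_norm_nonneg[OF poly_fin_norm, of R] by (intro mult_left_mono power_mono) auto
    then have R2: "(LINT z|\<mu>. (norm (poly R z))^2) \<le> B * (2 * e)^2" using B(2)[of R] by linarith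
    have "(LINT z|\<nu>. norm (poly R z)) \<le> (LINT z|\<mu>. norm (poly R z))"
      unfolding \<nu>_def by (intro integral_restrict_le E continuous_intros) auto
    also have "\<dots> \<le> (LINT z|\<mu>. e / 2 + (norm (poly R z))^2 / (2 * e))"
    proof (intro integral_circle_mono continuous_intros)
      fix z
      have "0 \<le> (norm (poly R z) - e)^2 / (2 * e)" using e by simp
      also have "\<dots> = e / 2 + (norm (poly R z))^2 / (2 * e) - norm (poly R z)"
        using e by (simp add: field_simps power2_eq_square)
      finally show "norm (poly R z) \<le> e / 2 + (norm (poly R z))^2 / (2 * e)" by simp
    qed (use e in auto)
    also have "\<dots> = e / 2 + (LINT z|\<mu>. (norm (poly R z))^2) / (2 * e)"
      using e by (subst Bochner_Integration.integral_add) (auto intro!: continuous_on_circle_integrable continuous_intros)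
    also have "\<dots> \<le> e / 2 + B * (2 * e)^2 / (2 * e)"
      using R2 e by (intro add_left_mono divide_right_mono) auto
    also have "\<dots> = (1 / 2 + 2 * B) * e" using e by (simp add: power2_eq_square algebra_simps)
    finally have R1: "(LINT z|\<nu>. norm (poly R z)) \<le> (1 / 2 + 2 * B) * e" .
    have "norm (LINT z|\<nu>. \<phi> z * poly R z) \<le> (LINT z|\<nu>. norm (\<phi> z * poly R z))" by (rule integral_norm_bound)
    also have "\<dots> \<le> (LINT z|\<nu>. C * norm (poly R z))"
    proof (rule integral_mono_AE)
      show "integrable \<nu> (\<lambda>z. norm (\<phi> z * poly R z))"
        unfolding \<nu>_def by (intro integrable_norm integrable_mult_ess_bounded \<phi> poly_ess_bounded E)
      show "integrable \<nu> (\<lambda>z. C * norm (poly R z))"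
        unfolding \<nu>_def using integrable_mult_ess_bounded[OF _ poly_ess_bounded[OF E, of R], of "\<lambda>_. 1"] \<nu>.integrable_const[of 1]
        by (intro integrable_mult_right integrable_norm) (simp add: \<nu>_def)
      show "AE z in \<nu>. norm (\<phi> z * poly R z) \<le> C * norm (poly R z)"
        using \<phi>C by eventually_elim (simp add: norm_mult mult_right_mono)
    qed
    also have "\<dots> \<le> C * ((1 / 2 + 2 * B) * e)"
      using R1 C(1) by (simp add: mult_left_mono)
    finally have main: "norm (LINT z|\<nu>. \<phi> z * poly R z) \<le> C * ((1 / 2 + 2 * B) * e)" .
    have intm: "integrable \<nu> (\<lambda>z. \<phi> z * h z)" if "h \<in> ess_bounded E" for h
      unfolding \<nu>_def by (rule integrable_mult_ess_bounded[OF \<phi> that])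
    have eqR: "(LINT z|\<nu>. \<phi> z * poly R z) = (LINT z|\<nu>. \<phi> z * poly Q1 z) - (LINT z|\<nu>. \<phi> z * poly Q2 z)"
      unfolding Rz right_diff_distrib by (intro Bochner_Integration.integral_diff intm poly_ess_bounded E)
    have eqD: "(LINT z|\<nu>. \<phi> z * D z) = (LINT z|\<nu>. \<phi> z * g1 z) - (LINT z|\<nu>. \<phi> z * g2 z)"
      unfolding D_def right_diff_distrib by (intro Bochner_Integration.integral_diff intm g)
    have "complex_of_real (LINT z|\<nu>. (norm (D z))^2) = (LINT z|\<nu>. \<phi> z * D z)"
      unfolding integral_complex_of_real[symmetric]
      by (intro Bochner_Integration.integral_cong refl) (simp only: complex_norm_square \<phi>_def mult.commute)
    also have "\<dots> = (LINT z|\<nu>. \<phi> z * poly R z) - ((LINT z|\<nu>. \<phi> z * poly Q1 z) - (LINT z|\<nu>. \<phi> z * g1 z))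
        + ((LINT z|\<nu>. \<phi> z * poly Q2 z) - (LINT z|\<nu>. \<phi> z * g2 z))"
      unfolding eqR eqD by simp
    finally have "norm (complex_of_real (LINT z|\<nu>. (norm (D z))^2)) \<le> norm (LINT z|\<nu>. \<phi> z * poly R z)
        + norm ((LINT z|\<nu>. \<phi> z * poly Q1 z) - (LINT z|\<nu>. \<phi> z * g1 z))
        + norm ((LINT z|\<nu>. \<phi> z * poly Q2 z) - (LINT z|\<nu>. \<phi> z * g2 z))"
      by (simp only:) (intro order_trans[OF norm_triangle_ineq] add_right_mono norm_triangle_ineq4)
    moreover have "norm ((LINT z|\<nu>. \<phi> z * poly Q1 z) - (LINT z|\<nu>. \<phi> z * g1 z)) < e"
      using Q1(2) unfolding g(2) pairing[OF g(1)] pairing[OF poly_ess_bounded[OF E]] .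
    moreover have "norm ((LINT z|\<nu>. \<phi> z * poly Q2 z) - (LINT z|\<nu>. \<phi> z * g2 z)) < e"
      using Q2(2) unfolding g(4) pairing[OF g(3)] pairing[OF poly_ess_bounded[OF E]] .
    ultimately have "\<bar>LINT z|\<nu>. (norm (D z))^2\<bar> \<le> C * ((1 / 2 + 2 * B) * e) + e + e"
      using main unfolding norm_of_real by linarith
    then show ?thesis by (simp add: algebra_simps)
  qed
  have nonneg: "0 \<le> (LINT z|\<nu>. (norm (D z))^2)" by simp
  have "(LINT z|\<nu>. (norm (D z))^2) = 0"
  proof (rule ccontr)
    assume "(LINT z|\<nu>. (norm (D z))^2) \<noteq> 0"
    then have pos: "0 < (LINT z|\<nu>. (norm (D z))^2)" using nonneg by linarith
    define A where "A = 2 + C * (1 / 2 + 2 * B)"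
    have A: "A > 0" using B(1) C(1) by (simp add: A_def add_pos_nonneg)
    \<comment> \<open>This choice of \<open>e\<close> would bound the positive integral by half of
      itself.\<close>
    have "(LINT z|\<nu>. (norm (D z))^2) \<le> A * ((LINT z|\<nu>. (norm (D z))^2) / (2 * A))"
      unfolding A_def by (rule small) (use pos A in \<open>simp add: A_def\<close>)
    then show False using A pos by simp
  qed
  moreover have "integrable \<nu> (\<lambda>z. (norm (D z))^2)"
  proof (rule \<nu>.integrable_const_bound)
    show "AE z in \<nu>. norm ((norm (D z))^2) \<le> C^2" using C(2) by eventually_elim (simp add: power_mono)
    show "(\<lambda>z. (norm (D z))^2) \<in> borel_measurable \<nu>" using Dm by measurable
  qed
  ultimately have "AE z in \<nu>. (norm (D z))^2 = 0"
    by (subst (asm) integral_nonneg_eq_0_iff_AE) auto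
  then have "AE z in \<mu>on E. g1 z = g2 z" unfolding \<nu>_def by (simp add: D_def)
  then show "G1 = G2" unfolding g(2,4) using Linf_class_eq_iff[OF g(1,3)] by blast
qed

text \<open>With both properties the projection would be injective on the full product, so the
  classes of the constants 0 and 1 would coincide; on a set of positive measure they do not.\<close>

lemma rigidity_not_SA:
  assumes E: "E \<in> sets \<mu>" "emeasure \<mu> E > 0"
    and "rigidity_set (bloch0 w) (bloch_norm w) E" "SA_property (bloch0 w) (bloch_norm w) E"
  shows False
proof -
  define f where "f = restrict (poly 0) unit_disc"
  have f: "f \<in> bloch0 w" unfolding f_def by (rule restrict_poly_bloch0)
  have b: "poly 0 \<in> ess_bounded E" "poly 1 \<in> ess_bounded E" using poly_ess_bounded[OF E(1)] by auto
  have "inj_on fst (bloch0 w \<times> Linf E)"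
    using assms(3,4) unfolding rigidity_set_def SA_property_def by simp
  then have "(f, Linf_class E (poly 0)) = (f, Linf_class E (poly 1))"
    by (rule inj_onD) (use f Linf_class_in[OF b(1)] Linf_class_in[OF b(2)] in auto)
  then have "AE z in \<mu>on E. poly 0 z = (poly 1 z :: complex)"
    using Linf_class_eq_iff[OF b] by simp
  then have "AE z in \<mu>on E. False" by simp
  then have "emeasure (\<mu>on E) (space (\<mu>on E)) = 0"
    unfolding eventually_False ae_filter_eq_bot_iff .
  then have "emeasure (\<mu>on E) E = 0"
    by (simp only: space_restrict_circle[OF E(1)])
  then have "emeasure \<mu> E = 0"
    using emeasure_restrict_space[of E \<mu> E] E(1) sets.Int_space_eq2[OF E(1)] by simp
  then show False using E(2) by simp
qed

end

theorem theorem2p1: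
  fixes w :: "real \<Rightarrow> real"
  assumes "majorant w"
  shows "((\<exists>E\<in>sets circle_measure. emeasure circle_measure E > 0 \<and>
             SA_property (bloch0 w) (bloch_norm w) E)
           \<longleftrightarrow> (\<integral>\<^sup>+t\<in>{0<..1}. ennreal ((w t)\<^sup>2 / t) \<partial>lborel) = \<infinity>)
       \<and> ((\<integral>\<^sup>+t\<in>{0<..1}. ennreal ((w t)\<^sup>2 / t) \<partial>lborel) \<noteq> \<infinity> \<longrightarrow>
           (\<forall>E\<in>sets circle_measure. emeasure circle_measure E > 0 \<longrightarrow>
             rigidity_set (bloch0 w) (bloch_norm w) E))"
proof -
  obtain \<alpha> where "majorant_weight w \<alpha>" using majorant_weightE[OF assms] .
  then interpret majorant_weight w \<alpha> .
  have "\<exists>E\<in>sets circle_measure. emeasure circle_measure E > 0 \<and> SA_property (bloch0 w) (bloch_norm w) E"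
    if inf: "(\<integral>\<^sup>+t\<in>{0<..1}. ennreal ((w t)\<^sup>2 / t) \<partial>lborel) = \<infinity>"
  proof -
    obtain E where E: "E \<in> sets circle_measure" "measure circle_measure E > 0"
      "\<And>d e. e > 0 \<Longrightarrow> \<exists>P. bloch_norm w (poly P) < e \<and> (\<forall>z\<in>E. norm (z ^ d * poly P z - 1) < e)"
      using approximation_set[OF dyadic_diverges[OF inf]] by metis
    then show ?thesis
      using SA_property_of_approximation_set[OF E(1,3)] by (auto simp: circle.emeasure_eq_measure)
  qed
  \<comment> \<open>Rigidity for a convergent integral excludes the SA-property, which is the
    remaining direction of the equivalence.\<close>
  then show ?thesis using rigidity_of_finite_integral rigidity_not_SA by blast
qed

end
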